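(* Fix a positive integer $d$. There is an algorithm that, given an integer $m\times n$ matrix $A$, weight vectors $w_1,\dots,w_d\in\mathbb{Z}^n$, and a function $f:\mathbb{R}^d\to\mathbb{R}$ presented by a comparison oracle, solves the nonlinear matroid optimization problem over the vectorial matroid of $A$ (finds a base $B$ minimizing $f(W(B))$) in time polynomial in $\langle A\rangle$ and $\max_{i,j}|w_{i,j}|$.
   Context: The vectorial matroid of $A$ has ground set $N=\{1,\dots,n\}$ (indexing the columns of $A$), and its bases are the index sets of maximal linearly independent subsets of columns of $A$ (over the rationals). For $S\subseteq N$, $W(S):=(w_1(S),\dots,w_d(S))$ with $w_i(S)=\sum_{j\in S}w_{i,j}$. A comparison oracle for $f$, queried on $x,y\in\mathbb{Z}^d$, answers whether $f(x)\le f(y)$; running time counts oracle queries. $\langle A\rangle=\sum_{i,j}\langle a_{i,j}\rangle$ is the binary length of $A$, where $\langle z\rangle=1+\lceil\log_2(|z|+1)\rceil$. *)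

theory Defs
  imports
    Complex_Main
    "HOL-Computational_Algebra.Polynomial"
    "Jordan_Normal_Form.VS_Connect"
begin

section \<open>Vectorial matroids\<close>

text \<open>
  Columns and rows are indexed from 0, so the ground set is \<open>{0..<dim_col A}\<close>.
  The ground set consists of indices, not of column vectors: an index set containing two equal
  columns is dependent, whence the injectivity condition.
\<close>

definition vectorial_indep :: "int mat \<Rightarrow> nat set \<Rightarrow> bool" where
  "vectorial_indep A S \<longleftrightarrow>
     S \<subseteq> {0..<dim_col A} \<and>
     inj_on (col (map_mat rat_of_int A)) S \<and>
     \<not> LinearCombinations.module.lin_dep class_ring (module_vec TYPE(rat) (dim_row A))
         (col (map_mat rat_of_int A) ` S)"

definition vectorial_base :: "int mat \<Rightarrow> nat set \<Rightarrow> bool" where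
  "vectorial_base A B \<longleftrightarrow>
     vectorial_indep A B \<and> (\<forall>S. vectorial_indep A S \<and> B \<subseteq> S \<longrightarrow> S = B)"

definition weight_vec :: "nat \<Rightarrow> (nat \<Rightarrow> int vec) \<Rightarrow> nat set \<Rightarrow> int vec" where
  "weight_vec d w S = vec d (\<lambda>i. \<Sum>j\<in>S. w i $ j)"

definition optimal_base ::
  "nat \<Rightarrow> int mat \<Rightarrow> (nat \<Rightarrow> int vec) \<Rightarrow> (real vec \<Rightarrow> real) \<Rightarrow> nat set \<Rightarrow> bool" where
  "optimal_base d A w f B \<longleftrightarrow>
     vectorial_base A B \<and>
     (\<forall>B'. vectorial_base A B' \<longrightarrow>
        f (map_vec real_of_int (weight_vec d w B)) \<le> f (map_vec real_of_int (weight_vec d w B')))"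

section \<open>Binary length\<close>

definition bin_length :: "int \<Rightarrow> nat" where
  "bin_length z = 1 + nat \<lceil>log 2 (real_of_int (\<bar>z\<bar> + 1))\<rceil>"

definition mat_bin_length :: "int mat \<Rightarrow> nat" where
  "mat_bin_length A = (\<Sum>i<dim_row A. \<Sum>j<dim_col A. bin_length (A $$ (i, j)))"

definition max_abs_weight :: "nat \<Rightarrow> nat \<Rightarrow> (nat \<Rightarrow> int vec) \<Rightarrow> nat" where
  "max_abs_weight d n w = Max {nat \<bar>w i $ j\<bar> | i j. i < d \<and> j < n}"

section \<open>Algorithms with a comparison oracle\<close>

text \<open>
  Algorithms are programs of a small imperative language whose state is a finite binary tree with
  integer leaves. Time is measured by the logarithmic cost criterion: every
  instruction is charged one unit plus the binary length of the whole state it is applied to, so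
  that copying data, reading an input and submitting an oracle query are all paid for in full. In
  particular the binary length of every intermediate result is at most a constant, depending on the
  program only, times the time spent so far, and each instruction is a polynomial-time
  operation on bit strings. Up to a polynomial, this running time is that of an oracle Turing
  machine.
\<close>

datatype val = Leaf int | Node val val

fun val_length :: "val \<Rightarrow> nat" where
  "val_length (Leaf z) = bin_length z"
| "val_length (Node u v) = 1 + val_length u + val_length v"

datatype instr = Const int | Id | Fst | Snd | IsNode | Add | Sub | Mult | Quo | Rem | Le

fun apply_instr :: "instr \<Rightarrow> val \<Rightarrow> val option" where
  "apply_instr (Const c) v = Some (Leaf c)"
| "apply_instr Id v = Some v"
| "apply_instr Fst (Node u v) = Some u"
| "apply_instr Snd (Node u v) = Some v"
| "apply_instr IsNode (Leaf z) = Some (Leaf 0)"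
| "apply_instr IsNode (Node u v) = Some (Leaf 1)"
| "apply_instr Add (Node (Leaf a) (Leaf b)) = Some (Leaf (a + b))"
| "apply_instr Sub (Node (Leaf a) (Leaf b)) = Some (Leaf (a - b))"
| "apply_instr Mult (Node (Leaf a) (Leaf b)) = Some (Leaf (a * b))"
| "apply_instr Quo (Node (Leaf a) (Leaf b)) = Some (Leaf (a div b))"
| "apply_instr Rem (Node (Leaf a) (Leaf b)) = Some (Leaf (a mod b))"
| "apply_instr Le (Node (Leaf a) (Leaf b)) = Some (Leaf (if a \<le> b then 1 else 0))"
| "apply_instr _ _ = None"

datatype prog =
    Prim instr
  | Query
  | Seq prog prog
  | Fork prog prog
  | Branch prog prog prog
  | Loop prog prog

fun encode_list :: "val list \<Rightarrow> val" where
  "encode_list [] = Leaf 0"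
| "encode_list (v # vs) = Node v (encode_list vs)"

definition encode_vec :: "int vec \<Rightarrow> val" where
  "encode_vec x = encode_list (map Leaf (list_of_vec x))"

text \<open>
  \<open>exec d f P u v t\<close>: started in state \<open>u\<close>, program \<open>P\<close> halts in state \<open>v\<close> after time \<open>t\<close>.
  The function \<open>f\<close> is accessible only through \<open>Query\<close>, which answers whether \<open>f x \<le> f y\<close> for a
  pair of integer vectors of dimension \<open>d\<close>. \<open>Fork\<close> runs both programs on copies of
  the state and pairs the results; \<open>Branch\<close> and \<open>Loop\<close> test the result of their first program
  against 0 and then continue from the state before the test. A program gets
  stuck on a state of the wrong shape.
\<close>

inductive exec :: "nat \<Rightarrow> (real vec \<Rightarrow> real) \<Rightarrow> prog \<Rightarrow> val \<Rightarrow> val \<Rightarrow> nat \<Rightarrow> bool"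
  for d :: nat and f :: "real vec \<Rightarrow> real" where
  Prim: "apply_instr c u = Some v \<Longrightarrow> exec d f (Prim c) u v (1 + val_length u)"
| Query: "x \<in> carrier_vec d \<Longrightarrow> y \<in> carrier_vec d \<Longrightarrow> u = Node (encode_vec x) (encode_vec y) \<Longrightarrow>
    exec d f Query u
      (Leaf (if f (map_vec real_of_int x) \<le> f (map_vec real_of_int y) then 1 else 0))
      (1 + val_length u)"
| Seq: "exec d f p u u' s \<Longrightarrow> exec d f q u' v t \<Longrightarrow>
    exec d f (Seq p q) u v (1 + val_length u + s + t)"
| Fork: "exec d f p u v s \<Longrightarrow> exec d f q u v' t \<Longrightarrow>
    exec d f (Fork p q) u (Node v v') (1 + val_length u + s + t)"
| Branch_true: "exec d f b u (Leaf z) s \<Longrightarrow> z \<noteq> 0 \<Longrightarrow> exec d f p u v t \<Longrightarrow>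
    exec d f (Branch b p q) u v (1 + val_length u + s + t)"
| Branch_false: "exec d f b u (Leaf 0) s \<Longrightarrow> exec d f q u v t \<Longrightarrow>
    exec d f (Branch b p q) u v (1 + val_length u + s + t)"
| Loop_stop: "exec d f b u (Leaf 0) s \<Longrightarrow>
    exec d f (Loop b p) u u (1 + val_length u + s)"
| Loop_step: "exec d f b u (Leaf z) s \<Longrightarrow> z \<noteq> 0 \<Longrightarrow> exec d f p u u' t \<Longrightarrow>
    exec d f (Loop b p) u' v r \<Longrightarrow>
    exec d f (Loop b p) u v (1 + val_length u + s + t + r)"

lemma encode_list_inject: "encode_list us = encode_list vs \<Longrightarrow> us = vs"
proof (induction us arbitrary: vs)
  case Nil
  then show ?case by (cases vs) auto
next
  case (Cons u us)
  then show ?case by (cases vs) auto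
qed

lemma encode_vec_inject: "encode_vec x = encode_vec y \<Longrightarrow> x = y"
proof -
  assume "encode_vec x = encode_vec y"
  then have "map Leaf (list_of_vec x) = map Leaf (list_of_vec y)"
    unfolding encode_vec_def by (rule encode_list_inject)
  then have "list_of_vec x = list_of_vec y"
    by (simp add: inj_map_eq_map inj_def)
  then show "x = y" by (metis vec_list)
qed

lemma exec_deterministic:
  "exec d f P u v t \<Longrightarrow> exec d f P u v' t' \<Longrightarrow> v' = v \<and> t' = t"
proof (induction arbitrary: v' t' rule: exec.induct)
  case (Prim c u v)
  from Prim(2) show ?case by cases (use Prim(1) in auto)
next
  case (Query x y u)
  from Query(4) show ?case by cases (use Query(3) in \<open>auto dest!: encode_vec_inject\<close>)
next
  case (Seq p u u' s q v t)
  from Seq.prems show ?case by cases (use Seq.IH in blast)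
next
  case (Fork p u v s q v' t)
  from Fork.prems show ?case by cases (use Fork.IH in blast)
next
  case (Branch_true b u z s p v t q)
  from Branch_true.prems show ?case
    by cases (use Branch_true.IH Branch_true.hyps in \<open>(blast | fastforce)+\<close>)
next
  case (Branch_false b u s q v t p)
  from Branch_false.prems show ?case
    by cases (use Branch_false.IH in \<open>(blast | fastforce)+\<close>)
next
  case (Loop_stop b u s p)
  from Loop_stop.prems show ?case by cases (use Loop_stop.IH in fastforce)+
next
  case (Loop_step b u z s p u' t v r)
  from Loop_step.prems show ?case
    by cases (use Loop_step.IH Loop_step.hyps in \<open>(blast | fastforce)+\<close>)
qed

definition encode_instance :: "nat \<Rightarrow> int mat \<Rightarrow> (nat \<Rightarrow> int vec) \<Rightarrow> val" where
  "encode_instance d A w =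
     Node (Node (Leaf (int (dim_row A))) (Leaf (int (dim_col A))))
       (Node (encode_list (map encode_vec (rows A)))
             (encode_list (map (\<lambda>i. encode_vec (w i)) [0..<d])))"

definition encode_nats :: "nat list \<Rightarrow> val" where
  "encode_nats js = encode_list (map (\<lambda>j. Leaf (int j)) js)"

text \<open>Value at \<open>(x, y)\<close> of a bivariate polynomial; \<open>x\<close> is substituted for the outer variable.\<close>

definition poly2 :: "nat poly poly \<Rightarrow> nat \<Rightarrow> nat \<Rightarrow> nat" where
  "poly2 p x y = poly (poly p [:x:]) y"

end

theory Submission
  imports Defs
begin

text \<open>
  Let \<open>G\<close> be the Gram matrix of the columns of \<open>A\<close>. Expanding \<open>det (I + G diag y)\<close> multilinearly in
  \<open>y\<close> gives the coefficient \<open>det G\<^sub>S \<ge> 0\<close> at \<open>\<Prod>j\<in>S. y j\<close>, which is nonzero iff the columns in \<open>S\<close> are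
  linearly independent. Substitute \<open>y j = T ^ e j\<close>, where \<open>e j\<close> packs the weights of \<open>j\<close> below a leading
  digit 1, and \<open>T\<close> exceeds the sum \<open>det (I + G)\<close> of all coefficients. The base-\<open>T\<close> digits of this single
  integer are nonzero exactly at the pairs (cardinality, weight vector) of independent sets. Since
  bases are the independent sets of maximal cardinality, scanning the polynomially many digits and
  querying \<open>f\<close> finds the weight of an optimal base. The base itself is what remains after
  deleting elements greedily as long as the corresponding digit stays nonzero. As \<open>I + G diag y\<close> has positive
  leading principal minors for \<open>y \<ge> 0\<close>, its determinant is computed by fraction-free elimination
  without pivoting, all intermediate results being minors.
\<close>

section \<open>Binary lengths\<close>

text \<open>The Gram matrix is used for the sign of its minors: distinct sets with equal cardinality
  and weight share a digit, and only nonnegative contributions are sure not to cancel there. The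
  summand \<open>I\<close> lets subsets of every size contribute to one determinant, so neither the
  rank of \<open>A\<close> nor a choice of rows has to be known. The exponents \<open>e j\<close>
  are polynomial in the weights with a degree that grows with \<open>d\<close>, and the powers of
  \<open>T\<close> have that many digits: hence \<open>d\<close> is fixed and the weights count by
  magnitude, not by length.

  The program itself is never written out. \<open>poly_time \<Gamma> u v\<close> only asserts that
  some fixed program takes every state \<open>u i\<close> to \<open>v i\<close> in time polynomial
  in the size of the instance \<open>i\<close>; rules for composition, branching, loops and lists
  assemble it along the proof. Since each instruction is charged for its whole state, a time bound
  also bounds the size of the result. Only the accumulators of loops need size bounds of their own,
  as otherwise growth could compound over the iterations.\<close>

text \<open>Trades the logarithm and the ceiling for a comparison with a power of 2, the form on
  which the size estimates below rest.\<close>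

lemma bin_length_le_iff: "bin_length z \<le> Suc l \<longleftrightarrow> \<bar>z\<bar> < 2 ^ l"
proof -
  define x where "x = log 2 (real_of_int (\<bar>z\<bar> + 1))"
  have "bin_length z \<le> Suc l \<longleftrightarrow> \<lceil>x\<rceil> \<le> int l"
    unfolding bin_length_def x_def[symmetric] by (simp only: plus_1_eq_Suc Suc_le_mono nat_le_iff)
  also have "\<dots> \<longleftrightarrow> x \<le> real l" by (simp only: ceiling_le_iff of_int_of_nat_eq)
  also have "\<dots> \<longleftrightarrow> log 2 (real_of_int (\<bar>z\<bar> + 1)) \<le> real l" by (simp only: x_def)
  also have "\<dots> \<longleftrightarrow> real_of_int (\<bar>z\<bar> + 1) \<le> 2 powr real l"
    by (subst log_le_iff) auto
  also have "\<dots> \<longleftrightarrow> \<bar>z\<bar> + 1 \<le> 2 ^ l"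
    by (metis of_int_le_iff of_int_numeral of_int_power powr_realpow zero_less_numeral)
  finally show ?thesis by linarith
qed

lemma bin_length_pos: "0 < bin_length z"
  by (simp add: bin_length_def)

lemma abs_less_bin_length: "\<bar>z\<bar> < 2 ^ (bin_length z - 1)"
  using bin_length_le_iff[of z "bin_length z - 1"] bin_length_pos[of z] by simp

lemma bin_length_mono: "\<bar>a\<bar> \<le> \<bar>b\<bar> \<Longrightarrow> bin_length a \<le> bin_length b"
  using bin_length_le_iff[of a "bin_length b - 1"] abs_less_bin_length[of b] bin_length_pos[of b]
  by simp

lemma bin_length_uminus [simp]: "bin_length (- a) = bin_length a"
  by (simp add: bin_length_def)

lemma bin_length_0 [simp]: "bin_length 0 = 1" and bin_length_1 [simp]: "bin_length 1 = 2"
  by (simp_all add: bin_length_def)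

text \<open>Adding the lengths is cruder than taking their maximum plus one, but it is the form that
  sums up in \<open>bin_length_sum\<close>.\<close>

lemma bin_length_add: "bin_length (a + b) \<le> bin_length a + bin_length b"
proof (cases "a = 0 \<or> b = 0")
  case False
  define k l where "k = bin_length a - 1" and "l = bin_length b - 1"
  have ab: "\<bar>a\<bar> < 2 ^ k" "\<bar>b\<bar> < 2 ^ l"
    using abs_less_bin_length[of a] abs_less_bin_length[of b] by (simp_all add: k_def l_def)
  have "\<bar>a\<bar> \<noteq> 0" "\<bar>b\<bar> \<noteq> 0" using False by auto
  have "(2::int) ^ k \<le> 2 ^ (k + l)" "(2::int) ^ l \<le> 2 ^ (k + l)" by simp_all
  then have "\<bar>a + b\<bar> < 2 ^ (k + l) + 2 ^ (k + l)" using ab abs_triangle_ineq[of a b] by linarith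
  then have "bin_length (a + b) \<le> Suc (Suc (k + l))" by (simp add: bin_length_le_iff)
  also have "\<dots> = bin_length a + bin_length b"
    using bin_length_pos[of a] bin_length_pos[of b] by (simp add: k_def l_def)
  finally show ?thesis .
qed (use bin_length_pos in auto)

lemma bin_length_diff: "bin_length (a - b) \<le> bin_length a + bin_length b"
  using bin_length_add[of a "- b"] by simp

lemma bin_length_mult: "bin_length (a * b) \<le> bin_length a + bin_length b"
proof -
  define k l where "k = bin_length a - 1" and "l = bin_length b - 1"
  have "\<bar>a\<bar> < 2 ^ k" "\<bar>b\<bar> < 2 ^ l"
    using abs_less_bin_length[of a] abs_less_bin_length[of b] by (simp_all add: k_def l_def)
  then have "\<bar>a * b\<bar> < 2 ^ (k + l)"
    by (simp add: abs_mult power_add mult_strict_mono')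
  then have "bin_length (a * b) \<le> Suc (k + l)" by (simp add: bin_length_le_iff)
  also have "\<dots> \<le> bin_length a + bin_length b"
    using bin_length_pos[of a] bin_length_pos[of b] by (simp add: k_def l_def)
  finally show ?thesis .
qed

lemma bin_length_div: "bin_length (a div b) \<le> bin_length a"
proof (rule bin_length_mono)
  show "\<bar>a div b\<bar> \<le> \<bar>a\<bar>"
  proof (cases "b = 0 \<or> a = 0")
    case False
    \<comment> \<open>Division rounds down, so the two signs of \<open>x\<close> need different
      monotonicity laws; a negative divisor is reduced to this case by negating both
      arguments.\<close>
    have pos: "\<bar>x div c\<bar> \<le> \<bar>x\<bar>" if "c > 0" for x c :: int
    proof (cases "x \<ge> 0")
      case True
      then have "x div c \<le> x div 1" using that by (intro zdiv_mono2) auto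
      moreover have "0 \<le> x div c" using True that by (simp add: pos_imp_zdiv_nonneg_iff)
      ultimately show ?thesis using True by simp
    next
      case False
      then have "x div 1 \<le> x div c" using that by (intro zdiv_mono2_neg) auto
      moreover have "x div c \<le> 0" using False that by (simp add: div_nonpos_pos_le0)
      ultimately show ?thesis using False by simp
    qed
    show ?thesis
    proof (cases "b > 0")
      case True
      then show ?thesis by (rule pos)
    next
      case neg: False
      then have "- b > 0" using False by auto
      from pos[OF this, of "- a"] show ?thesis by simp
    qed
  qed auto
qed

text \<open>For \<open>b \<noteq> 0\<close> the remainder is no longer than the divisor; the summand
  \<open>bin_length a\<close> covers \<open>a mod 0 = a\<close>.\<close>

lemma bin_length_mod: "bin_length (a mod b) \<le> bin_length a + bin_length b"
proof (cases "b = 0")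
  case False
  then have "\<bar>a mod b\<bar> \<le> \<bar>b\<bar>"
    by (metis abs_mod_less less_eq_int_code(1) order_less_imp_le)
  then show ?thesis using bin_length_mono by (meson le_add2 order_trans)
qed simp

lemma bin_length_le_abs: "bin_length z \<le> 1 + nat \<bar>z\<bar>"
proof -
  have "\<bar>z\<bar> < 2 ^ nat \<bar>z\<bar>"
    by (metis abs_ge_zero int_nat_eq less_exp of_nat_less_iff of_nat_numeral of_nat_power)
  then show ?thesis using bin_length_le_iff[of z "nat \<bar>z\<bar>"] by simp
qed

lemma bin_length_sum: "finite S \<Longrightarrow> bin_length (\<Sum>x\<in>S. g x) \<le> 1 + (\<Sum>x\<in>S. bin_length (g x))"
proof (induction S rule: finite_induct)
  case (insert x S)
  then show ?case using bin_length_add[of "g x" "\<Sum>x\<in>S. g x"] by simp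
qed simp

lemma bin_length_power: "bin_length (a ^ k) \<le> 2 + k * bin_length a"
proof (induction k)
  case (Suc k)
  then show ?case using bin_length_mult[of a "a ^ k"] by simp
qed simp

lemma val_length_encode_list: "val_length (encode_list vs) = 1 + (\<Sum>v\<leftarrow>vs. 1 + val_length v)"
  by (induction vs) auto

section \<open>Polynomial bounds and polynomial time\<close>

text \<open>
  A family bundles a set of problem instances with their size parameters and oracles, so that
  "polynomial time uniformly in all instances" becomes a property of functions of the instance.
\<close>

datatype 'i family =
  Family (dim: nat) (idx: "'i set") (bound: "'i \<Rightarrow> nat") (objective: "'i \<Rightarrow> real vec \<Rightarrow> real")

text \<open>One monomial suffices as a bound, because the shift by 1 keeps the base positive and
  exponents can then be raised at will. The constants are chosen before the instance.\<close>

definition poly_bounded :: "'i family \<Rightarrow> ('i \<Rightarrow> nat) \<Rightarrow> bool" where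
  "poly_bounded \<Gamma> g \<longleftrightarrow> (\<exists>c k. \<forall>i\<in>idx \<Gamma>. g i \<le> c * (1 + bound \<Gamma> i) ^ k)"

text \<open>The instances of \<open>\<Gamma>\<close> paired with the iterations of a loop that is run \<open>N i\<close> times.\<close>

definition steps :: "'i family \<Rightarrow> ('i \<Rightarrow> nat) \<Rightarrow> ('i \<times> nat) family" where
  "steps \<Gamma> N = Family (dim \<Gamma>) {j. fst j \<in> idx \<Gamma> \<and> snd j < N (fst j)}
     (\<lambda>j. bound \<Gamma> (fst j)) (\<lambda>j. objective \<Gamma> (fst j))"

lemma steps_simps [simp]:
  "dim (steps \<Gamma> N) = dim \<Gamma>"
  "j \<in> idx (steps \<Gamma> N) \<longleftrightarrow> fst j \<in> idx \<Gamma> \<and> snd j < N (fst j)"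
  "bound (steps \<Gamma> N) j = bound \<Gamma> (fst j)"
  "objective (steps \<Gamma> N) j = objective \<Gamma> (fst j)"
  by (simp_all add: steps_def)

lemma poly_bounded_mono:
  "poly_bounded \<Gamma> h \<Longrightarrow> (\<And>i. i \<in> idx \<Gamma> \<Longrightarrow> g i \<le> h i) \<Longrightarrow> poly_bounded \<Gamma> g"
  unfolding poly_bounded_def by (meson order_trans)

lemma poly_bounded_const: "poly_bounded \<Gamma> (\<lambda>_. c)"
  unfolding poly_bounded_def by (rule exI[of _ c], rule exI[of _ 0]) simp

lemma poly_bounded_bound: "poly_bounded \<Gamma> (bound \<Gamma>)"
  unfolding poly_bounded_def by (rule exI[of _ 1], rule exI[of _ 1]) simp

lemma poly_bounded_add:
  assumes "poly_bounded \<Gamma> g" "poly_bounded \<Gamma> h"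
  shows "poly_bounded \<Gamma> (\<lambda>i. g i + h i)"
proof -
  obtain c k where 1: "\<And>i. i \<in> idx \<Gamma> \<Longrightarrow> g i \<le> c * (1 + bound \<Gamma> i) ^ k"
    using assms(1) unfolding poly_bounded_def by blast
  obtain c' k' where 2: "\<And>i. i \<in> idx \<Gamma> \<Longrightarrow> h i \<le> c' * (1 + bound \<Gamma> i) ^ k'"
    using assms(2) unfolding poly_bounded_def by blast
  have "g i + h i \<le> (c + c') * (1 + bound \<Gamma> i) ^ (k + k')" if "i \<in> idx \<Gamma>" for i
  proof -
    have "(1 + bound \<Gamma> i) ^ k \<le> (1 + bound \<Gamma> i) ^ (k + k')"
      "(1 + bound \<Gamma> i) ^ k' \<le> (1 + bound \<Gamma> i) ^ (k + k')"
      by (intro power_increasing; simp)+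
    then have "c * (1 + bound \<Gamma> i) ^ k \<le> c * (1 + bound \<Gamma> i) ^ (k + k')"
      "c' * (1 + bound \<Gamma> i) ^ k' \<le> c' * (1 + bound \<Gamma> i) ^ (k + k')" by simp_all
    then show ?thesis using 1[OF that] 2[OF that] unfolding distrib_right by linarith
  qed
  then show ?thesis unfolding poly_bounded_def by blast
qed

lemma poly_bounded_mult:
  assumes "poly_bounded \<Gamma> g" "poly_bounded \<Gamma> h"
  shows "poly_bounded \<Gamma> (\<lambda>i. g i * h i)"
proof -
  obtain c k where 1: "\<And>i. i \<in> idx \<Gamma> \<Longrightarrow> g i \<le> c * (1 + bound \<Gamma> i) ^ k"
    using assms(1) unfolding poly_bounded_def by blast
  obtain c' k' where 2: "\<And>i. i \<in> idx \<Gamma> \<Longrightarrow> h i \<le> c' * (1 + bound \<Gamma> i) ^ k'"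
    using assms(2) unfolding poly_bounded_def by blast
  have "g i * h i \<le> (c * c') * (1 + bound \<Gamma> i) ^ (k + k')" if "i \<in> idx \<Gamma>" for i
    using mult_mono[OF 1[OF that] 2[OF that]] by (simp add: power_add mult.assoc mult.left_commute)
  then show ?thesis unfolding poly_bounded_def by blast
qed

lemma poly_bounded_Suc: "poly_bounded \<Gamma> g \<Longrightarrow> poly_bounded \<Gamma> (\<lambda>i. Suc (g i))"
  using poly_bounded_add[OF poly_bounded_const[of \<Gamma> 1]] by simp

lemma poly_bounded_power: "poly_bounded \<Gamma> g \<Longrightarrow> poly_bounded \<Gamma> (\<lambda>i. g i ^ k)"
  by (induction k) (simp_all add: poly_bounded_const[of _ 1, simplified] poly_bounded_mult)

lemma poly_bounded_fst: "poly_bounded \<Gamma> g \<Longrightarrow> poly_bounded (steps \<Gamma> N) (\<lambda>j. g (fst j))"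
  unfolding poly_bounded_def by (metis steps_simps(2,3))

lemma poly_bounded_snd:
  "poly_bounded \<Gamma> N \<Longrightarrow> poly_bounded (steps \<Gamma> N) snd"
  by (rule poly_bounded_mono[OF poly_bounded_fst]) auto

lemma poly_bounded_steps_mono:
  "poly_bounded (steps \<Gamma> N') g \<Longrightarrow> (\<And>i. i \<in> idx \<Gamma> \<Longrightarrow> N i \<le> N' i) \<Longrightarrow> poly_bounded (steps \<Gamma> N) g"
  unfolding poly_bounded_def by (metis order.strict_trans2 steps_simps(2,3))

text \<open>\<open>steps\<close> ignores the iteration number in its size, so a single monomial in
  the size of \<open>i\<close> covers all \<open>N i\<close> summands.\<close>

lemma poly_bounded_sum:
  assumes g: "poly_bounded (steps \<Gamma> N) g" and N: "poly_bounded \<Gamma> N"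
  shows "poly_bounded \<Gamma> (\<lambda>i. \<Sum>k<N i. g (i, k))"
proof -
  obtain c k where 1: "\<And>j. j \<in> idx (steps \<Gamma> N) \<Longrightarrow> g j \<le> c * (1 + bound (steps \<Gamma> N) j) ^ k"
    using g unfolding poly_bounded_def by blast
  have 2: "(\<Sum>k<N i. g (i, k)) \<le> N i * (c * (1 + bound \<Gamma> i) ^ k)" if "i \<in> idx \<Gamma>" for i
    using sum_bounded_above[of "{..<N i}" "\<lambda>k. g (i, k)" "c * (1 + bound \<Gamma> i) ^ k"]
      1[of "(i, _)"] that by simp
  have "poly_bounded \<Gamma> (\<lambda>i. c * (1 + bound \<Gamma> i) ^ k)" unfolding poly_bounded_def by blast
  from poly_bounded_mult[OF N this] 2 show ?thesis by (rule poly_bounded_mono)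
qed

lemmas poly_bounded_intros =
  poly_bounded_const poly_bounded_bound poly_bounded_add poly_bounded_mult poly_bounded_Suc
  poly_bounded_power

text \<open>A relation between families of states rather than a property of functions: the same data
  may be held in different states \<open>u\<close>, and a rule only asks that its inputs be
  computable from the current one.\<close>

definition poly_time :: "'i family \<Rightarrow> ('i \<Rightarrow> val) \<Rightarrow> ('i \<Rightarrow> val) \<Rightarrow> bool" where
  "poly_time \<Gamma> u v \<longleftrightarrow> (\<exists>P \<tau>. poly_bounded \<Gamma> \<tau> \<and>
     (\<forall>i\<in>idx \<Gamma>. exec (dim \<Gamma>) (objective \<Gamma> i) P (u i) (v i) (\<tau> i)))"

lemma poly_timeI:
  assumes "poly_bounded \<Gamma> \<tau>"
    and "\<And>i. i \<in> idx \<Gamma> \<Longrightarrow> exec (dim \<Gamma>) (objective \<Gamma> i) P (u i) (v i) (\<tau> i)"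
  shows "poly_time \<Gamma> u v"
  using assms unfolding poly_time_def by blast

lemma poly_timeE:
  assumes "poly_time \<Gamma> u v"
  obtains P \<tau> where "poly_bounded \<Gamma> \<tau>"
    "\<And>i. i \<in> idx \<Gamma> \<Longrightarrow> exec (dim \<Gamma>) (objective \<Gamma> i) P (u i) (v i) (\<tau> i)"
  using assms unfolding poly_time_def by blast

lemma poly_time_cong:
  "(\<And>i. i \<in> idx \<Gamma> \<Longrightarrow> v i = v' i) \<Longrightarrow> poly_time \<Gamma> u v \<Longrightarrow> poly_time \<Gamma> u v'"
  unfolding poly_time_def by simp

section \<open>Running time bounds the size of states\<close>

lemma val_length_less_time: "exec d f P u v t \<Longrightarrow> val_length u < t"
  by (induction rule: exec.induct) auto

lemma val_length_apply_instr:
  "apply_instr c u = Some v \<Longrightarrow>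
     val_length v \<le> (case c of Const z \<Rightarrow> bin_length z | _ \<Rightarrow> 2) + val_length u"
proof (induction c u rule: apply_instr.induct)
  case (7 a b)
  then show ?case using bin_length_add[of a b] by auto
next
  case (8 a b)
  then show ?case using bin_length_diff[of a b] by auto
next
  case (9 a b)
  then show ?case using bin_length_mult[of a b] by auto
next
  case (10 a b)
  then show ?case using bin_length_div[of a b] by auto
next
  case (11 a b)
  then show ?case using bin_length_mod[of a b] by auto
qed auto

text \<open>One instruction lengthens its state by at most a constant read off the program, and the
  state was already charged. Having \<open>c \<ge> 1\<close> lets the charge of a
  \<open>Fork\<close> pay for the node that it creates.\<close>

lemma val_length_exec: "\<exists>c\<ge>1. \<forall>d f u v t. exec d f P u v t \<longrightarrow> val_length v \<le> c * t"
proof (induction P)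
  case (Prim i)
  define c where "c = Suc (case i of Const z \<Rightarrow> bin_length z | _ \<Rightarrow> 2)"
  have "val_length v \<le> c * t" if "exec d f (Prim i) u v t" for d f u v t
    using that
  proof cases
    case Prim
    have "val_length v \<le> c + val_length u"
      using val_length_apply_instr[OF Prim(2)] by (simp add: c_def)
    also have "\<dots> \<le> c * t" unfolding Prim(1) by (simp add: c_def)
    finally show ?thesis .
  qed
  then show ?case by (intro exI[of _ c]) (auto simp: c_def)
next
  case Query
  have "val_length v \<le> 2 * t" if "exec d f Query u v t" for d f u v t
    using that by cases auto
  then show ?case by (intro exI[of _ 2]) auto
next
  case (Seq P Q)
  then obtain c where c: "c \<ge> 1" "\<And>d f u v t. exec d f Q u v t \<Longrightarrow> val_length v \<le> c * t" by blast
  have "val_length v \<le> c * t" if "exec d f (Seq P Q) u v t" for d f u v t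
    using that
  proof cases
    case (Seq u' s t')
    then show ?thesis using c(2)[OF Seq(3)] by (simp add: distrib_left)
  qed
  then show ?case using c(1) by blast
next
  case (Fork P Q)
  then obtain c c' where c: "c \<ge> 1" "\<And>d f u v t. exec d f P u v t \<Longrightarrow> val_length v \<le> c * t"
    "c' \<ge> 1" "\<And>d f u v t. exec d f Q u v t \<Longrightarrow> val_length v \<le> c' * t" by meson
  have "val_length v \<le> (c + c') * t" if "exec d f (Fork P Q) u v t" for d f u v t
    using that
  proof cases
    case (Fork v1 s v2 t')
    have "val_length v1 \<le> (c + c') * s" "val_length v2 \<le> (c + c') * t'"
      using c(2)[OF Fork(3)] c(4)[OF Fork(4)] by (simp_all add: distrib_right)
    then have "val_length v1 + val_length v2 \<le> (c + c') * (s + t')" by (simp add: distrib_left)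
    moreover have "1 \<le> (c + c') * (1 + val_length u)" using c(1) by simp
    ultimately have "1 + val_length v1 + val_length v2 \<le> (c + c') * ((1 + val_length u) + (s + t'))"
      unfolding distrib_left[of _ "1 + val_length u"] by linarith
    then show ?thesis using Fork by (simp add: add.assoc)
  qed
  then show ?case using c(1) by (intro exI[of _ "c + c'"]) auto
next
  case (Branch B P Q)
  then obtain c c' where c: "c \<ge> 1" "\<And>d f u v t. exec d f P u v t \<Longrightarrow> val_length v \<le> c * t"
    "c' \<ge> 1" "\<And>d f u v t. exec d f Q u v t \<Longrightarrow> val_length v \<le> c' * t" by meson
  have "val_length v \<le> (c + c') * t" if "exec d f (Branch B P Q) u v t" for d f u v t
    using that
  proof cases
    case (Branch_true z s t')
    then show ?thesis using c(2)[OF Branch_true(4)] by (simp add: distrib_left distrib_right)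
  next
    case (Branch_false s t')
    then show ?thesis using c(4)[OF Branch_false(3)] by (simp add: distrib_left distrib_right)
  qed
  then show ?case using c(1) by (intro exI[of _ "c + c'"]) auto
next
  case (Loop B P)
  \<comment> \<open>A loop returns the state in which its test failed, and that state is charged in
    \<open>Loop_stop\<close>; nothing needs to be known of the body.\<close>
  have "val_length v \<le> t" if "exec d f Q u v t" "Q = Loop B P" for d f u v t Q
    using that by (induction rule: exec.induct) auto
  then show ?case by (intro exI[of _ 1]) auto
qed

text \<open>Removes size conditions from the composition rules: whatever has been computed is
  polynomially bounded already.\<close>

lemma poly_time_imp_bounded:
  assumes "poly_time \<Gamma> u v"
  shows "poly_bounded \<Gamma> (\<lambda>i. val_length (u i))" "poly_bounded \<Gamma> (\<lambda>i. val_length (v i))"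
proof -
  obtain P \<tau> where P: "poly_bounded \<Gamma> \<tau>"
    "\<And>i. i \<in> idx \<Gamma> \<Longrightarrow> exec (dim \<Gamma>) (objective \<Gamma> i) P (u i) (v i) (\<tau> i)"
    using assms by (rule poly_timeE) blast
  obtain c where c: "\<And>d f u v t. exec d f P u v t \<Longrightarrow> val_length v \<le> c * t"
    using val_length_exec[of P] by blast
  show "poly_bounded \<Gamma> (\<lambda>i. val_length (u i))"
    by (rule poly_bounded_mono[OF P(1)]) (use P(2) val_length_less_time less_imp_le in blast)
  show "poly_bounded \<Gamma> (\<lambda>i. val_length (v i))"
    by (rule poly_bounded_mono[OF poly_bounded_mult[OF poly_bounded_const P(1)]])
      (use P(2) c in blast)
qed

section \<open>Closure of polynomial time under the program constructors\<close>

lemma poly_time_prim: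
  assumes "poly_bounded \<Gamma> (\<lambda>i. val_length (u i))"
    and "\<And>i. i \<in> idx \<Gamma> \<Longrightarrow> apply_instr c (u i) = Some (v i)"
  shows "poly_time \<Gamma> u v"
proof (rule poly_timeI)
  show "poly_bounded \<Gamma> (\<lambda>i. 1 + val_length (u i))"
    by (intro poly_bounded_intros assms)
  show "exec (dim \<Gamma>) (objective \<Gamma> i) (Prim c) (u i) (v i) (1 + val_length (u i))" if "i \<in> idx \<Gamma>" for i
    using assms(2)[OF that] by (rule exec.Prim)
qed

lemma poly_time_id: "poly_bounded \<Gamma> (\<lambda>i. val_length (u i)) \<Longrightarrow> poly_time \<Gamma> u u"
  by (rule poly_time_prim[where c = Id]) auto

lemma poly_time_refl: "poly_time \<Gamma> u v \<Longrightarrow> poly_time \<Gamma> u u"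
  by (rule poly_time_id) (rule poly_time_imp_bounded)

lemma poly_time_trans:
  assumes "poly_time \<Gamma> u v" "poly_time \<Gamma> v w"
  shows "poly_time \<Gamma> u w"
proof -
  obtain P \<tau> where P: "poly_bounded \<Gamma> \<tau>"
    "\<And>i. i \<in> idx \<Gamma> \<Longrightarrow> exec (dim \<Gamma>) (objective \<Gamma> i) P (u i) (v i) (\<tau> i)"
    using assms(1) by (rule poly_timeE) blast
  obtain Q \<sigma> where Q: "poly_bounded \<Gamma> \<sigma>"
    "\<And>i. i \<in> idx \<Gamma> \<Longrightarrow> exec (dim \<Gamma>) (objective \<Gamma> i) Q (v i) (w i) (\<sigma> i)"
    using assms(2) by (rule poly_timeE) blast
  show ?thesis
  proof (rule poly_timeI)
    show "poly_bounded \<Gamma> (\<lambda>i. 1 + val_length (u i) + \<tau> i + \<sigma> i)"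
      by (intro poly_bounded_intros P Q poly_time_imp_bounded(1)[OF assms(1)])
    show "exec (dim \<Gamma>) (objective \<Gamma> i) (Seq P Q) (u i) (w i) (1 + val_length (u i) + \<tau> i + \<sigma> i)"
      if "i \<in> idx \<Gamma>" for i
      using P(2)[OF that] Q(2)[OF that] by (rule exec.Seq)
  qed
qed

lemma poly_time_Node:
  assumes "poly_time \<Gamma> u v" "poly_time \<Gamma> u w"
  shows "poly_time \<Gamma> u (\<lambda>i. Node (v i) (w i))"
proof -
  obtain P \<tau> where P: "poly_bounded \<Gamma> \<tau>"
    "\<And>i. i \<in> idx \<Gamma> \<Longrightarrow> exec (dim \<Gamma>) (objective \<Gamma> i) P (u i) (v i) (\<tau> i)"
    using assms(1) by (rule poly_timeE) blast
  obtain Q \<sigma> where Q: "poly_bounded \<Gamma> \<sigma>"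
    "\<And>i. i \<in> idx \<Gamma> \<Longrightarrow> exec (dim \<Gamma>) (objective \<Gamma> i) Q (u i) (w i) (\<sigma> i)"
    using assms(2) by (rule poly_timeE) blast
  show ?thesis
  proof (rule poly_timeI)
    show "poly_bounded \<Gamma> (\<lambda>i. 1 + val_length (u i) + \<tau> i + \<sigma> i)"
      by (intro poly_bounded_intros P Q poly_time_imp_bounded(1)[OF assms(1)])
    show "exec (dim \<Gamma>) (objective \<Gamma> i) (Fork P Q) (u i) (Node (v i) (w i))
        (1 + val_length (u i) + \<tau> i + \<sigma> i)" if "i \<in> idx \<Gamma>" for i
      using P(2)[OF that] Q(2)[OF that] by (rule exec.Fork)
  qed
qed

lemma poly_time_apply:
  assumes "poly_time \<Gamma> u v" "\<And>i. i \<in> idx \<Gamma> \<Longrightarrow> apply_instr c (v i) = Some (w i)"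
  shows "poly_time \<Gamma> u w"
  by (rule poly_time_trans[OF assms(1)], rule poly_time_prim[where c = c])
    (use poly_time_imp_bounded(2)[OF assms(1)] assms(2) in auto)

lemma poly_time_Const: "poly_time \<Gamma> u v \<Longrightarrow> poly_time \<Gamma> u (\<lambda>_. Leaf z)"
  by (rule poly_time_apply[where c = "Const z"]) auto

lemma poly_time_fst: "poly_time \<Gamma> u (\<lambda>i. Node (v i) (w i)) \<Longrightarrow> poly_time \<Gamma> u v"
  by (rule poly_time_apply[where c = Fst]) auto

lemma poly_time_snd: "poly_time \<Gamma> u (\<lambda>i. Node (v i) (w i)) \<Longrightarrow> poly_time \<Gamma> u w"
  by (rule poly_time_apply[where c = Snd]) auto

abbreviation poly_time_int :: "'i family \<Rightarrow> ('i \<Rightarrow> val) \<Rightarrow> ('i \<Rightarrow> int) \<Rightarrow> bool" where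
  "poly_time_int \<Gamma> u a \<equiv> poly_time \<Gamma> u (\<lambda>i. Leaf (a i))"

lemma poly_time_add: "poly_time_int \<Gamma> u a \<Longrightarrow> poly_time_int \<Gamma> u b \<Longrightarrow> poly_time_int \<Gamma> u (\<lambda>i. a i + b i)"
  by (erule (1) poly_time_apply[OF poly_time_Node, where c = Add]) auto

lemma poly_time_diff: "poly_time_int \<Gamma> u a \<Longrightarrow> poly_time_int \<Gamma> u b \<Longrightarrow> poly_time_int \<Gamma> u (\<lambda>i. a i - b i)"
  by (erule (1) poly_time_apply[OF poly_time_Node, where c = Sub]) auto

lemma poly_time_mult: "poly_time_int \<Gamma> u a \<Longrightarrow> poly_time_int \<Gamma> u b \<Longrightarrow> poly_time_int \<Gamma> u (\<lambda>i. a i * b i)"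
  by (erule (1) poly_time_apply[OF poly_time_Node, where c = Mult]) auto

lemma poly_time_div: "poly_time_int \<Gamma> u a \<Longrightarrow> poly_time_int \<Gamma> u b \<Longrightarrow> poly_time_int \<Gamma> u (\<lambda>i. a i div b i)"
  by (erule (1) poly_time_apply[OF poly_time_Node, where c = Quo]) auto

lemma poly_time_mod: "poly_time_int \<Gamma> u a \<Longrightarrow> poly_time_int \<Gamma> u b \<Longrightarrow> poly_time_int \<Gamma> u (\<lambda>i. a i mod b i)"
  by (erule (1) poly_time_apply[OF poly_time_Node, where c = Rem]) auto

lemma poly_time_if:
  assumes z: "poly_time_int \<Gamma> u z" and v: "poly_time \<Gamma> u v" and w: "poly_time \<Gamma> u w"
  shows "poly_time \<Gamma> u (\<lambda>i. if z i = 0 then v i else w i)"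
proof -
  obtain B \<rho> where B: "poly_bounded \<Gamma> \<rho>"
    "\<And>i. i \<in> idx \<Gamma> \<Longrightarrow> exec (dim \<Gamma>) (objective \<Gamma> i) B (u i) (Leaf (z i)) (\<rho> i)"
    using z by (rule poly_timeE) blast
  obtain P \<tau> where P: "poly_bounded \<Gamma> \<tau>"
    "\<And>i. i \<in> idx \<Gamma> \<Longrightarrow> exec (dim \<Gamma>) (objective \<Gamma> i) P (u i) (v i) (\<tau> i)"
    using v by (rule poly_timeE) blast
  obtain Q \<sigma> where Q: "poly_bounded \<Gamma> \<sigma>"
    "\<And>i. i \<in> idx \<Gamma> \<Longrightarrow> exec (dim \<Gamma>) (objective \<Gamma> i) Q (u i) (w i) (\<sigma> i)"
    using w by (rule poly_timeE) blast
  show ?thesis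
  proof (rule poly_timeI)
    show "poly_bounded \<Gamma> (\<lambda>i. 1 + val_length (u i) + \<rho> i + (if z i = 0 then \<tau> i else \<sigma> i))"
      by (rule poly_bounded_mono[where h = "\<lambda>i. 1 + val_length (u i) + \<rho> i + (\<tau> i + \<sigma> i)"])
        (intro poly_bounded_intros B P Q poly_time_imp_bounded(1)[OF v], simp)
    \<comment> \<open>\<open>Branch\<close> takes its first alternative on a nonzero test, hence
      \<open>Q\<close> before \<open>P\<close>.\<close>
    show "exec (dim \<Gamma>) (objective \<Gamma> i) (Branch B Q P) (u i) (if z i = 0 then v i else w i)
        (1 + val_length (u i) + \<rho> i + (if z i = 0 then \<tau> i else \<sigma> i))" if "i \<in> idx \<Gamma>" for i
    proof (cases "z i = 0")
      case True
      then show ?thesis using exec.Branch_false[OF _ P(2)[OF that]] B(2)[OF that] by simp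
    next
      case False
      then show ?thesis using exec.Branch_true[OF B(2)[OF that] False Q(2)[OF that]] by simp
    qed
  qed
qed

lemma poly_time_le:
  "poly_time_int \<Gamma> u a \<Longrightarrow> poly_time_int \<Gamma> u b \<Longrightarrow> poly_time_int \<Gamma> u (\<lambda>i. of_bool (a i \<le> b i))"
  by (erule (1) poly_time_apply[OF poly_time_Node, where c = Le]) auto

lemma poly_time_query:
  assumes "poly_time \<Gamma> u (\<lambda>i. encode_vec (x i))" "poly_time \<Gamma> u (\<lambda>i. encode_vec (y i))"
    and "\<And>i. i \<in> idx \<Gamma> \<Longrightarrow> x i \<in> carrier_vec (dim \<Gamma>)" "\<And>i. i \<in> idx \<Gamma> \<Longrightarrow> y i \<in> carrier_vec (dim \<Gamma>)"
  shows "poly_time_int \<Gamma> u (\<lambda>i. of_bool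
     (objective \<Gamma> i (map_vec real_of_int (x i)) \<le> objective \<Gamma> i (map_vec real_of_int (y i))))"
proof (rule poly_time_trans[OF poly_time_Node[OF assms(1,2)]], rule poly_timeI)
  let ?u = "\<lambda>i. Node (encode_vec (x i)) (encode_vec (y i))"
  show "poly_bounded \<Gamma> (\<lambda>i. 1 + val_length (?u i))"
    by (intro poly_bounded_intros poly_time_imp_bounded[OF poly_time_Node[OF assms(1,2)]])
  show "exec (dim \<Gamma>) (objective \<Gamma> i) Query (?u i) (Leaf (of_bool
     (objective \<Gamma> i (map_vec real_of_int (x i)) \<le> objective \<Gamma> i (map_vec real_of_int (y i)))))
     (1 + val_length (?u i))" if "i \<in> idx \<Gamma>" for i
    using exec.Query[OF assms(3)[OF that] assms(4)[OF that] refl, of "objective \<Gamma> i"]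
    by (simp add: of_bool_def)
qed

lemma poly_time_steps: "poly_time \<Gamma> u v \<Longrightarrow> poly_time (steps \<Gamma> N) (\<lambda>j. u (fst j)) (\<lambda>j. v (fst j))"
  by (erule poly_timeE, rule poly_timeI, erule poly_bounded_fst) auto

text \<open>\<open>st i k\<close> describes the state after \<open>k\<close> iterations in closed
  form. The test also runs on the final state, so it is assumed over \<open>Suc (N i)\<close>
  states, and the body over \<open>N i\<close>. Both are uniform in \<open>k\<close>, which makes
  the total time a polynomial sum.\<close>

lemma poly_time_loop:
  assumes N: "poly_bounded \<Gamma> N"
    and test: "poly_time_int (steps \<Gamma> (\<lambda>i. Suc (N i))) (\<lambda>j. st (fst j) (snd j)) z"
    and z: "\<And>i k. i \<in> idx \<Gamma> \<Longrightarrow> k \<le> N i \<Longrightarrow> z (i, k) = 0 \<longleftrightarrow> k = N i"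
    and step: "poly_time (steps \<Gamma> N) (\<lambda>j. st (fst j) (snd j)) (\<lambda>j. st (fst j) (Suc (snd j)))"
  shows "poly_time \<Gamma> (\<lambda>i. st i 0) (\<lambda>i. st i (N i))"
proof -
  obtain B \<rho> where B0: "poly_bounded (steps \<Gamma> (\<lambda>i. Suc (N i))) \<rho>"
    "\<And>j. j \<in> idx (steps \<Gamma> (\<lambda>i. Suc (N i))) \<Longrightarrow>
      exec (dim (steps \<Gamma> (\<lambda>i. Suc (N i)))) (objective (steps \<Gamma> (\<lambda>i. Suc (N i))) j) B
        (st (fst j) (snd j)) (Leaf (z j)) (\<rho> j)"
    using test by (rule poly_timeE) blast
  have B: "exec (dim \<Gamma>) (objective \<Gamma> i) B (st i k) (Leaf (z (i, k))) (\<rho> (i, k))"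
    if "i \<in> idx \<Gamma>" "k \<le> N i" for i k
    using B0(2)[of "(i, k)"] that by simp
  obtain P \<tau> where P0: "poly_bounded (steps \<Gamma> N) \<tau>"
    "\<And>j. j \<in> idx (steps \<Gamma> N) \<Longrightarrow>
      exec (dim (steps \<Gamma> N)) (objective (steps \<Gamma> N) j) P
        (st (fst j) (snd j)) (st (fst j) (Suc (snd j))) (\<tau> j)"
    using step by (rule poly_timeE) blast
  have P: "exec (dim \<Gamma>) (objective \<Gamma> i) P (st i k) (st i (Suc k)) (\<tau> (i, k))"
    if "i \<in> idx \<Gamma>" "k < N i" for i k
    using P0(2)[of "(i, k)"] that by simp
  define c where "c = (\<lambda>i k. 1 + val_length (st i k) + \<rho> (i, k))"
  define T where "T = (\<lambda>i k. c i (N i) + (\<Sum>l=k..<N i. c i l + \<tau> (i, l)))"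
  \<comment> \<open>\<open>Loop_step\<close> puts one iteration in front of a finished run, so the
    induction counts the iterations that remain.\<close>
  have run: "exec (dim \<Gamma>) (objective \<Gamma> i) (Loop B P) (st i (N i - k)) (st i (N i)) (T i (N i - k))"
    if i: "i \<in> idx \<Gamma>" and "k \<le> N i" for i k
    using \<open>k \<le> N i\<close>
  proof (induction k)
    case 0
    have "exec (dim \<Gamma>) (objective \<Gamma> i) B (st i (N i)) (Leaf 0) (\<rho> (i, N i))"
      using B[OF i, of "N i"] z[OF i, of "N i"] by simp
    from exec.Loop_stop[OF this] show ?case by (simp add: T_def c_def)
  next
    case (Suc k)
    let ?l = "N i - Suc k"
    have l: "?l < N i" "Suc ?l = N i - k" using Suc.prems by auto
    have "T i ?l = 1 + val_length (st i ?l) + \<rho> (i, ?l) + \<tau> (i, ?l) + T i (N i - k)"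
      unfolding T_def using l by (simp add: sum.atLeast_Suc_lessThan c_def)
    moreover have "z (i, ?l) \<noteq> 0" using z[OF i, of ?l] l by auto
    ultimately show ?case
      using exec.Loop_step[OF B[OF i less_imp_le[OF l(1)]] _ P[OF i l(1)]] Suc l(2) by simp
  qed
  show ?thesis
  proof (rule poly_timeI)
    show "exec (dim \<Gamma>) (objective \<Gamma> i) (Loop B P) (st i 0) (st i (N i)) (T i 0)"
      if "i \<in> idx \<Gamma>" for i
      using run[OF that, of "N i"] by simp
    have c: "poly_bounded (steps \<Gamma> (\<lambda>i. Suc (N i))) (\<lambda>j. c (fst j) (snd j))"
      unfolding c_def using poly_time_imp_bounded(1)[OF test] B0(1)
      by (intro poly_bounded_intros) simp_all
    have "poly_bounded \<Gamma> (\<lambda>i. (\<Sum>k<Suc (N i). c i k) + (\<Sum>k<N i. \<tau> (i, k)))"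
      using poly_bounded_sum[OF c poly_bounded_Suc[OF N]] poly_bounded_sum[OF P0(1) N]
      by (intro poly_bounded_add) simp_all
    then show "poly_bounded \<Gamma> (\<lambda>i. T i 0)"
      by (rule poly_bounded_mono) (simp add: T_def sum.distrib atLeast0LessThan)
  qed
qed

section \<open>Lists\<close>

text \<open>Lists are given by a length and an index function, so that the intermediate states of a
  loop have closed forms with shifted or reversed indices.\<close>

definition tab :: "nat \<Rightarrow> (nat \<Rightarrow> val) \<Rightarrow> val" where
  "tab N x = encode_list (map x [0..<N])"

abbreviation int_tab :: "nat \<Rightarrow> (nat \<Rightarrow> int) \<Rightarrow> val" where
  "int_tab N a \<equiv> tab N (\<lambda>k. Leaf (a k))"

lemma tab_0 [simp]: "tab 0 x = Leaf 0"
  by (simp add: tab_def)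

lemma tab_Suc: "tab (Suc n) x = Node (x 0) (tab n (\<lambda>k. x (Suc k)))"
  unfolding tab_def by (simp only: map_upt_Suc encode_list.simps)

lemma tab_cong: "(\<And>k. k < N \<Longrightarrow> x k = y k) \<Longrightarrow> tab N x = tab N y"
  unfolding tab_def by (rule arg_cong[where f = encode_list]) simp

lemma val_length_tab: "val_length (tab N x) = 1 + N + (\<Sum>k<N. val_length (x k))"
proof -
  have "(\<Sum>v\<leftarrow>map x [0..<N]. 1 + val_length v) = (\<Sum>k<N. 1 + val_length (x k))"
    by (simp add: comp_def sum_set_upt_conv_sum_list_nat[symmetric] atLeast0LessThan)
  then show ?thesis unfolding tab_def val_length_encode_list by (simp only: sum.distrib) simp
qed

lemma poly_bounded_tab:
  assumes "poly_bounded \<Gamma> N"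
    and "poly_bounded (steps \<Gamma> N) (\<lambda>j. val_length (x (fst j) (snd j)))"
  shows "poly_bounded \<Gamma> (\<lambda>i. val_length (tab (N i) (x i)))"
  unfolding val_length_tab
  using poly_bounded_sum[OF assms(2,1)] by (intro poly_bounded_intros assms(1)) simp_all

lemma poly_bounded_tab_length:
  "poly_bounded \<Gamma> (\<lambda>i. val_length (tab (N i) (x i))) \<Longrightarrow> poly_bounded \<Gamma> N"
  by (erule poly_bounded_mono) (simp add: val_length_tab)

lemma val_length_tab_nth: "k < N \<Longrightarrow> val_length (x k) \<le> val_length (tab N x)"
  using member_le_sum[of k "{..<N}" "\<lambda>k. val_length (x k)"] by (simp add: val_length_tab)

text \<open>
  In the rules for loops the state \<open>e\<close> of the loop body is arbitrary: all that is known of it is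
  that the listed data, and whatever could be computed before the loop, can be computed from it.
\<close>

lemma poly_time_fold:
  assumes xs: "poly_time \<Gamma> u (\<lambda>i. tab (N i) (x i))"
    and init: "poly_time \<Gamma> u (\<lambda>i. acc i 0)"
    and bnd: "poly_bounded (steps \<Gamma> (\<lambda>i. Suc (N i))) (\<lambda>j. val_length (acc (fst j) (snd j)))"
    and step: "\<And>e. poly_time (steps \<Gamma> N) e (\<lambda>j. acc (fst j) (snd j)) \<Longrightarrow>
      poly_time (steps \<Gamma> N) e (\<lambda>j. x (fst j) (snd j)) \<Longrightarrow>
      (\<And>h. poly_time \<Gamma> u h \<Longrightarrow> poly_time (steps \<Gamma> N) e (\<lambda>j. h (fst j))) \<Longrightarrow>
      poly_time (steps \<Gamma> N) e (\<lambda>j. acc (fst j) (Suc (snd j)))"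
  shows "poly_time \<Gamma> u (\<lambda>i. acc i (N i))"
proof -
  define rest where "rest = (\<lambda>i k. tab (N i - k) (\<lambda>l. x i (k + l)))"
  \<comment> \<open>The original state \<open>u i\<close> travels along: anything computable before
    the loop can be recomputed from it in the body, which is what the last premise of
    \<open>step\<close> offers.\<close>
  define st where "st = (\<lambda>i k. Node (u i) (Node (acc i k) (rest i k)))"
  have N: "poly_bounded \<Gamma> N"
    using poly_time_imp_bounded(2)[OF xs] by (rule poly_bounded_tab_length)
  have rest_Suc: "rest i k = Node (x i k) (rest i (Suc k))" if "k < N i" for i k
  proof -
    have "N i - k = Suc (N i - Suc k)" using that by simp
    then show ?thesis unfolding rest_def by (simp add: tab_Suc)
  qed
  have rest_le: "val_length (rest i k) \<le> val_length (tab (N i) (x i))" if "k \<le> N i" for i k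
    using that
  proof (induction k)
    case (Suc k)
    then show ?case using rest_Suc[of k i] by simp
  qed (simp add: rest_def)
  have bnd_st: "poly_bounded (steps \<Gamma> (\<lambda>i. Suc (N i))) (\<lambda>j. val_length (st (fst j) (snd j)))"
  proof (rule poly_bounded_mono)
    show "poly_bounded (steps \<Gamma> (\<lambda>i. Suc (N i))) (\<lambda>j. 1 + val_length (u (fst j)) +
       (1 + val_length (acc (fst j) (snd j)) + val_length (tab (N (fst j)) (x (fst j)))))"
      by (intro poly_bounded_intros bnd poly_bounded_fst[of _ "\<lambda>i. val_length (u i)"]
          poly_bounded_fst[of _ "\<lambda>i. val_length (tab (N i) (x i))"] poly_time_imp_bounded[OF xs])
  qed (auto simp: st_def less_Suc_eq_le intro: rest_le)
  define e where "e = (\<lambda>j. st (fst j) (snd j))"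
  have "poly_time \<Gamma> (\<lambda>i. st i 0) (\<lambda>i. st i (N i))"
  proof (rule poly_time_loop[OF N])
    have "poly_time (steps \<Gamma> (\<lambda>i. Suc (N i))) e (\<lambda>j. st (fst j) (snd j))"
      using bnd_st unfolding e_def by (rule poly_time_id)
    then have "poly_time (steps \<Gamma> (\<lambda>i. Suc (N i))) e (\<lambda>j. rest (fst j) (snd j))"
      unfolding st_def by (rule poly_time_snd[OF poly_time_snd])
    then show "poly_time_int (steps \<Gamma> (\<lambda>i. Suc (N i))) (\<lambda>j. st (fst j) (snd j))
        (\<lambda>j. of_bool (snd j \<noteq> N (fst j)))"
      unfolding e_def
    proof (rule poly_time_apply[where c = IsNode])
      fix j assume "j \<in> idx (steps \<Gamma> (\<lambda>i. Suc (N i)))"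
      then have "snd j \<noteq> N (fst j) \<Longrightarrow> snd j < N (fst j)" by simp
      then show "apply_instr IsNode (rest (fst j) (snd j)) = Some (Leaf (of_bool (snd j \<noteq> N (fst j))))"
        using rest_Suc[of "snd j" "fst j"]
        by (cases "snd j = N (fst j)") (auto simp: rest_def)
    qed
  next
    have st: "poly_time (steps \<Gamma> N) e (\<lambda>j. st (fst j) (snd j))"
      unfolding e_def by (intro poly_time_id poly_bounded_steps_mono[OF bnd_st]) simp
    have "poly_time (steps \<Gamma> N) e (\<lambda>j. rest (fst j) (snd j))"
      using st unfolding st_def by (rule poly_time_snd[OF poly_time_snd])
    then have "poly_time (steps \<Gamma> N) e (\<lambda>j. Node (x (fst j) (snd j)) (rest (fst j) (Suc (snd j))))"
      by (rule poly_time_cong[rotated]) (simp add: rest_Suc)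
    then have x: "poly_time (steps \<Gamma> N) e (\<lambda>j. x (fst j) (snd j))"
      and rest: "poly_time (steps \<Gamma> N) e (\<lambda>j. rest (fst j) (Suc (snd j)))"
      by (rule poly_time_fst, rule poly_time_snd)
    have u: "poly_time (steps \<Gamma> N) e (\<lambda>j. u (fst j))"
      and acc: "poly_time (steps \<Gamma> N) e (\<lambda>j. acc (fst j) (snd j))"
      using st unfolding st_def
      by (rule poly_time_fst, rule poly_time_fst[OF poly_time_snd])
    have "poly_time (steps \<Gamma> N) e (\<lambda>j. acc (fst j) (Suc (snd j)))"
    proof (rule step[OF acc x])
      fix h assume "poly_time \<Gamma> u h"
      then have "poly_time (steps \<Gamma> N) (\<lambda>j. u (fst j)) (\<lambda>j. h (fst j))" by (rule poly_time_steps)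
      with u show "poly_time (steps \<Gamma> N) e (\<lambda>j. h (fst j))" by (rule poly_time_trans)
    qed
    then have "poly_time (steps \<Gamma> N) e (\<lambda>j. st (fst j) (Suc (snd j)))"
      unfolding st_def by (intro poly_time_Node u rest)
    then show "poly_time (steps \<Gamma> N) (\<lambda>j. st (fst j) (snd j)) (\<lambda>j. st (fst j) (Suc (snd j)))"
      unfolding e_def .
  qed simp_all
  moreover have "poly_time \<Gamma> u (\<lambda>i. st i 0)"
    unfolding st_def rest_def using poly_time_refl[OF xs] init xs by (intro poly_time_Node) simp_all
  ultimately have "poly_time \<Gamma> u (\<lambda>i. st i (N i))" by (rule poly_time_trans[rotated])
  then show ?thesis
    unfolding st_def by (rule poly_time_fst[OF poly_time_snd])
qed

text \<open>A fold builds its output by pushing onto the front and so delivers it backwards; this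
  restores the order.\<close>

lemma poly_time_reverse:
  assumes xs: "poly_time \<Gamma> u (\<lambda>i. tab (N i) (x i))"
  shows "poly_time \<Gamma> u (\<lambda>i. tab (N i) (\<lambda>k. x i (N i - Suc k)))"
proof (rule poly_time_fold[OF xs, where acc = "\<lambda>i k. tab k (\<lambda>l. x i (k - Suc l))"])
  show "poly_time \<Gamma> u (\<lambda>i. tab 0 (\<lambda>l. x i (0 - Suc l)))"
    using poly_time_Const[OF xs] by simp
  have eq: "(\<Sum>l<k. val_length (x i (k - Suc l))) = (\<Sum>l<k. val_length (x i l))" for i k
    by (rule sum.nat_diff_reindex)
  show "poly_bounded (steps \<Gamma> (\<lambda>i. Suc (N i)))
     (\<lambda>j. val_length (tab (snd j) (\<lambda>l. x (fst j) (snd j - Suc l))))"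
    by (rule poly_bounded_mono[OF poly_bounded_fst[OF poly_time_imp_bounded(2)[OF xs]]])
      (unfold val_length_tab eq, intro add_mono sum_mono2, auto)
next
  fix e assume acc: "poly_time (steps \<Gamma> N) e (\<lambda>j. tab (snd j) (\<lambda>l. x (fst j) (snd j - Suc l)))"
    and x: "poly_time (steps \<Gamma> N) e (\<lambda>j. x (fst j) (snd j))"
  show "poly_time (steps \<Gamma> N) e (\<lambda>j. tab (Suc (snd j)) (\<lambda>l. x (fst j) (Suc (snd j) - Suc l)))"
    unfolding tab_Suc using poly_time_Node[OF x acc] by simp
qed

lemma poly_time_map:
  assumes xs: "poly_time \<Gamma> u (\<lambda>i. tab (N i) (x i))"
    and step: "\<And>e. poly_time (steps \<Gamma> N) e (\<lambda>j. x (fst j) (snd j)) \<Longrightarrow>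
      (\<And>h. poly_time \<Gamma> u h \<Longrightarrow> poly_time (steps \<Gamma> N) e (\<lambda>j. h (fst j))) \<Longrightarrow>
      poly_time (steps \<Gamma> N) e (\<lambda>j. y (fst j) (snd j))"
  shows "poly_time \<Gamma> u (\<lambda>i. tab (N i) (y i))"
proof -
  have N: "poly_bounded \<Gamma> N"
    using poly_time_imp_bounded(2)[OF xs] by (rule poly_bounded_tab_length)
  define e where "e = (\<lambda>j. Node (u (fst j)) (x (fst j) (snd j)))"
  have "poly_bounded (steps \<Gamma> N) (\<lambda>j. val_length (e j))"
  proof (rule poly_bounded_mono)
    show "poly_bounded (steps \<Gamma> N)
       (\<lambda>j. 1 + val_length (u (fst j)) + val_length (tab (N (fst j)) (x (fst j))))"
      by (intro poly_bounded_intros poly_bounded_fst[of _ "\<lambda>i. val_length (u i)"]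
          poly_bounded_fst[of _ "\<lambda>i. val_length (tab (N i) (x i))"] poly_time_imp_bounded[OF xs])
  qed (auto simp: e_def intro: val_length_tab_nth)
  then have "poly_time (steps \<Gamma> N) e (\<lambda>j. Node (u (fst j)) (x (fst j) (snd j)))"
    unfolding e_def by (rule poly_time_id)
  then have u: "poly_time (steps \<Gamma> N) e (\<lambda>j. u (fst j))"
    and x: "poly_time (steps \<Gamma> N) e (\<lambda>j. x (fst j) (snd j))"
    by (rule poly_time_fst, rule poly_time_snd)
  \<comment> \<open>A first use of \<open>step\<close>, outside the fold, only bounds the size of
    the results; the fold demands such a bound for its accumulator before its own body is
    considered.\<close>
  have "poly_time (steps \<Gamma> N) e (\<lambda>j. y (fst j) (snd j))"
    using x poly_time_trans[OF u poly_time_steps] by (rule step)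
  then have bnd_y: "poly_bounded (steps \<Gamma> N) (\<lambda>j. val_length (y (fst j) (snd j)))"
    by (rule poly_time_imp_bounded)
  have "poly_time \<Gamma> u (\<lambda>i. tab (N i) (\<lambda>l. y i (N i - Suc l)))"
  proof (rule poly_time_fold[OF xs, where acc = "\<lambda>i k. tab k (\<lambda>l. y i (k - Suc l))"])
    show "poly_time \<Gamma> u (\<lambda>i. tab 0 (\<lambda>l. y i (0 - Suc l)))"
      using poly_time_Const[OF xs] by simp
    have eq: "(\<Sum>l<k. val_length (y i (k - Suc l))) = (\<Sum>l<k. val_length (y i l))" for i k
      by (rule sum.nat_diff_reindex)
    show "poly_bounded (steps \<Gamma> (\<lambda>i. Suc (N i)))
       (\<lambda>j. val_length (tab (snd j) (\<lambda>l. y (fst j) (snd j - Suc l))))"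
      by (rule poly_bounded_mono[OF poly_bounded_fst[OF poly_bounded_tab[OF N bnd_y]]])
        (unfold val_length_tab eq, intro add_mono sum_mono2, auto)
  next
    fix e assume acc: "poly_time (steps \<Gamma> N) e (\<lambda>j. tab (snd j) (\<lambda>l. y (fst j) (snd j - Suc l)))"
      and x: "poly_time (steps \<Gamma> N) e (\<lambda>j. x (fst j) (snd j))"
      and h: "\<And>h. poly_time \<Gamma> u h \<Longrightarrow> poly_time (steps \<Gamma> N) e (\<lambda>j. h (fst j))"
    show "poly_time (steps \<Gamma> N) e (\<lambda>j. tab (Suc (snd j)) (\<lambda>l. y (fst j) (Suc (snd j) - Suc l)))"
      unfolding tab_Suc using poly_time_Node[OF step[OF x h] acc] by simp
  qed
  from poly_time_reverse[OF this] show ?thesis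
    by (rule poly_time_cong[rotated]) (rule tab_cong, simp)
qed

text \<open>The fold runs along one list only, so the unread part of the other one is kept in the
  accumulator and loses its head in every iteration.\<close>

lemma poly_time_zip:
  assumes xs: "poly_time \<Gamma> u (\<lambda>i. tab (N i) (x i))" and ys: "poly_time \<Gamma> u (\<lambda>i. tab (N i) (y i))"
  shows "poly_time \<Gamma> u (\<lambda>i. tab (N i) (\<lambda>k. Node (x i k) (y i k)))"
proof -
  define rest where "rest = (\<lambda>i k. tab (N i - k) (\<lambda>l. y i (k + l)))"
  define out where "out = (\<lambda>i k. tab k (\<lambda>l. Node (x i (k - Suc l)) (y i (k - Suc l))))"
  have rest_Suc: "rest i k = Node (y i k) (rest i (Suc k))" if "k < N i" for i k
  proof -
    have "N i - k = Suc (N i - Suc k)" using that by simp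
    then show ?thesis unfolding rest_def by (simp add: tab_Suc)
  qed
  have rest_le: "val_length (rest i k) \<le> val_length (tab (N i) (y i))" if "k \<le> N i" for i k
    using that
  proof (induction k)
    case (Suc k)
    then show ?case using rest_Suc[of k i] by simp
  qed (simp add: rest_def)
  have out_le: "val_length (out i k) \<le> 2 * (val_length (tab (N i) (x i)) + val_length (tab (N i) (y i)))"
    if "k \<le> N i" for i k
  proof -
    have "val_length (out i k) = 1 + k + (\<Sum>l<k. 1 + val_length (x i l) + val_length (y i l))"
      unfolding out_def val_length_tab val_length.simps
      by (subst sum.nat_diff_reindex) (rule refl)
    also have "\<dots> \<le> 1 + N i + (\<Sum>l<N i. 1 + val_length (x i l) + val_length (y i l))"
      using that by (intro add_mono sum_mono2) auto
    also have "\<dots> \<le> 2 * (val_length (tab (N i) (x i)) + val_length (tab (N i) (y i)))"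
      unfolding val_length_tab sum.distrib by simp
    finally show ?thesis .
  qed
  have "poly_time \<Gamma> u (\<lambda>i. Node (rest i (N i)) (out i (N i)))"
  proof (rule poly_time_fold[OF xs, where acc = "\<lambda>i k. Node (rest i k) (out i k)"])
    show "poly_time \<Gamma> u (\<lambda>i. Node (rest i 0) (out i 0))"
      unfolding rest_def out_def using poly_time_Const[OF xs] ys by (intro poly_time_Node) simp_all
    show "poly_bounded (steps \<Gamma> (\<lambda>i. Suc (N i)))
       (\<lambda>j. val_length (Node (rest (fst j) (snd j)) (out (fst j) (snd j))))"
    proof (rule poly_bounded_mono)
      show "poly_bounded (steps \<Gamma> (\<lambda>i. Suc (N i))) (\<lambda>j. 1 + val_length (tab (N (fst j)) (y (fst j))) +
         2 * (val_length (tab (N (fst j)) (x (fst j))) + val_length (tab (N (fst j)) (y (fst j)))))"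
        by (intro poly_bounded_intros poly_bounded_fst[of _ "\<lambda>i. val_length (tab (N i) (y i))"]
            poly_bounded_fst[of _ "\<lambda>i. val_length (tab (N i) (x i))"]
            poly_time_imp_bounded[OF xs] poly_time_imp_bounded[OF ys])
      show "val_length (Node (rest (fst j) (snd j)) (out (fst j) (snd j)))
         \<le> 1 + val_length (tab (N (fst j)) (y (fst j))) +
         2 * (val_length (tab (N (fst j)) (x (fst j))) + val_length (tab (N (fst j)) (y (fst j))))"
        if "j \<in> idx (steps \<Gamma> (\<lambda>i. Suc (N i)))" for j
        using rest_le[of "snd j" "fst j"] out_le[of "snd j" "fst j"] that by simp
    qed
  next
    fix e assume acc: "poly_time (steps \<Gamma> N) e (\<lambda>j. Node (rest (fst j) (snd j)) (out (fst j) (snd j)))"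
      and x: "poly_time (steps \<Gamma> N) e (\<lambda>j. x (fst j) (snd j))"
    have "poly_time (steps \<Gamma> N) e (\<lambda>j. Node (y (fst j) (snd j)) (rest (fst j) (Suc (snd j))))"
      by (rule poly_time_cong[OF _ poly_time_fst[OF acc]]) (simp add: rest_Suc)
    from poly_time_fst[OF this] poly_time_snd[OF this]
    have y: "poly_time (steps \<Gamma> N) e (\<lambda>j. y (fst j) (snd j))"
      and rest: "poly_time (steps \<Gamma> N) e (\<lambda>j. rest (fst j) (Suc (snd j)))" .
    have "out i (Suc k) = Node (Node (x i k) (y i k)) (out i k)" for i k
      unfolding out_def tab_Suc by simp
    then show "poly_time (steps \<Gamma> N) e
        (\<lambda>j. Node (rest (fst j) (Suc (snd j))) (out (fst j) (Suc (snd j))))"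
      using poly_time_Node[OF rest poly_time_Node[OF poly_time_Node[OF x y] poly_time_snd[OF acc]]]
      by simp
  qed
  from poly_time_reverse[OF poly_time_snd[OF this, unfolded out_def]] show ?thesis
    by (rule poly_time_cong[rotated]) (rule tab_cong, simp)
qed

lemma poly_time_map2:
  assumes xs: "poly_time \<Gamma> u (\<lambda>i. tab (N i) (x i))" and ys: "poly_time \<Gamma> u (\<lambda>i. tab (N i) (y i))"
    and step: "\<And>e. poly_time (steps \<Gamma> N) e (\<lambda>j. x (fst j) (snd j)) \<Longrightarrow>
      poly_time (steps \<Gamma> N) e (\<lambda>j. y (fst j) (snd j)) \<Longrightarrow>
      (\<And>h. poly_time \<Gamma> u h \<Longrightarrow> poly_time (steps \<Gamma> N) e (\<lambda>j. h (fst j))) \<Longrightarrow>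
      poly_time (steps \<Gamma> N) e (\<lambda>j. z (fst j) (snd j))"
  shows "poly_time \<Gamma> u (\<lambda>i. tab (N i) (z i))"
proof (rule poly_time_map[OF poly_time_zip[OF xs ys]])
  fix e assume 1: "poly_time (steps \<Gamma> N) e (\<lambda>j. Node (x (fst j) (snd j)) (y (fst j) (snd j)))"
    and 2: "\<And>h. poly_time \<Gamma> u h \<Longrightarrow> poly_time (steps \<Gamma> N) e (\<lambda>j. h (fst j))"
  show "poly_time (steps \<Gamma> N) e (\<lambda>j. z (fst j) (snd j))"
    using poly_time_fst[OF 1] poly_time_snd[OF 1] 2 by (rule step)
qed

text \<open>Counting down makes the counter itself the loop test, and pushing onto the front then
  yields increasing order. The length of a binary numeral does not bound its value, hence the
  separate hypothesis on \<open>N\<close>.\<close>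

lemma poly_time_upto:
  assumes n: "poly_time_int \<Gamma> u (\<lambda>i. int (N i))" and N: "poly_bounded \<Gamma> N"
  shows "poly_time \<Gamma> u (\<lambda>i. int_tab (N i) int)"
proof -
  define st where "st = (\<lambda>i k. Node (Leaf (int (N i - k))) (int_tab k (\<lambda>l. int (N i - k + l))))"
  have bnd: "poly_bounded (steps \<Gamma> (\<lambda>i. Suc (N i))) (\<lambda>j. val_length (st (fst j) (snd j)))"
  proof (rule poly_bounded_mono)
    show "poly_bounded (steps \<Gamma> (\<lambda>i. Suc (N i)))
       (\<lambda>j. 1 + (1 + N (fst j)) + (1 + N (fst j) + N (fst j) * (1 + N (fst j))))"
      by (intro poly_bounded_intros poly_bounded_fst[OF N])
    show "val_length (st (fst j) (snd j)) \<le> 1 + (1 + N (fst j)) + (1 + N (fst j) + N (fst j) * (1 + N (fst j)))"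
      if "j \<in> idx (steps \<Gamma> (\<lambda>i. Suc (N i)))" for j
    proof -
      have k: "snd j \<le> N (fst j)" using that by simp
      have 1: "bin_length (int (N (fst j) - snd j)) \<le> 1 + N (fst j)"
        using bin_length_le_abs[of "int (N (fst j) - snd j)"] by simp
      have "(\<Sum>l<snd j. val_length (Leaf (int (N (fst j) - snd j + l))))
          \<le> of_nat (card {..<snd j}) * (1 + N (fst j))"
      proof (rule sum_bounded_above)
        fix l assume "l \<in> {..<snd j}"
        then show "val_length (Leaf (int (N (fst j) - snd j + l))) \<le> 1 + N (fst j)"
          using bin_length_le_abs[of "int (N (fst j) - snd j + l)"] k by simp
      qed
      also have "\<dots> \<le> N (fst j) * (1 + N (fst j))" using k by (intro mult_right_mono) auto
      finally show ?thesis using 1 k unfolding st_def val_length.simps val_length_tab by linarith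
    qed
  qed
  have "poly_time \<Gamma> (\<lambda>i. st i 0) (\<lambda>i. st i (N i))"
  proof (rule poly_time_loop[OF N])
    have "poly_time (steps \<Gamma> (\<lambda>i. Suc (N i))) (\<lambda>j. st (fst j) (snd j)) (\<lambda>j. st (fst j) (snd j))"
      using bnd by (rule poly_time_id)
    from poly_time_fst[OF this[unfolded st_def]]
    show "poly_time_int (steps \<Gamma> (\<lambda>i. Suc (N i))) (\<lambda>j. st (fst j) (snd j))
      (\<lambda>j. int (N (fst j) - snd j))" unfolding st_def .
  next
    let ?e = "\<lambda>j. st (fst j) (snd j)"
    have st: "poly_time (steps \<Gamma> N) ?e
       (\<lambda>j. Node (Leaf (int (N (fst j) - snd j))) (int_tab (snd j) (\<lambda>l. int (N (fst j) - snd j + l))))"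
      using poly_time_id[OF poly_bounded_steps_mono[OF bnd]] unfolding st_def by simp
    have "poly_time_int (steps \<Gamma> N) ?e (\<lambda>j. int (N (fst j) - snd j) - 1)"
      by (rule poly_time_diff[OF poly_time_fst[OF st] poly_time_Const[OF st]])
    then have 1: "poly_time_int (steps \<Gamma> N) ?e (\<lambda>j. int (N (fst j) - Suc (snd j)))"
      by (rule poly_time_cong[rotated]) auto
    show "poly_time (steps \<Gamma> N) ?e (\<lambda>j. st (fst j) (Suc (snd j)))"
    proof (rule poly_time_cong[OF _ poly_time_Node[OF 1 poly_time_Node[OF 1 poly_time_snd[OF st]]]])
      fix j assume "j \<in> idx (steps \<Gamma> N)"
      then have "N (fst j) - snd j = Suc (N (fst j) - Suc (snd j))" by (simp add: Suc_diff_Suc)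
      then show "Node (Leaf (int (N (fst j) - Suc (snd j)))) (Node (Leaf (int (N (fst j) - Suc (snd j))))
          (int_tab (snd j) (\<lambda>l. int (N (fst j) - snd j + l)))) = st (fst j) (Suc (snd j))"
        unfolding st_def tab_Suc by simp
    qed
  qed auto
  moreover have "poly_time \<Gamma> u (\<lambda>i. st i 0)"
    unfolding st_def using poly_time_Node[OF n poly_time_Const[OF n]] by simp
  ultimately have "poly_time \<Gamma> u (\<lambda>i. st i (N i))" by (rule poly_time_trans[rotated])
  from poly_time_snd[OF this[unfolded st_def]] show ?thesis by simp
qed

lemma poly_time_iterate:
  assumes n: "poly_time_int \<Gamma> u (\<lambda>i. int (N i))" and N: "poly_bounded \<Gamma> N"
    and init: "poly_time \<Gamma> u (\<lambda>i. acc i 0)"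
    and bnd: "poly_bounded (steps \<Gamma> (\<lambda>i. Suc (N i))) (\<lambda>j. val_length (acc (fst j) (snd j)))"
    and step: "\<And>e. poly_time (steps \<Gamma> N) e (\<lambda>j. acc (fst j) (snd j)) \<Longrightarrow>
      poly_time_int (steps \<Gamma> N) e (\<lambda>j. int (snd j)) \<Longrightarrow>
      (\<And>h. poly_time \<Gamma> u h \<Longrightarrow> poly_time (steps \<Gamma> N) e (\<lambda>j. h (fst j))) \<Longrightarrow>
      poly_time (steps \<Gamma> N) e (\<lambda>j. acc (fst j) (Suc (snd j)))"
  shows "poly_time \<Gamma> u (\<lambda>i. acc i (N i))"
  using poly_time_upto[OF n N] init bnd step by (rule poly_time_fold)

text \<open>Repeated multiplication, and already the size of the result, requires an exponent that
  is polynomial in value. This is one reason why the weights enter the running time by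
  magnitude.\<close>

lemma poly_time_power:
  assumes a: "poly_time_int \<Gamma> u a"
    and n: "poly_time_int \<Gamma> u (\<lambda>i. int (N i))" and N: "poly_bounded \<Gamma> N"
  shows "poly_time_int \<Gamma> u (\<lambda>i. a i ^ N i)"
proof (rule poly_time_iterate[OF n N, where acc = "\<lambda>i k. Leaf (a i ^ k)"])
  show "poly_time_int \<Gamma> u (\<lambda>i. a i ^ 0)" using poly_time_Const[OF a] by simp
  show "poly_bounded (steps \<Gamma> (\<lambda>i. Suc (N i))) (\<lambda>j. val_length (Leaf (a (fst j) ^ snd j)))"
  proof (rule poly_bounded_mono)
    show "poly_bounded (steps \<Gamma> (\<lambda>i. Suc (N i))) (\<lambda>j. 2 + N (fst j) * val_length (Leaf (a (fst j))))"
      by (intro poly_bounded_intros poly_bounded_fst[OF N] poly_bounded_fst[of _ "\<lambda>i. val_length (Leaf (a i))"]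
          poly_time_imp_bounded[OF a])
    show "val_length (Leaf (a (fst j) ^ snd j)) \<le> 2 + N (fst j) * val_length (Leaf (a (fst j)))"
      if "j \<in> idx (steps \<Gamma> (\<lambda>i. Suc (N i)))" for j
    proof -
      have "snd j * bin_length (a (fst j)) \<le> N (fst j) * bin_length (a (fst j))"
        using that by (intro mult_right_mono) auto
      then show ?thesis using bin_length_power[of "a (fst j)" "snd j"] unfolding val_length.simps by linarith
    qed
  qed
next
  fix e
  assume acc: "poly_time_int (steps \<Gamma> N) e (\<lambda>j. a (fst j) ^ snd j)"
    and h: "\<And>h. poly_time \<Gamma> u h \<Longrightarrow> poly_time (steps \<Gamma> N) e (\<lambda>j. h (fst j))"
  show "poly_time_int (steps \<Gamma> N) e (\<lambda>j. a (fst j) ^ Suc (snd j))"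
    using poly_time_mult[OF h[OF a] acc] by simp
qed

lemma poly_time_sum:
  assumes xs: "poly_time \<Gamma> u (\<lambda>i. int_tab (N i) (a i))"
  shows "poly_time_int \<Gamma> u (\<lambda>i. \<Sum>k<N i. a i k)"
proof (rule poly_time_fold[OF xs, where acc = "\<lambda>i k. Leaf (\<Sum>l<k. a i l)"])
  show "poly_time_int \<Gamma> u (\<lambda>i. \<Sum>l<0. a i l)" using poly_time_Const[OF xs] by simp
  show "poly_bounded (steps \<Gamma> (\<lambda>i. Suc (N i))) (\<lambda>j. val_length (Leaf (\<Sum>l<snd j. a (fst j) l)))"
  proof (rule poly_bounded_mono[OF poly_bounded_fst[OF poly_time_imp_bounded(2)[OF xs]]])
    fix j assume j: "j \<in> idx (steps \<Gamma> (\<lambda>i. Suc (N i)))"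
    have "bin_length (\<Sum>l<snd j. a (fst j) l) \<le> 1 + (\<Sum>l<snd j. bin_length (a (fst j) l))"
      by (rule bin_length_sum) simp
    also have "\<dots> \<le> 1 + (\<Sum>l<N (fst j). bin_length (a (fst j) l))"
      using j by (intro add_left_mono sum_mono2) auto
    finally show "val_length (Leaf (\<Sum>l<snd j. a (fst j) l)) \<le> val_length (int_tab (N (fst j)) (a (fst j)))"
      by (simp add: val_length_tab)
  qed
next
  fix e
  assume "poly_time_int (steps \<Gamma> N) e (\<lambda>j. \<Sum>l<snd j. a (fst j) l)"
    "poly_time_int (steps \<Gamma> N) e (\<lambda>j. a (fst j) (snd j))"
  from poly_time_add[OF this]
  show "poly_time_int (steps \<Gamma> N) e (\<lambda>j. \<Sum>l<Suc (snd j). a (fst j) l)" by simp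
qed

section \<open>The weighted Gram determinant\<close>

text \<open>Generic in the ring: signs are settled over the reals, linear dependence over the
  rationals, and the computation is over the integers.\<close>

definition gram :: "nat \<Rightarrow> (nat \<Rightarrow> nat \<Rightarrow> 'a :: comm_ring_1) \<Rightarrow> nat \<Rightarrow> nat \<Rightarrow> 'a" where
  "gram m c a b = (\<Sum>r<m. c r a * c r b)"

definition weighted_mat :: "nat \<Rightarrow> (nat \<Rightarrow> nat \<Rightarrow> 'a :: comm_ring_1) \<Rightarrow> (nat \<Rightarrow> 'a) \<Rightarrow> 'a mat" where
  "weighted_mat n G y = mat n n (\<lambda>(a, b). of_bool (a = b) + G a b * y b)"

text \<open>Unit columns outside \<open>S\<close> make the determinant of this matrix the principal
  minor of \<open>G\<close> on \<open>S\<close>, without reindexing by \<open>S\<close>.\<close>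

definition minor_mat :: "nat \<Rightarrow> (nat \<Rightarrow> nat \<Rightarrow> 'a :: comm_ring_1) \<Rightarrow> nat set \<Rightarrow> 'a mat" where
  "minor_mat n G S = mat n n (\<lambda>(a, b). if b \<in> S then G a b else of_bool (a = b))"

lemma weighted_mat_carrier [simp]: "weighted_mat n G y \<in> carrier_mat n n"
  by (simp add: weighted_mat_def)

lemma minor_mat_carrier [simp]: "minor_mat n G S \<in> carrier_mat n n"
  by (simp add: minor_mat_def)

lemma weighted_mat_dim [simp]: "dim_row (weighted_mat n G y) = n" "dim_col (weighted_mat n G y) = n"
  by (simp_all add: weighted_mat_def)

lemma minor_mat_dim [simp]: "dim_row (minor_mat n G S) = n" "dim_col (minor_mat n G S) = n"
  by (simp_all add: minor_mat_def)

text \<open>In the Leibniz formula each factor is a sum of a Gram term and an identity term.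
  Expanding the product chooses the set \<open>S\<close> of columns that take the Gram term; the
  other columns force \<open>p j = j\<close>, exactly as in \<open>minor_mat\<close>.\<close>

lemma det_weighted_mat:
  "det (weighted_mat n G y) = (\<Sum>S\<in>Pow {..<n}. det (minor_mat n G S) * (\<Prod>j\<in>S. y j))"
proof -
  let ?P = "{p. p permutes {0..<n}}"
  have bound: "p j < n" if "p permutes {0..<n}" "j < n" for p j
    using permutes_in_image[OF that(1), of j] that(2) by simp
  have "det (weighted_mat n G y)
      = (\<Sum>p\<in>?P. signof p * (\<Prod>j<n. G (p j) j * y j + of_bool (p j = j)))"
    unfolding det_col[OF weighted_mat_carrier] using bound
    by (intro sum.cong refl arg_cong2[where f = "(*)"] prod.cong) (auto simp: weighted_mat_def)
  also have "\<dots> = (\<Sum>p\<in>?P. \<Sum>S\<in>Pow {..<n}.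
      signof p * ((\<Prod>j\<in>S. G (p j) j * y j) * (\<Prod>j\<in>{..<n} - S. of_bool (p j = j))))"
    by (simp add: prod_add sum_distrib_left)
  also have "\<dots> = (\<Sum>S\<in>Pow {..<n}. \<Sum>p\<in>?P.
      signof p * ((\<Prod>j\<in>S. G (p j) j * y j) * (\<Prod>j\<in>{..<n} - S. of_bool (p j = j))))"
    by (rule sum.swap)
  also have "\<dots> = (\<Sum>S\<in>Pow {..<n}. det (minor_mat n G S) * (\<Prod>j\<in>S. y j))"
  proof (rule sum.cong[OF refl])
    fix S assume "S \<in> Pow {..<n}"
    then have S: "S \<subseteq> {..<n}" by simp
    have "(\<Prod>j<n. minor_mat n G S $$ (p j, j))
        = (\<Prod>j\<in>S. G (p j) j) * (\<Prod>j\<in>{..<n} - S. of_bool (p j = j))"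
      if "p permutes {0..<n}" for p
    proof -
      have "(\<Prod>j<n. minor_mat n G S $$ (p j, j))
          = (\<Prod>j\<in>{..<n} - S. minor_mat n G S $$ (p j, j)) * (\<Prod>j\<in>S. minor_mat n G S $$ (p j, j))"
        by (rule prod.subset_diff[OF S]) simp
      also have "(\<Prod>j\<in>S. minor_mat n G S $$ (p j, j)) = (\<Prod>j\<in>S. G (p j) j)"
        using S bound[OF that] by (intro prod.cong) (auto simp: minor_mat_def)
      also have "(\<Prod>j\<in>{..<n} - S. minor_mat n G S $$ (p j, j)) = (\<Prod>j\<in>{..<n} - S. of_bool (p j = j))"
        using S bound[OF that] by (intro prod.cong) (auto simp: minor_mat_def)
      finally show ?thesis by (simp add: mult.commute)
    qed
    then show "(\<Sum>p\<in>?P. signof p *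
        ((\<Prod>j\<in>S. G (p j) j * y j) * (\<Prod>j\<in>{..<n} - S. of_bool (p j = j))))
      = det (minor_mat n G S) * (\<Prod>j\<in>S. y j)"
      unfolding det_col[OF minor_mat_carrier] sum_distrib_right
      by (intro sum.cong) (auto simp: prod.distrib algebra_simps)
  qed
  finally show ?thesis .
qed

lemma det_weighted_mat_of_int:
  "det (weighted_mat n (\<lambda>a b. of_int (G a b)) (\<lambda>b. of_int (y b)) :: 'a :: comm_ring_1 mat)
     = of_int (det (weighted_mat n G y))"
proof -
  have "weighted_mat n (\<lambda>a b. of_int (G a b)) (\<lambda>b. of_int (y b) :: 'a)
      = map_mat of_int (weighted_mat n G y)"
    by (rule eq_matI) (auto simp: weighted_mat_def)
  then show ?thesis by (simp add: of_int_hom.hom_det)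
qed

lemma det_minor_mat_of_int:
  "det (minor_mat n (\<lambda>a b. of_int (G a b)) S :: 'a :: comm_ring_1 mat) = of_int (det (minor_mat n G S))"
proof -
  have "minor_mat n (\<lambda>a b. of_int (G a b) :: 'a) S = map_mat of_int (minor_mat n G S)"
    by (rule eq_matI) (auto simp: minor_mat_def)
  then show ?thesis by (simp add: of_int_hom.hom_det)
qed

section \<open>Positivity and vanishing of Gram determinants\<close>

lemma gram_of_int: "gram m (\<lambda>r a. of_int (c r a)) = (\<lambda>a b. of_int (gram m c a b))"
  by (intro ext) (simp add: gram_def)

lemma gram_apply:
  "(\<Sum>b\<in>B. gram m c a b * z b) = (\<Sum>r<m. c r a * (\<Sum>b\<in>B. c r b * z b))"
proof -
  have "(\<Sum>b\<in>B. gram m c a b * z b) = (\<Sum>b\<in>B. \<Sum>r<m. c r a * (c r b * z b))"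
    unfolding gram_def sum_distrib_right by (simp add: algebra_simps)
  also have "\<dots> = (\<Sum>r<m. \<Sum>b\<in>B. c r a * (c r b * z b))" by (rule sum.swap)
  finally show ?thesis by (simp add: sum_distrib_left)
qed

lemma gram_quadratic_form:
  "(\<Sum>a\<in>B. z a * (\<Sum>b\<in>B. gram m c a b * z b)) = (\<Sum>r<m. (\<Sum>b\<in>B. c r b * z b)\<^sup>2)"
proof -
  have "(\<Sum>a\<in>B. z a * (\<Sum>b\<in>B. gram m c a b * z b))
      = (\<Sum>a\<in>B. \<Sum>r<m. c r a * z a * (\<Sum>b\<in>B. c r b * z b))"
    unfolding gram_apply sum_distrib_left by (simp add: algebra_simps)
  also have "\<dots> = (\<Sum>r<m. \<Sum>a\<in>B. c r a * z a * (\<Sum>b\<in>B. c r b * z b))" by (rule sum.swap)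
  finally show ?thesis by (simp add: sum_distrib_right power2_eq_square)
qed

text \<open>\<open>G diag y\<close> need not be symmetric, so definiteness does not apply directly.
  For a kernel vector \<open>v\<close> put \<open>z = diag y v\<close>; then
  \<open>v = - G z\<close>, and the quadratic form at \<open>z\<close> equals
  \<open>- (\<Sum>a<n. y a * (v $ a)\<^sup>2)\<close>. It is both a sum of squares and at most 0, so
  all products of rows of \<open>c\<close> with \<open>z\<close> vanish, and with them
  \<open>G z\<close> and \<open>v\<close>.\<close>

lemma det_weighted_gram_nonzero:
  fixes c :: "nat \<Rightarrow> nat \<Rightarrow> 'a :: linordered_field"
  assumes y: "\<And>a. a < n \<Longrightarrow> 0 \<le> y a"
  shows "det (weighted_mat n (gram m c) y) \<noteq> 0"
proof
  assume "det (weighted_mat n (gram m c) y) = 0"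
  then obtain v where v: "v \<in> carrier_vec n" "v \<noteq> 0\<^sub>v n"
    and 0: "weighted_mat n (gram m c) y *\<^sub>v v = 0\<^sub>v n"
    unfolding det_0_iff_vec_prod_zero[OF weighted_mat_carrier] by blast
  define z where "z = (\<lambda>a. y a * v $ a)"
  have eq: "v $ a = - (\<Sum>b<n. gram m c a b * z b)" if a: "a < n" for a
  proof -
    have "0 = (weighted_mat n (gram m c) y *\<^sub>v v) $ a" using a by (simp add: 0)
    also have "\<dots> = (\<Sum>b<n. (of_bool (a = b) + gram m c a b * y b) * v $ b)"
      using a v by (simp add: weighted_mat_def scalar_prod_def atLeast0LessThan)
    also have "\<dots> = (\<Sum>b<n. of_bool (a = b) * v $ b) + (\<Sum>b<n. gram m c a b * z b)"
      by (simp add: z_def distrib_right sum.distrib algebra_simps)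
    also have "(\<Sum>b<n. of_bool (a = b) * v $ b) = v $ a"
      using a by (simp add: of_bool_def if_distrib[of "\<lambda>x. x * _"] cong: if_cong)
    finally show ?thesis by (simp add: eq_neg_iff_add_eq_0)
  qed
  have "(\<Sum>r<m. (\<Sum>b<n. c r b * z b)\<^sup>2) = (\<Sum>a<n. z a * - v $ a)"
    unfolding gram_quadratic_form[symmetric] by (rule sum.cong) (simp_all add: eq)
  also have "\<dots> = - (\<Sum>a<n. y a * (v $ a)\<^sup>2)"
    by (simp add: z_def sum_negf power2_eq_square mult.assoc)
  also have "\<dots> \<le> 0" using y by (auto intro!: sum_nonneg)
  finally have "(\<Sum>r<m. (\<Sum>b<n. c r b * z b)\<^sup>2) = 0" by (simp add: antisym sum_nonneg)
  then have "(\<Sum>b<n. c r b * z b) = 0" if "r < m" for r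
    using that by (subst (asm) sum_nonneg_eq_0_iff) auto
  then have "v $ a = 0" if "a < n" for a
    using eq[OF that] by (simp add: gram_apply)
  then show False using v by auto
qed

lemma det_weighted_mat_0: "det (weighted_mat n G (\<lambda>_. 0)) = 1"
proof -
  have "weighted_mat n G (\<lambda>_. 0) = 1\<^sub>m n" by (rule eq_matI) (auto simp: weighted_mat_def)
  then show ?thesis by simp
qed

text \<open>Scaling \<open>y\<close> by \<open>t\<close> from 1 to 0 deforms the determinant
  continuously to \<open>det I = 1\<close> without meeting a zero; the intermediate value theorem is
  the reason for passing to the reals.\<close>

lemma det_weighted_gram_pos_real:
  fixes c :: "nat \<Rightarrow> nat \<Rightarrow> real"
  assumes y: "\<And>a. a < n \<Longrightarrow> 0 \<le> y a"
  shows "0 < det (weighted_mat n (gram m c) y)"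
proof (rule ccontr)
  define h where "h = (\<lambda>t. det (weighted_mat n (gram m c) (\<lambda>a. t * y a)))"
  assume "\<not> 0 < det (weighted_mat n (gram m c) y)"
  then have "h 1 \<le> 0" by (simp add: h_def)
  moreover have "0 \<le> h 0" by (simp add: h_def det_weighted_mat_0)
  moreover have "isCont h t" for t
    unfolding h_def det_weighted_mat by (intro continuous_intros)
  ultimately obtain t where "0 \<le> t" "h t = 0"
    using IVT2[of h 1 0 0] by auto
  then show False using det_weighted_gram_nonzero[of n "\<lambda>a. t * y a" m c] y by (simp add: h_def)
qed

lemma det_weighted_gram_pos:
  fixes c :: "nat \<Rightarrow> nat \<Rightarrow> int"
  assumes "\<And>a. a < n \<Longrightarrow> 0 \<le> y a"
  shows "0 < det (weighted_mat n (gram m c) y)"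
  using det_weighted_gram_pos_real[of n "\<lambda>a. real_of_int (y a)" m "\<lambda>r a. real_of_int (c r a)"] assms
  by (simp add: gram_of_int det_weighted_mat_of_int)

text \<open>The principal Gram minor is the leading coefficient of a polynomial that is positive on the positive axis.\<close>

lemma det_minor_gram_nonneg_real:
  fixes c :: "nat \<Rightarrow> nat \<Rightarrow> real"
  assumes S: "S \<subseteq> {..<n}"
  shows "0 \<le> det (minor_mat n (gram m c) S)"
proof -
  have fin: "finite S" using S finite_subset by blast
  \<comment> \<open>The polynomial in \<open>t = 1 / \<epsilon>\<close> with its coefficients
    reversed: its leading coefficient becomes \<open>h 0\<close>, a limit from the right of positive
    values.\<close>
  define h where "h = (\<lambda>\<epsilon>. \<Sum>R\<in>Pow S. det (minor_mat n (gram m c) R) * \<epsilon> ^ (card S - card R))"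
  have pos: "0 < h \<epsilon>" if "\<epsilon> > 0" for \<epsilon>
  proof -
    let ?y = "\<lambda>j. if j \<in> S then 1 / \<epsilon> else 0"
    have "\<epsilon> ^ card S * det (weighted_mat n (gram m c) ?y)
        = (\<Sum>R\<in>Pow {..<n}. \<epsilon> ^ card S * (det (minor_mat n (gram m c) R) * (\<Prod>j\<in>R. ?y j)))"
      unfolding det_weighted_mat by (rule sum_distrib_left)
    also have "\<dots> = (\<Sum>R\<in>Pow S. \<epsilon> ^ card S * (det (minor_mat n (gram m c) R) * (\<Prod>j\<in>R. ?y j)))"
    proof (rule sum.mono_neutral_right)
      show "\<forall>R\<in>Pow {..<n} - Pow S. \<epsilon> ^ card S * (det (minor_mat n (gram m c) R) * (\<Prod>j\<in>R. ?y j)) = 0"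
      proof
        fix R assume "R \<in> Pow {..<n} - Pow S"
        then obtain j where "j \<in> R" "j \<notin> S" "finite R" using finite_subset by auto
        then have "(\<Prod>j\<in>R. ?y j) = 0" by (intro prod_zero) auto
        then show "\<epsilon> ^ card S * (det (minor_mat n (gram m c) R) * (\<Prod>j\<in>R. ?y j)) = 0" by simp
      qed
    qed (use S in auto)
    also have "\<dots> = h \<epsilon>"
      unfolding h_def
    proof (rule sum.cong[OF refl])
      fix R assume "R \<in> Pow S"
      then have R: "R \<subseteq> S" by simp
      then have "card R \<le> card S" using fin by (simp add: card_mono)
      moreover have "(\<Prod>j\<in>R. ?y j) = (1 / \<epsilon>) ^ card R" using R by (simp add: subset_iff)
      ultimately show "\<epsilon> ^ card S * (det (minor_mat n (gram m c) R) * (\<Prod>j\<in>R. ?y j))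
          = det (minor_mat n (gram m c) R) * \<epsilon> ^ (card S - card R)"
        using that by (simp add: power_diff power_one_over field_simps)
    qed
    finally have "h \<epsilon> = \<epsilon> ^ card S * det (weighted_mat n (gram m c) ?y)" ..
    then show ?thesis using that det_weighted_gram_pos_real[of n ?y m c] by simp
  qed
  have "isCont h 0" unfolding h_def by (intro continuous_intros)
  then have "(h \<longlongrightarrow> h 0) (at_right 0)" by (simp add: isCont_def filterlim_at_split)
  moreover have "\<forall>\<^sub>F \<epsilon> in at_right 0. 0 \<le> h \<epsilon>"
    using pos by (auto simp: eventually_at_right_field intro!: exI[of _ 1] less_imp_le)
  ultimately have "0 \<le> h 0" by (rule tendsto_lowerbound) simp
  also have "h 0 = (\<Sum>R\<in>{S}. det (minor_mat n (gram m c) R) * 0 ^ (card S - card R))"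
    unfolding h_def
  proof (rule sum.mono_neutral_right)
    show "\<forall>R\<in>Pow S - {S}. det (minor_mat n (gram m c) R) * 0 ^ (card S - card R) = 0"
      using fin by (auto simp: psubset_card_mono psubset_eq)
  qed (use fin in auto)
  finally show ?thesis by simp
qed

lemma det_minor_gram_nonneg:
  fixes c :: "nat \<Rightarrow> nat \<Rightarrow> int"
  assumes "S \<subseteq> {..<n}"
  shows "0 \<le> det (minor_mat n (gram m c) S)"
  using det_minor_gram_nonneg_real[OF assms, of m "\<lambda>r a. real_of_int (c r a)"]
  by (simp add: gram_of_int det_minor_mat_of_int)

text \<open>Over an ordered field a sum of squares vanishes only termwise, so a kernel vector of the
  Gram block on \<open>S\<close> is already a linear relation between the columns in
  \<open>S\<close>.\<close>

lemma det_minor_gram_eq_0_iff: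
  fixes c :: "nat \<Rightarrow> nat \<Rightarrow> 'a :: linordered_field"
  assumes S: "S \<subseteq> {..<n}"
  shows "det (minor_mat n (gram m c) S) = 0 \<longleftrightarrow>
    (\<exists>z. (\<exists>j\<in>S. z j \<noteq> 0) \<and> (\<forall>r<m. (\<Sum>j\<in>S. c r j * z j) = 0))" (is "?L \<longleftrightarrow> ?R")
proof -
  have fin: "finite S" using S finite_subset by blast
  have row: "(minor_mat n (gram m c) S *\<^sub>v v) $ a
      = (\<Sum>b\<in>S. gram m c a b * v $ b) + (if a \<in> S then 0 else v $ a)"
    if a: "a < n" and v: "v \<in> carrier_vec n" for a v
  proof -
    have "(minor_mat n (gram m c) S *\<^sub>v v) $ a
        = (\<Sum>b<n. (if b \<in> S then gram m c a b else of_bool (a = b)) * v $ b)"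
      using a v by (simp add: minor_mat_def scalar_prod_def atLeast0LessThan)
    also have "\<dots> = (\<Sum>b\<in>{..<n} - S. (if b \<in> S then gram m c a b else of_bool (a = b)) * v $ b)
        + (\<Sum>b\<in>S. (if b \<in> S then gram m c a b else of_bool (a = b)) * v $ b)"
      by (rule sum.subset_diff[OF S]) simp
    also have "(\<Sum>b\<in>{..<n} - S. (if b \<in> S then gram m c a b else of_bool (a = b)) * v $ b)
        = (\<Sum>b\<in>{..<n} - S. if b = a then v $ b else 0)"
      by (rule sum.cong) auto
    also have "\<dots> = (if a \<in> S then 0 else v $ a)" using a by simp
    finally show ?thesis by simp
  qed
  show ?thesis
  proof
    assume ?L
    then obtain v where v: "v \<in> carrier_vec n" "v \<noteq> 0\<^sub>v n"
      and 0: "minor_mat n (gram m c) S *\<^sub>v v = 0\<^sub>v n"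
      unfolding det_0_iff_vec_prod_zero[OF minor_mat_carrier] by blast
    have eq: "(\<Sum>b\<in>S. gram m c a b * v $ b) + (if a \<in> S then 0 else v $ a) = 0" if "a < n" for a
      using row[OF that v(1)] that by (simp add: 0)
    have "(\<Sum>r<m. (\<Sum>b\<in>S. c r b * v $ b)\<^sup>2) = 0"
      unfolding gram_quadratic_form[symmetric] using eq S by (intro sum.neutral) force
    then have kernel: "\<forall>r<m. (\<Sum>b\<in>S. c r b * v $ b) = 0"
      by (subst (asm) sum_nonneg_eq_0_iff) auto
    moreover have "\<exists>j\<in>S. v $ j \<noteq> 0"
    proof (rule ccontr)
      \<comment> \<open>A kernel vector that is 0 on \<open>S\<close> is 0 everywhere, because a row
        outside \<open>S\<close> then reads off its own entry \<open>v $ a\<close>.\<close>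
      assume *: "\<not> (\<exists>j\<in>S. v $ j \<noteq> 0)"
      then have "v $ a = 0" if "a < n" for a
        using eq[OF that] by (cases "a \<in> S") (auto simp: gram_apply)
      then show False using v by auto
    qed
    ultimately show ?R by (intro exI[of _ "\<lambda>j. v $ j"]) simp
  next
    assume ?R
    then obtain z j where j: "j \<in> S" "z j \<noteq> 0" and z: "\<And>r. r < m \<Longrightarrow> (\<Sum>j\<in>S. c r j * z j) = 0"
      by blast
    define v where "v = vec n (\<lambda>a. if a \<in> S then z a else 0)"
    have v: "v \<in> carrier_vec n" by (simp add: v_def)
    have "v $ j \<noteq> 0" using j S by (auto simp: v_def)
    then have "v \<noteq> 0\<^sub>v n" using j S by auto
    moreover have "minor_mat n (gram m c) S *\<^sub>v v = 0\<^sub>v n"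
    proof (rule eq_vecI)
      fix a assume "a < dim_vec (0\<^sub>v n :: 'a vec)"
      then have a: "a < n" by simp
      have "(\<Sum>b\<in>S. c r b * v $ b) = (\<Sum>b\<in>S. c r b * z b)" for r
        using S by (intro sum.cong) (auto simp: v_def)
      then show "(minor_mat n (gram m c) S *\<^sub>v v) $ a = 0\<^sub>v n $ a"
        unfolding row[OF a v] using a z by (simp add: gram_apply) (simp add: v_def)
    qed simp
    ultimately show ?L unfolding det_0_iff_vec_prod_zero[OF minor_mat_carrier] using v by blast
  qed
qed

section \<open>Fraction-free elimination\<close>

text \<open>Columns from \<open>k\<close> on are unit vectors, so the determinant is the leading
  principal minor of order \<open>k\<close>, for \<open>k \<le> n\<close>. As the truncated
  \<open>y\<close> is again nonnegative, positivity of all pivots is an instance of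
  \<open>det_weighted_gram_pos\<close>.\<close>

definition pivot_mat :: "nat \<Rightarrow> (nat \<Rightarrow> nat \<Rightarrow> int) \<Rightarrow> (nat \<Rightarrow> int) \<Rightarrow> nat \<Rightarrow> int mat" where
  "pivot_mat n G y k = weighted_mat n G (\<lambda>b. if b < k then y b else 0)"

text \<open>
  By Cramer's rule this is the numerator, over the denominator \<open>det P\<close> for \<open>P = pivot_mat n G y k\<close>,
  of the entry \<open>(i, j)\<close> of the product of \<open>G\<close> with the inverse of \<open>P\<close> from the left.
\<close>

definition elim_entry :: "nat \<Rightarrow> (nat \<Rightarrow> nat \<Rightarrow> int) \<Rightarrow> (nat \<Rightarrow> int) \<Rightarrow> nat \<Rightarrow> nat \<Rightarrow> nat \<Rightarrow> int" where
  "elim_entry n G y k i j = det (replace_col (pivot_mat n G y k) (vec n (\<lambda>a. G a j)) i)"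

lemma pivot_mat_carrier [simp]: "pivot_mat n G y k \<in> carrier_mat n n"
  by (simp add: pivot_mat_def)

lemma pivot_mat_dim [simp]: "dim_row (pivot_mat n G y k) = n" "dim_col (pivot_mat n G y k) = n"
  by (simp_all add: pivot_mat_def)

lemma det_replace_col_smult:
  assumes A: "A \<in> carrier_mat n n" and x: "x \<in> carrier_vec n" and k: "k < n"
  shows "det (replace_col A (c \<cdot>\<^sub>v x) k) = c * det (replace_col A x k)"
proof -
  have R: "replace_col A b k \<in> carrier_mat n n" for b using A by (simp add: replace_col_def)
  have prod: "(\<Prod>j<n. replace_col A (c \<cdot>\<^sub>v x) k $$ (p j, j)) = c * (\<Prod>j<n. replace_col A x k $$ (p j, j))"
    if p: "p permutes {0..<n}" for p
  proof -
    have pj: "p j < n" if "j < n" for j using permutes_in_image[OF p, of j] that by simp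
    show ?thesis
      using A x k pj unfolding prod.remove[of "{..<n}" k, OF finite_lessThan lessThan_iff[THEN iffD2, OF k]]
      by (auto simp: replace_col_def intro!: prod.cong)
  qed
  show ?thesis
    unfolding det_col[OF R] sum_distrib_left using prod by (intro sum.cong) (auto simp: algebra_simps)
qed

text \<open>The adjugate supplies an integral solution of the system; Cramer's rule and cancellation
  of the nonzero determinant identify its entries with \<open>elim_entry\<close>.\<close>

lemma pivot_mat_elim_entry:
  assumes D: "det (pivot_mat n G y k) \<noteq> 0" and j: "j < n"
  shows "pivot_mat n G y k *\<^sub>v vec n (\<lambda>i. elim_entry n G y k i j)
    = det (pivot_mat n G y k) \<cdot>\<^sub>v vec n (\<lambda>a. G a j)"
proof -
  let ?P = "pivot_mat n G y k" and ?g = "vec n (\<lambda>a. G a j)"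
  define x where "x = adj_mat ?P *\<^sub>v ?g"
  have adj: "adj_mat ?P \<in> carrier_mat n n" by (rule adj_mat(1)) simp
  have x: "x \<in> carrier_vec n" unfolding x_def using adj by (intro mult_mat_vec_carrier) auto
  have Px: "?P *\<^sub>v x = det ?P \<cdot>\<^sub>v ?g"
  proof -
    have "?P *\<^sub>v x = (?P * adj_mat ?P) *\<^sub>v ?g"
      unfolding x_def by (rule assoc_mult_mat_vec[symmetric, of _ n n _ n]) (use adj in auto)
    also have "\<dots> = det ?P \<cdot>\<^sub>v ?g"
      unfolding adj_mat(2)[OF pivot_mat_carrier]
      by (rule eq_vecI) (auto simp: scalar_prod_def if_distrib[of "\<lambda>x. _ * x"] if_distrib[of "\<lambda>x. x * _"] cong: if_cong)
    finally show ?thesis .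
  qed
  have "x = vec n (\<lambda>i. elim_entry n G y k i j)"
  proof (rule eq_vecI)
    fix i assume "i < dim_vec (vec n (\<lambda>i. elim_entry n G y k i j))"
    then have i: "i < n" by simp
    have "det ?P * elim_entry n G y k i j = det (replace_col ?P (?P *\<^sub>v x) i)"
      unfolding Px elim_entry_def using i by (subst det_replace_col_smult[of _ n]) auto
    also have "\<dots> = x $ i * det ?P" by (rule cramer_lemma_mat[OF pivot_mat_carrier x i])
    finally show "x $ i = vec n (\<lambda>i. elim_entry n G y k i j) $ i" using D i by simp
  qed (use x in simp)
  with Px show ?thesis by simp
qed

text \<open>Passing from \<open>k\<close> to \<open>Suc k\<close> is a rank-one update, as only
  column \<open>k\<close> changes, by a multiple of a column of \<open>G\<close>.\<close>

lemma pivot_mat_Suc_mult: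
  assumes k: "k < n" and z: "z \<in> carrier_vec n"
  shows "pivot_mat n G y (Suc k) *\<^sub>v z = pivot_mat n G y k *\<^sub>v z + (y k * z $ k) \<cdot>\<^sub>v vec n (\<lambda>a. G a k)"
proof (rule eq_vecI)
  fix a assume "a < dim_vec (pivot_mat n G y k *\<^sub>v z + (y k * z $ k) \<cdot>\<^sub>v vec n (\<lambda>a. G a k))"
  then have a: "a < n" by simp
  let ?c = "\<lambda>k b. (of_bool (a = b) + G a b * (if b < k then y b else 0)) * z $ b"
  have *: "(pivot_mat n G y k *\<^sub>v z) $ a = (\<Sum>b<n. ?c k b)" for k
    using a z by (simp add: pivot_mat_def weighted_mat_def scalar_prod_def atLeast0LessThan)
  have "(\<Sum>b<n. ?c (Suc k) b) = (\<Sum>b<n. ?c k b + (if b = k then G a k * y k * z $ k else 0))"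
    by (intro sum.cong) (auto simp: algebra_simps less_Suc_eq)
  also have "\<dots> = (\<Sum>b<n. ?c k b) + G a k * y k * z $ k"
    using k by (simp add: sum.distrib)
  finally show "(pivot_mat n G y (Suc k) *\<^sub>v z) $ a
      = (pivot_mat n G y k *\<^sub>v z + (y k * z $ k) \<cdot>\<^sub>v vec n (\<lambda>a. G a k)) $ a"
    unfolding * using a by (simp add: *)
qed (use k in simp_all)

text \<open>Linearity of the determinant in column \<open>k\<close>, which grows from a unit vector
  by \<open>y k\<close> times column \<open>k\<close> of \<open>G\<close>.\<close>

lemma det_pivot_mat_Suc:
  assumes k: "k < n"
  shows "det (pivot_mat n G y (Suc k)) = det (pivot_mat n G y k) + y k * elim_entry n G y k k k"
proof -
  have R: "replace_col (pivot_mat n G y k) b k \<in> carrier_mat n n" for b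
    by (simp add: replace_col_def pivot_mat_def weighted_mat_def)
  have "(\<Prod>j<n. pivot_mat n G y (Suc k) $$ (p j, j)) = (\<Prod>j<n. pivot_mat n G y k $$ (p j, j))
      + y k * (\<Prod>j<n. replace_col (pivot_mat n G y k) (vec n (\<lambda>a. G a k)) k $$ (p j, j))"
    if p: "p permutes {0..<n}" for p
  proof -
    have pj: "p j < n" if "j < n" for j using permutes_in_image[OF p, of j] that by simp
    let ?rest = "\<Prod>j\<in>{..<n} - {k}. pivot_mat n G y k $$ (p j, j)"
    have 1: "(\<Prod>j\<in>{..<n} - {k}. pivot_mat n G y (Suc k) $$ (p j, j)) = ?rest"
      using pj by (intro prod.cong) (auto simp: pivot_mat_def weighted_mat_def less_Suc_eq)
    have 2: "(\<Prod>j\<in>{..<n} - {k}. replace_col (pivot_mat n G y k) (vec n (\<lambda>a. G a k)) k $$ (p j, j)) = ?rest"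
      using pj by (intro prod.cong) (auto simp: replace_col_def pivot_mat_def weighted_mat_def)
    show ?thesis
      unfolding prod.remove[of "{..<n}" k, OF finite_lessThan lessThan_iff[THEN iffD2, OF k]] 1 2
      using pj[OF k] k by (simp add: replace_col_def pivot_mat_def weighted_mat_def algebra_simps)
  qed
  then show ?thesis
    unfolding elim_entry_def det_col[OF R] det_col[OF pivot_mat_carrier] sum_distrib_left
      sum.distrib[symmetric]
    by (intro sum.cong) (auto simp: algebra_simps)
qed

text \<open>A step of fraction-free elimination in the manner of Bareiss. The division is exact
  because the new entry is itself a determinant of integers.\<close>

lemma elim_entry_Suc:
  assumes k: "k < n" and i: "i < n" and j: "j < n"
    and D: "det (pivot_mat n G y k) \<noteq> 0" and D': "det (pivot_mat n G y (Suc k)) \<noteq> 0"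
  shows "elim_entry n G y (Suc k) i j =
    (det (pivot_mat n G y (Suc k)) * elim_entry n G y k i j
       - y k * elim_entry n G y k i k * elim_entry n G y k k j) div det (pivot_mat n G y k)"
proof -
  let ?P = "pivot_mat n G y k" and ?P' = "pivot_mat n G y (Suc k)"
  let ?q = "elim_entry n G y k" and ?g = "\<lambda>j. vec n (\<lambda>a. G a j)"
  \<comment> \<open>The Sherman-Morrison formula for the rank-one update with denominators cleared:
    \<open>z\<close> will be \<open>det ?P\<close> times the new column.\<close>
  define z where "z = vec n (\<lambda>i. det ?P' * ?q i j - y k * ?q k j * ?q i k)"
  have zc: "z \<in> carrier_vec n" by (simp add: z_def)
  have Pq: "?P *\<^sub>v vec n (\<lambda>i. ?q i j) = det ?P \<cdot>\<^sub>v ?g j" if "j < n" for j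
    by (rule pivot_mat_elim_entry[OF D that])
  have z': "z = det ?P' \<cdot>\<^sub>v vec n (\<lambda>i. ?q i j) - (y k * ?q k j) \<cdot>\<^sub>v vec n (\<lambda>i. ?q i k)"
    by (rule eq_vecI) (auto simp: z_def)
  have smult: "?P *\<^sub>v (c \<cdot>\<^sub>v v) = c \<cdot>\<^sub>v (?P *\<^sub>v v)" if "v \<in> carrier_vec n" for c v
    using that by (intro eq_vecI) (auto simp: scalar_prod_def sum_distrib_left algebra_simps)
  have Pz: "?P *\<^sub>v z = det ?P' \<cdot>\<^sub>v (det ?P \<cdot>\<^sub>v ?g j) - (y k * ?q k j) \<cdot>\<^sub>v (det ?P \<cdot>\<^sub>v ?g k)"
    unfolding z' Pq[OF j, symmetric] Pq[OF k, symmetric]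
    by (subst mult_minus_distrib_mat_vec[of _ n n]) (simp_all add: smult)
  \<comment> \<open>\<open>det ?P' - y k * ?q k k\<close> is \<open>det ?P\<close>; with this value
    of \<open>z $ k\<close> the rank-one term cancels the multiple of column \<open>k\<close> in
    \<open>Pz\<close>.\<close>
  have zk: "z $ k = det ?P * ?q k j"
    using k by (simp add: z_def det_pivot_mat_Suc[OF k] algebra_simps)
  have "?P' *\<^sub>v z = (det ?P' * det ?P) \<cdot>\<^sub>v ?g j"
    unfolding pivot_mat_Suc_mult[OF k zc] Pz zk
    by (rule eq_vecI) (auto simp: algebra_simps)
  moreover have "det (replace_col ?P' (?P' *\<^sub>v z) i) = z $ i * det ?P'"
    by (rule cramer_lemma_mat[OF pivot_mat_carrier zc i])
  ultimately have "det ?P' * det ?P * elim_entry n G y (Suc k) i j = z $ i * det ?P'"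
    unfolding elim_entry_def[of n G y "Suc k"] using i
    by (simp add: det_replace_col_smult[of _ n])
  then have "elim_entry n G y (Suc k) i j * det ?P = z $ i" using D' by (simp add: mult.commute)
  then have "elim_entry n G y (Suc k) i j = z $ i div det ?P" using D by (metis nonzero_mult_div_cancel_right)
  then show ?thesis using i by (simp add: z_def algebra_simps)
qed

lemma elim_entry_0:
  assumes "i < n" shows "elim_entry n G y 0 i j = G i j"
proof -
  have P: "pivot_mat n G y 0 = 1\<^sub>m n"
    unfolding pivot_mat_def by (rule eq_matI) (auto simp: weighted_mat_def)
  have "elim_entry n G y 0 i j = det (replace_col (1\<^sub>m n) (1\<^sub>m n *\<^sub>v vec n (\<lambda>a. G a j)) i)"
    unfolding elim_entry_def P by simp
  also have "\<dots> = G i j" by (subst cramer_lemma_mat[of _ n]) (use assms in auto)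
  finally show ?thesis .
qed

lemma pivot_mat_0: "det (pivot_mat n G y 0) = 1"
  by (simp add: pivot_mat_def det_weighted_mat_0)

lemma pivot_mat_last: "pivot_mat n G y n = weighted_mat n G y"
  unfolding pivot_mat_def by (rule eq_matI) (auto simp: weighted_mat_def)

lemma det_pivot_gram_pos:
  assumes "\<And>b. b < n \<Longrightarrow> 0 \<le> y b"
  shows "0 < det (pivot_mat n (gram m c) y k)"
  unfolding pivot_mat_def by (rule det_weighted_gram_pos) (use assms in auto)

section \<open>Elimination in polynomial time\<close>

text \<open>The Leibniz formula has \<open>n!\<close> terms, at most \<open>2 ^ (n * n)\<close>,
  each of absolute value at most \<open>2 ^ (n * L)\<close>. The final 2 comes from the strict
  inequality and from the offset in \<open>bin_length\<close>.\<close>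

lemma bin_length_det:
  assumes A: "A \<in> carrier_mat n n" and L: "\<And>a b. a < n \<Longrightarrow> b < n \<Longrightarrow> bin_length (A $$ (a, b)) \<le> L"
  shows "bin_length (det A) \<le> n * n + n * L + 2"
proof -
  have entry: "\<bar>A $$ (a, b)\<bar> \<le> 2 ^ L" if "a < n" "b < n" for a b
  proof -
    have "bin_length (A $$ (a, b)) \<le> Suc L" using L[OF that] by simp
    then show ?thesis unfolding bin_length_le_iff by simp
  qed
  have "\<bar>det A\<bar> \<le> (\<Sum>p | p permutes {0..<n}. \<bar>signof p * (\<Prod>a = 0..<n. A $$ (a, p a))\<bar>)"
    unfolding det_def'[OF A] by (rule sum_abs)
  also have "\<dots> \<le> of_nat (card {p. p permutes {0..<n}}) * (2 ^ L) ^ n"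
  proof (rule sum_bounded_above)
    fix p assume "p \<in> {p. p permutes {0..<n}}"
    then have p: "p a < n" if "a < n" for a using permutes_in_image[of p "{0..<n}" a] that by simp
    have "\<bar>signof p * (\<Prod>a = 0..<n. A $$ (a, p a))\<bar> = (\<Prod>a = 0..<n. \<bar>A $$ (a, p a)\<bar>)"
      by (simp add: abs_mult abs_prod sign_def)
    also have "\<dots> \<le> (\<Prod>a = 0..<n. 2 ^ L)" using p by (intro prod_mono) (auto intro: entry)
    finally show "\<bar>signof p * (\<Prod>a = 0..<n. A $$ (a, p a))\<bar> \<le> (2 ^ L) ^ n" by simp
  qed
  also have "of_nat (card {p. p permutes {0..<n}}) \<le> (2 ^ (n * n) :: int)"
  proof -
    have "card {p. p permutes {0..<n}} = fact n" by (simp add: card_permutations)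
    also have "\<dots> \<le> n ^ n" using fact_le_power[of n, where ?'a = nat] by simp
    also have "\<dots> \<le> (2 ^ n) ^ n" by (intro power_mono) (auto simp: less_imp_le[OF less_exp])
    also have "\<dots> = 2 ^ (n * n)" by (simp add: power_mult)
    finally show ?thesis by (metis of_nat_le_iff of_nat_numeral of_nat_power)
  qed
  finally have "\<bar>det A\<bar> \<le> 2 ^ (n * n) * (2 ^ L) ^ n" by simp
  also have "\<dots> = 2 ^ (n * n + n * L)" by (simp add: power_add power_mult[symmetric] mult.commute)
  also have "\<dots> < (2 :: int) ^ (n * n + n * L + 1)" by simp
  finally show ?thesis using bin_length_le_iff[of "det A" "n * n + n * L + 1"] by simp
qed

text \<open>Every stored number is the determinant of a matrix whose entries have length at most
  \<open>L i\<close>; the bound \<open>B i\<close> therefore holds at every stage and nothing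
  compounds.\<close>

lemma poly_time_det_weighted:
  assumes G: "poly_time \<Gamma> u (\<lambda>i. tab (n i) (\<lambda>a. int_tab (n i) (G i a)))"
    and y: "poly_time \<Gamma> u (\<lambda>i. int_tab (n i) (y i))"
    and nonzero: "\<And>i k. i \<in> idx \<Gamma> \<Longrightarrow> det (pivot_mat (n i) (G i) (y i) k) \<noteq> 0"
  shows "poly_time_int \<Gamma> u (\<lambda>i. det (weighted_mat (n i) (G i) (y i)))"
proof -
  define D where "D = (\<lambda>i k. det (pivot_mat (n i) (G i) (y i) k))"
  define q where "q = (\<lambda>i k a b. elim_entry (n i) (G i) (y i) k (k + a) (k + b))"
  \<comment> \<open>Only the block of rows and columns from \<open>k\<close> on is kept; later steps
    never read outside it.\<close>
  define acc where "acc = (\<lambda>i k. Node (Leaf (D i k)) (tab (n i - k) (\<lambda>a. int_tab (n i - k) (q i k a))))"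
  have n: "poly_bounded \<Gamma> n"
    using poly_time_imp_bounded(2)[OF y] by (rule poly_bounded_tab_length)
  define L where "L = (\<lambda>i. 2 + val_length (tab (n i) (\<lambda>a. int_tab (n i) (G i a))) + val_length (int_tab (n i) (y i)))"
  define B where "B = (\<lambda>i. n i * n i + n i * L i + 2)"
  have B: "poly_bounded \<Gamma> B"
    unfolding B_def L_def
    by (intro poly_bounded_intros n poly_time_imp_bounded[OF G] poly_time_imp_bounded[OF y])
  have G_le: "bin_length (G i a b) \<le> val_length (tab (n i) (\<lambda>a. int_tab (n i) (G i a)))"
    if "a < n i" "b < n i" for i a b
    using val_length_tab_nth[of b "n i" "\<lambda>b. Leaf (G i a b)"]
      val_length_tab_nth[of a "n i" "\<lambda>a. int_tab (n i) (G i a)"] that by simp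
  have y_le: "bin_length (y i b) \<le> val_length (int_tab (n i) (y i))" if "b < n i" for i b
    using val_length_tab_nth[of b "n i" "\<lambda>b. Leaf (y i b)"] that by simp
  have entry_le: "bin_length (pivot_mat (n i) (G i) (y i) k $$ (a, b)) \<le> L i"
    if "a < n i" "b < n i" for i k a b
  proof -
    let ?y = "if b < k then y i b else 0"
    have "bin_length ?y \<le> bin_length (y i b)" using bin_length_pos[of "y i b"] by simp
    moreover have "bin_length (of_bool (a = b) :: int) \<le> 2" by simp
    moreover have eq: "pivot_mat (n i) (G i) (y i) k $$ (a, b) = of_bool (a = b) + G i a b * ?y"
      using that by (simp add: pivot_mat_def weighted_mat_def)
    ultimately show ?thesis
      using bin_length_add[of "of_bool (a = b)" "G i a b * ?y"] bin_length_mult[of "G i a b" ?y]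
        G_le[OF that] y_le[OF that(2)] unfolding L_def eq by linarith
  qed
  have D_le: "bin_length (D i k) \<le> B i" for i k
    unfolding D_def B_def using entry_le by (intro bin_length_det pivot_mat_carrier)
  have q_le: "bin_length (q i k a b) \<le> B i" if "k + b < n i" for i k a b
    unfolding q_def B_def elim_entry_def
  proof (rule bin_length_det)
    fix a' b' assume "a' < n i" "b' < n i"
    then show "bin_length (replace_col (pivot_mat (n i) (G i) (y i) k) (vec (n i) (\<lambda>a. G i a (k + b))) (k + a)
        $$ (a', b')) \<le> L i"
      using entry_le[of a' i b' k] G_le[OF _ that, of a'] by (auto simp: replace_col_def L_def)
  qed (simp add: replace_col_def)
  have "poly_time \<Gamma> u (\<lambda>i. acc i (n i))"
  proof (rule poly_time_fold[OF y])
    have "poly_time \<Gamma> u (\<lambda>i. Node (Leaf 1) (tab (n i) (\<lambda>a. int_tab (n i) (G i a))))"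
      by (rule poly_time_Node[OF poly_time_Const[OF G] G])
    then show "poly_time \<Gamma> u (\<lambda>i. acc i 0)"
      by (rule poly_time_cong[rotated])
        (auto simp: acc_def D_def q_def pivot_mat_0 elim_entry_0 intro!: tab_cong)
  next
    show "poly_bounded (steps \<Gamma> (\<lambda>i. Suc (n i))) (\<lambda>j. val_length (acc (fst j) (snd j)))"
    proof (rule poly_bounded_mono)
      show "poly_bounded (steps \<Gamma> (\<lambda>i. Suc (n i)))
         (\<lambda>j. 1 + B (fst j) + (1 + n (fst j) + n (fst j) * (1 + n (fst j) + n (fst j) * B (fst j))))"
        by (intro poly_bounded_intros poly_bounded_fst[OF n] poly_bounded_fst[OF B])
    next
      fix j assume "j \<in> idx (steps \<Gamma> (\<lambda>i. Suc (n i)))"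
      let ?i = "fst j" and ?k = "snd j"
      let ?l = "n ?i - ?k"
      have "(\<Sum>a<?l. val_length (int_tab ?l (q ?i ?k a))) \<le> of_nat (card {..<?l}) * (1 + n ?i + n ?i * B ?i)"
      proof (rule sum_bounded_above)
        fix a
        have "(\<Sum>b<?l. val_length (Leaf (q ?i ?k a b))) \<le> of_nat (card {..<?l}) * B ?i"
          by (rule sum_bounded_above) (auto intro!: q_le)
        also have "\<dots> \<le> n ?i * B ?i" by (intro mult_right_mono) auto
        finally show "val_length (int_tab ?l (q ?i ?k a)) \<le> 1 + n ?i + n ?i * B ?i"
          unfolding val_length_tab by linarith
      qed
      also have "\<dots> \<le> n ?i * (1 + n ?i + n ?i * B ?i)" by (intro mult_right_mono) auto
      finally show "val_length (acc ?i ?k) \<le> 1 + B ?i + (1 + n ?i + n ?i * (1 + n ?i + n ?i * B ?i))"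
        unfolding acc_def val_length.simps val_length_tab[of _ "\<lambda>a. int_tab _ (_ a)"]
        using D_le[of ?i ?k] by linarith
    qed
  next
    fix e
    let ?\<Gamma> = "steps \<Gamma> n"
    assume acc: "poly_time ?\<Gamma> e (\<lambda>j. acc (fst j) (snd j))"
      and yk: "poly_time_int ?\<Gamma> e (\<lambda>j. y (fst j) (snd j))"
    define N where "N = (\<lambda>j. n (fst j) - Suc (snd j))"
    define Q where "Q = (\<lambda>j. q (fst j) (snd j))"
    define D0 where "D0 = (\<lambda>j. D (fst j) (snd j))"
    define D1 where "D1 = (\<lambda>j. D (fst j) (Suc (snd j)))"
    define Y where "Y = (\<lambda>j. y (fst j) (snd j))"
    \<comment> \<open>Splitting off the first row and the head of each other row exposes the pivot
      entry, its row and its column; what is left is the block to be updated.\<close>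
    have "poly_time ?\<Gamma> e (\<lambda>j. Node (Leaf (D0 j))
       (Node (Node (Leaf (Q j 0 0)) (int_tab (N j) (\<lambda>b. Q j 0 (Suc b))))
         (tab (N j) (\<lambda>a. Node (Leaf (Q j (Suc a) 0)) (int_tab (N j) (\<lambda>b. Q j (Suc a) (Suc b)))))))"
    proof (rule poly_time_cong[OF _ acc])
      fix j assume "j \<in> idx ?\<Gamma>"
      then have "n (fst j) - snd j = Suc (N j)" by (auto simp: N_def Suc_diff_Suc)
      then show "acc (fst j) (snd j) = Node (Leaf (D0 j))
         (Node (Node (Leaf (Q j 0 0)) (int_tab (N j) (\<lambda>b. Q j 0 (Suc b))))
           (tab (N j) (\<lambda>a. Node (Leaf (Q j (Suc a) 0)) (int_tab (N j) (\<lambda>b. Q j (Suc a) (Suc b))))))"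
        by (simp add: acc_def D0_def Q_def tab_Suc)
    qed
    note D0 = poly_time_fst[OF this] and matrix = poly_time_snd[OF this]
    note h = poly_time_fst[OF poly_time_fst[OF matrix]]
      and t = poly_time_snd[OF poly_time_fst[OF matrix]] and rows = poly_time_snd[OF matrix]
    have D1: "poly_time_int ?\<Gamma> e D1"
    proof (rule poly_time_cong[OF _ poly_time_add[OF D0 poly_time_mult[OF yk h]]])
      fix j assume "j \<in> idx ?\<Gamma>"
      then show "Leaf (D0 j + y (fst j) (snd j) * Q j 0 0) = Leaf (D1 j)"
        by (simp add: D0_def D1_def D_def Q_def q_def det_pivot_mat_Suc)
    qed
    define R where "R = (\<lambda>j a b. (D1 j * Q j (Suc a) (Suc b) - Y j * Q j (Suc a) 0 * Q j 0 (Suc b)) div D0 j)"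
    have "poly_time ?\<Gamma> e (\<lambda>j. tab (N j) (\<lambda>a. int_tab (N j) (R j a)))"
    proof (rule poly_time_map[OF rows])
      fix e'
      assume row: "poly_time (steps ?\<Gamma> N) e' (\<lambda>l. Node (Leaf (Q (fst l) (Suc (snd l)) 0))
          (int_tab (N (fst l)) (\<lambda>b. Q (fst l) (Suc (snd l)) (Suc b))))"
        and lift: "\<And>h. poly_time ?\<Gamma> e h \<Longrightarrow> poly_time (steps ?\<Gamma> N) e' (\<lambda>l. h (fst l))"
      show "poly_time (steps ?\<Gamma> N) e' (\<lambda>l. int_tab (N (fst l)) (R (fst l) (snd l)))"
      proof (rule poly_time_map2[OF poly_time_snd[OF row] lift[OF t]])
        let ?\<Gamma>' = "steps (steps ?\<Gamma> N) (\<lambda>l. N (fst l))"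
        fix e''
        assume ab: "poly_time_int ?\<Gamma>' e'' (\<lambda>l. Q (fst (fst l)) (Suc (snd (fst l))) (Suc (snd l)))"
          and kb: "poly_time_int ?\<Gamma>' e'' (\<lambda>l. Q (fst (fst l)) 0 (Suc (snd l)))"
          and lift': "\<And>h. poly_time (steps ?\<Gamma> N) e' h \<Longrightarrow> poly_time ?\<Gamma>' e'' (\<lambda>l. h (fst l))"
        have ak: "poly_time_int ?\<Gamma>' e'' (\<lambda>l. Q (fst (fst l)) (Suc (snd (fst l))) 0)"
          by (rule lift'[OF poly_time_fst[OF row]])
        have Y: "poly_time_int ?\<Gamma>' e'' (\<lambda>l. Y (fst (fst l)))"
          using lift'[OF lift[OF yk]] unfolding Y_def .
        show "poly_time_int ?\<Gamma>' e'' (\<lambda>l. R (fst (fst l)) (snd (fst l)) (snd l))"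
          unfolding R_def
          by (intro poly_time_div poly_time_diff poly_time_mult ab ak kb Y
              lift'[OF lift[OF D0]] lift'[OF lift[OF D1]])
      qed
    qed
    then have "poly_time ?\<Gamma> e (\<lambda>j. Node (Leaf (D1 j)) (tab (N j) (\<lambda>a. int_tab (N j) (R j a))))"
      by (rule poly_time_Node[OF D1])
    then show "poly_time ?\<Gamma> e (\<lambda>j. acc (fst j) (Suc (snd j)))"
    proof (rule poly_time_cong[rotated])
      fix j assume j: "j \<in> idx ?\<Gamma>"
      have "R j a b = q (fst j) (Suc (snd j)) a b" if "a < N j" "b < N j" for a b
        using that j unfolding R_def D0_def D1_def Y_def Q_def q_def D_def N_def
        by (simp add: elim_entry_Suc nonzero)
      then have "tab (N j) (\<lambda>a. int_tab (N j) (R j a)) = tab (N j) (\<lambda>a. int_tab (N j) (q (fst j) (Suc (snd j)) a))"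
        by (intro tab_cong) simp
      then show "Node (Leaf (D1 j)) (tab (N j) (\<lambda>a. int_tab (N j) (R j a))) = acc (fst j) (Suc (snd j))"
        by (simp add: acc_def D1_def N_def)
    qed
  qed
  from poly_time_fst[OF this[unfolded acc_def]] show ?thesis
    unfolding D_def pivot_mat_last .
qed

text \<open>The input comes by rows. Adding the outer product of each row to a running matrix avoids
  any access by columns.\<close>

lemma poly_time_gram:
  assumes rows: "poly_time \<Gamma> u (\<lambda>i. tab (m i) (\<lambda>r. int_tab (n i) (c i r)))"
    and n: "poly_time_int \<Gamma> u (\<lambda>i. int (n i))" and N: "poly_bounded \<Gamma> n"
  shows "poly_time \<Gamma> u (\<lambda>i. tab (n i) (\<lambda>a. int_tab (n i) (gram (m i) (c i) a)))"
proof -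
  define g where "g = (\<lambda>i r. gram r (c i))"
  have "poly_time \<Gamma> u (\<lambda>i. tab (n i) (\<lambda>a. int_tab (n i) (g i (m i) a)))"
  proof (rule poly_time_fold[OF rows, where acc = "\<lambda>i r. tab (n i) (\<lambda>a. int_tab (n i) (g i r a))"])
    note upto = poly_time_upto[OF n N]
    have "poly_time \<Gamma> u (\<lambda>i. int_tab (n i) (\<lambda>b. 0))"
      by (rule poly_time_map[OF upto]) (rule poly_time_Const)
    then have "poly_time \<Gamma> u (\<lambda>i. tab (n i) (\<lambda>a. int_tab (n i) (\<lambda>b. 0)))"
      by (intro poly_time_map[OF upto])
    then show "poly_time \<Gamma> u (\<lambda>i. tab (n i) (\<lambda>a. int_tab (n i) (g i 0 a)))"
      by (simp add: g_def gram_def)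
  next
    define L where "L = (\<lambda>i. val_length (tab (m i) (\<lambda>r. int_tab (n i) (c i r))))"
    have L: "poly_bounded \<Gamma> L" unfolding L_def by (rule poly_time_imp_bounded[OF rows])
    show "poly_bounded (steps \<Gamma> (\<lambda>i. Suc (m i)))
       (\<lambda>j. val_length (tab (n (fst j)) (\<lambda>a. int_tab (n (fst j)) (g (fst j) (snd j) a))))"
    proof (rule poly_bounded_mono)
      show "poly_bounded (steps \<Gamma> (\<lambda>i. Suc (m i))) (\<lambda>j. 1 + n (fst j) +
         n (fst j) * (1 + n (fst j) + n (fst j) * (1 + 2 * L (fst j))))"
        by (intro poly_bounded_intros poly_bounded_fst[OF N] poly_bounded_fst[OF L])
    next
      fix j assume j: "j \<in> idx (steps \<Gamma> (\<lambda>i. Suc (m i)))"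
      let ?i = "fst j" and ?r = "snd j"
      have col: "(\<Sum>r<?r. bin_length (c ?i r a)) \<le> L ?i" if "a < n ?i" for a
      proof -
        have "(\<Sum>r<?r. bin_length (c ?i r a)) \<le> (\<Sum>r<m ?i. bin_length (c ?i r a))"
          using j by (intro sum_mono2) auto
        also have "\<dots> \<le> (\<Sum>r<m ?i. val_length (int_tab (n ?i) (c ?i r)))"
          using val_length_tab_nth[of a "n ?i" "\<lambda>a. Leaf (c ?i _ a)"] that by (intro sum_mono) auto
        also have "\<dots> \<le> L ?i" unfolding L_def val_length_tab[of "m ?i"] by linarith
        finally show ?thesis .
      qed
      have entry: "bin_length (g ?i ?r a b) \<le> 1 + 2 * L ?i" if "a < n ?i" "b < n ?i" for a b
      proof -
        have "bin_length (g ?i ?r a b) \<le> 1 + (\<Sum>r<?r. bin_length (c ?i r a * c ?i r b))"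
          unfolding g_def gram_def by (rule bin_length_sum) simp
        also have "\<dots> \<le> 1 + ((\<Sum>r<?r. bin_length (c ?i r a)) + (\<Sum>r<?r. bin_length (c ?i r b)))"
          unfolding sum.distrib[symmetric] by (intro add_left_mono sum_mono bin_length_mult)
        also have "\<dots> \<le> 1 + 2 * L ?i" using col[OF that(1)] col[OF that(2)] by linarith
        finally show ?thesis .
      qed
      have "(\<Sum>a<n ?i. val_length (int_tab (n ?i) (g ?i ?r a)))
          \<le> of_nat (card {..<n ?i}) * (1 + n ?i + n ?i * (1 + 2 * L ?i))"
      proof (rule sum_bounded_above)
        fix a assume "a \<in> {..<n ?i}"
        then have "(\<Sum>b<n ?i. val_length (Leaf (g ?i ?r a b))) \<le> of_nat (card {..<n ?i}) * (1 + 2 * L ?i)"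
          by (intro sum_bounded_above) (use entry in auto)
        then show "val_length (int_tab (n ?i) (g ?i ?r a)) \<le> 1 + n ?i + n ?i * (1 + 2 * L ?i)"
          unfolding val_length_tab by simp
      qed
      then show "val_length (tab (n ?i) (\<lambda>a. int_tab (n ?i) (g ?i ?r a)))
          \<le> 1 + n ?i + n ?i * (1 + n ?i + n ?i * (1 + 2 * L ?i))"
        unfolding val_length_tab[of _ "\<lambda>a. int_tab _ (_ a)"] by simp
    qed
  next
    let ?\<Gamma> = "steps \<Gamma> m"
    fix e
    assume acc: "poly_time ?\<Gamma> e (\<lambda>j. tab (n (fst j)) (\<lambda>a. int_tab (n (fst j)) (g (fst j) (snd j) a)))"
      and row: "poly_time ?\<Gamma> e (\<lambda>j. int_tab (n (fst j)) (c (fst j) (snd j)))"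
    define C where "C = (\<lambda>j. c (fst j) (snd j))"
    define H where "H = (\<lambda>j. g (fst j) (snd j))"
    define N where "N = (\<lambda>j :: _ \<times> nat. n (fst j))"
    have acc': "poly_time ?\<Gamma> e (\<lambda>j. tab (N j) (\<lambda>a. int_tab (N j) (H j a)))"
      using acc by (simp add: N_def H_def)
    have row': "poly_time ?\<Gamma> e (\<lambda>j. int_tab (N j) (C j))"
      using row by (simp add: N_def C_def)
    have "poly_time ?\<Gamma> e (\<lambda>j. tab (N j) (\<lambda>a. int_tab (N j) (\<lambda>b. H j a b + C j a * C j b)))"
    proof (rule poly_time_map2[OF acc' row'])
      fix e'
      assume 1: "poly_time (steps ?\<Gamma> N) e' (\<lambda>l. int_tab (N (fst l)) (H (fst l) (snd l)))"
        and 2: "poly_time_int (steps ?\<Gamma> N) e' (\<lambda>l. C (fst l) (snd l))"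
        and lift: "\<And>h. poly_time ?\<Gamma> e h \<Longrightarrow> poly_time (steps ?\<Gamma> N) e' (\<lambda>l. h (fst l))"
      show "poly_time (steps ?\<Gamma> N) e'
          (\<lambda>l. int_tab (N (fst l)) (\<lambda>b. H (fst l) (snd l) b + C (fst l) (snd l) * C (fst l) b))"
      proof (rule poly_time_map2[OF 1 lift[OF row']])
        let ?\<Gamma>' = "steps (steps ?\<Gamma> N) (\<lambda>l. N (fst l))"
        fix e''
        assume 3: "poly_time_int ?\<Gamma>' e'' (\<lambda>l. H (fst (fst l)) (snd (fst l)) (snd l))"
          and 4: "poly_time_int ?\<Gamma>' e'' (\<lambda>l. C (fst (fst l)) (snd l))"
          and lift': "\<And>h. poly_time (steps ?\<Gamma> N) e' h \<Longrightarrow> poly_time ?\<Gamma>' e'' (\<lambda>l. h (fst l))"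
        show "poly_time_int ?\<Gamma>' e'' (\<lambda>l. H (fst (fst l)) (snd (fst l)) (snd l) +
            C (fst (fst l)) (snd (fst l)) * C (fst (fst l)) (snd l))"
          by (intro poly_time_add poly_time_mult 3 4 lift'[OF 2])
      qed
    qed
    then show "poly_time ?\<Gamma> e (\<lambda>j. tab (n (fst j)) (\<lambda>a. int_tab (n (fst j)) (g (fst j) (Suc (snd j)) a)))"
      by (simp add: N_def H_def C_def g_def gram_def)
  qed
  then show ?thesis by (simp add: g_def)
qed

section \<open>Independent sets and bases\<close>

text \<open>\<open>lin_dep\<close> speaks of the set of columns, the Gram minor of the family
  indexed by \<open>S\<close>. Injectivity on \<open>S\<close> makes the two agree.\<close>

lemma vectorial_indep_iff:
  assumes A: "A \<in> carrier_mat m n"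
  shows "vectorial_indep A S \<longleftrightarrow>
    S \<subseteq> {..<n} \<and> det (minor_mat n (gram m (\<lambda>r a. A $$ (r, a))) S) \<noteq> 0"
proof (cases "S \<subseteq> {..<n}")
  case True
  then have finS: "finite S" using finite_subset by blast
  interpret vec_space "TYPE(rat)" m .
  define v where "v = col (map_mat rat_of_int A)"
  define c where "c = (\<lambda>r a. rat_of_int (A $$ (r, a)))"
  have v: "v j \<in> carrier_vec m" "r < m \<Longrightarrow> v j $ r = c r j" if "j \<in> S" for j r
    using that A True by (auto simp: v_def c_def)
  have vS: "v ` S \<subseteq> carrier_vec m" using v by auto
  have entry: "lincomb a (v ` S) $ r = (\<Sum>j\<in>S. c r j * a (v j))" if "inj_on v S" "r < m" for a r
    unfolding lincomb_index[OF that(2) vS] sum.reindex[OF that(1)]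
    using v that by (intro sum.cong) (auto simp: mult.commute)
  have "inj_on v S \<and> lin_indpt (v ` S) \<longleftrightarrow>
    \<not> (\<exists>z. (\<exists>j\<in>S. z j \<noteq> 0) \<and> (\<forall>r<m. (\<Sum>j\<in>S. c r j * z j) = 0))" (is "?L \<longleftrightarrow> \<not> ?R")
  proof
    assume L: ?L
    show "\<not> ?R"
    proof
      assume ?R
      then obtain z j where j: "j \<in> S" "z j \<noteq> 0" and z: "\<And>r. r < m \<Longrightarrow> (\<Sum>j\<in>S. c r j * z j) = 0"
        by blast
      \<comment> \<open>Injectivity lets coefficients on indices be carried over to coefficients on
        vectors.\<close>
      define a where "a = (\<lambda>w. z (the_inv_into S v w))"
      have a: "a (v j) = z j" if "j \<in> S" for j
        using L that by (simp add: a_def the_inv_into_f_f)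
      have "lincomb a (v ` S) = 0\<^sub>v m"
      proof (rule eq_vecI)
        fix r assume "r < dim_vec (0\<^sub>v m :: rat vec)"
        then have r: "r < m" by simp
        have "(\<Sum>j\<in>S. c r j * a (v j)) = 0" using z[OF r] a by simp
        then show "lincomb a (v ` S) $ r = 0\<^sub>v m $ r" using L r by (simp add: entry)
      qed (use finS vS in \<open>simp add: lincomb_dim\<close>)
      then have "lin_dep (v ` S)"
        using finite_imageI[OF finS, of v] j a
        by (intro lin_dep_crit[where A = "v ` S" and S = "v ` S" and a = a and v = "v j"]) auto
      then show False using L by simp
    qed
  next
    assume R: "\<not> ?R"
    have inj: "inj_on v S"
    proof (rule inj_onI, rule ccontr)
      fix j k assume jk: "j \<in> S" "k \<in> S" "v j = v k" "j \<noteq> k"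
      \<comment> \<open>Two equal columns satisfy a nontrivial relation with coefficients 1 and
        -1.\<close>
      define z :: "nat \<Rightarrow> rat" where "z = (\<lambda>l. if l = j then 1 else if l = k then - 1 else 0)"
      have "(\<Sum>l\<in>S. c r l * z l) = 0" if "r < m" for r
      proof -
        have "(\<Sum>l\<in>S. c r l * z l) = (\<Sum>l\<in>S. (if l = j then c r j else 0) - (if l = k then c r k else 0))"
          using jk by (intro sum.cong) (auto simp: z_def)
        also have "\<dots> = c r j - c r k" using jk finS by (simp add: sum_subtractf)
        also have "\<dots> = 0" using v(2)[of j r] v(2)[of k r] jk that by simp
        finally show ?thesis .
      qed
      moreover have "z j \<noteq> 0" by (simp add: z_def)
      ultimately show False using R jk by blast
    qed
    moreover have "lin_indpt (v ` S)"
    proof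
      assume "lin_dep (v ` S)"
      then obtain a w where a: "lincomb a (v ` S) = 0\<^sub>v m" and w: "w \<in> v ` S" "a w \<noteq> 0"
        using finite_lin_dep[OF finite_imageI[OF finS, of v] _ vS] by blast
      then obtain j where j: "j \<in> S" "a (v j) \<noteq> 0" by auto
      have kernel: "(\<Sum>j\<in>S. c r j * a (v j)) = 0" if "r < m" for r
        using entry[OF inj that, of a] a that by simp
      have ?R
        by (intro exI[of _ "\<lambda>j. a (v j)"] conjI bexI[of _ j] allI impI) (use j kernel in simp_all)
      with R show False ..
    qed
    ultimately show ?L by blast
  qed
  also have "\<dots> \<longleftrightarrow> det (minor_mat n (gram m c) S) \<noteq> 0"
    by (simp add: det_minor_gram_eq_0_iff[OF True])
  also have "\<dots> \<longleftrightarrow> det (minor_mat n (gram m (\<lambda>r a. A $$ (r, a))) S) \<noteq> 0"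
    unfolding c_def gram_of_int det_minor_mat_of_int by simp
  finally show ?thesis
    using A True unfolding vectorial_indep_def v_def by (auto simp: atLeast0LessThan)
next
  case False
  then show ?thesis using A by (auto simp: vectorial_indep_def)
qed

text \<open>By maximality every column indexed by \<open>S\<close> lies in the span of those indexed
  by \<open>B\<close>, for otherwise \<open>B\<close> could be extended. Steinitz exchange
  (\<open>replacement\<close>) then compares the cardinalities.\<close>

lemma card_indep_le_base:
  assumes B: "vectorial_base A B" and S: "vectorial_indep A S"
  shows "card S \<le> card B"
proof -
  define m where "m = dim_row A"
  interpret vec_space "TYPE(rat)" m .
  define v where "v = col (map_mat rat_of_int A)"
  have indep: "vectorial_indep A S \<longleftrightarrow> S \<subseteq> {0..<dim_col A} \<and> inj_on v S \<and> lin_indpt (v ` S)" for S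
    unfolding vectorial_indep_def v_def m_def ..
  have v: "v j \<in> carrier_vec m" for j
    using col_dim[of "map_mat rat_of_int A" j] unfolding v_def m_def by (simp only: index_map_mat)
  have Bi: "vectorial_indep A B" using B by (simp add: vectorial_base_def)
  have fin: "finite S" "finite B"
    using S Bi finite_subset[OF _ finite_atLeastLessThan] unfolding indep by blast+
  have "v ` S \<subseteq> span (v ` B)"
  proof (rule image_subsetI, rule ccontr)
    fix j assume j: "j \<in> S" "v j \<notin> span (v ` B)"
    have "v ` B \<subseteq> span (v ` B)" using v by (intro in_own_span) auto
    with j have notin: "v j \<notin> v ` B" by auto
    have "lin_indpt (v ` B \<union> {v j})"
      using lin_dep_iff_in_span[of "v ` B" "v j"] v Bi j notin by (auto simp: indep)
    then have "vectorial_indep A (insert j B)"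
      using Bi S j notin by (auto simp: indep)
    then have "insert j B = B" using B by (auto simp: vectorial_base_def)
    then show False using notin by auto
  qed
  moreover have "v ` B \<subseteq> carrier_vec m" using v by auto
  moreover have "lin_indpt (v ` S)" using S unfolding indep by (elim conjE)
  ultimately have "\<exists>C. finite C \<and> C \<subseteq> carrier_vec m \<and> C \<subseteq> span (v ` B) \<and> C \<inter> v ` S = {} \<and>
      int (card C) \<le> int (card (v ` B)) - int (card (v ` S)) \<and> span (v ` S \<union> C) = span (v ` B)"
    by (intro replacement finite_imageI fin)
  then have "card (v ` S) \<le> card (v ` B)" by (elim exE conjE) linarith
  then show ?thesis using S Bi by (simp add: indep card_image)
qed

lemma vectorial_baseI:
  assumes B: "vectorial_indep A B" and max: "\<And>S. vectorial_indep A S \<Longrightarrow> card S \<le> card B"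
  shows "vectorial_base A B"
  unfolding vectorial_base_def
proof (intro conjI allI impI B)
  fix S assume S: "vectorial_indep A S \<and> B \<subseteq> S"
  then have "finite S" using finite_subset[OF _ finite_atLeastLessThan] unfolding vectorial_indep_def by blast
  then show "S = B" using S max[of S] by (metis card_seteq)
qed

section \<open>Reading off coefficients\<close>

lemma digit_sum:
  fixes T :: int
  assumes a: "\<And>p. p < N \<Longrightarrow> 0 \<le> a p \<and> a p < T" and q: "q < N"
  shows "(\<Sum>p<N. a p * T ^ p) div T ^ q mod T = a q"
  using assms
proof (induction N arbitrary: a q)
  case (Suc N)
  have T: "0 < T" using Suc.prems by fastforce
  let ?R = "\<Sum>p<N. a (Suc p) * T ^ p"
  have "(\<Sum>p<Suc N. a p * T ^ p) = a 0 + T * ?R"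
    by (subst sum.lessThan_Suc_shift) (simp add: sum_distrib_left algebra_simps)
  then have eq: "(\<Sum>p<Suc N. a p * T ^ p) = ?R * T + a 0" by simp
  show ?case
  proof (cases q)
    case 0
    then show ?thesis using Suc.prems(1)[of 0] unfolding eq by simp
  next
    case (Suc q')
    have "(?R * T + a 0) div T ^ q = (?R * T + a 0) div T div T ^ q'"
      using T by (simp add: Suc zdiv_zmult2_eq)
    also have "(?R * T + a 0) div T = ?R" using Suc.prems(1)[of 0] T by simp
    finally show ?thesis
      unfolding eq using Suc.IH[of "\<lambda>p. a (Suc p)" q'] Suc.prems Suc by simp
  qed
qed simp

section \<open>Packing a weight vector into one exponent\<close>

text \<open>
  \<open>pack K x r c\<close> has the digits \<open>x (r - 1), \<dots>, x 0\<close> and the leading part \<open>c\<close> in base \<open>K\<close>; the digits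
  are balanced, with \<open>K = 2 * M + 1\<close> and \<open>\<bar>x i\<bar> \<le> M\<close>.
\<close>

fun pack :: "int \<Rightarrow> (nat \<Rightarrow> int) \<Rightarrow> nat \<Rightarrow> int \<Rightarrow> int" where
  "pack K x 0 c = c"
| "pack K x (Suc r) c = pack K x r c * K + x r"

text \<open>Adding \<open>M\<close> moves a balanced digit into the range from 0 to
  \<open>2 * M\<close>, where rounding down strips it off correctly.\<close>

fun unpack_rest :: "int \<Rightarrow> int \<Rightarrow> nat \<Rightarrow> int" where
  "unpack_rest M p 0 = p"
| "unpack_rest M p (Suc r) = (unpack_rest M p r + M) div (2 * M + 1)"

definition unpack_digit :: "int \<Rightarrow> int \<Rightarrow> nat \<Rightarrow> int" where
  "unpack_digit M p r = (unpack_rest M p r + M) mod (2 * M + 1) - M"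

text \<open>Digits are read from the least significant end, where \<open>pack\<close> put the last
  coordinate; hence the reversed index.\<close>

definition unpack_vec :: "int \<Rightarrow> nat \<Rightarrow> int \<Rightarrow> int vec" where
  "unpack_vec M d p = vec d (\<lambda>i. unpack_digit M p (d - Suc i))"

text \<open>Packing is linear in digits and leading part together. The exponents of a set thus add
  up to its packed weight vector, headed by its cardinality when every leading part is 1.\<close>

lemma pack_sum:
  "finite S \<Longrightarrow> (\<Sum>j\<in>S. pack K (\<lambda>i. x i j) r (c j)) = pack K (\<lambda>i. \<Sum>j\<in>S. x i j) r (\<Sum>j\<in>S. c j)"
  by (induction r) (simp_all add: sum.distrib sum_distrib_right[symmetric])

text \<open>The leading part outweighs all negative digits, so the packed number is a legitimate
  exponent although weights may be negative.\<close>

lemma pack_pos: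
  assumes "\<And>i. i < r \<Longrightarrow> \<bar>x i\<bar> \<le> M" "1 \<le> c"
  shows "1 \<le> pack (2 * M + 1) x r c"
  using assms
proof (induction r)
  case (Suc r)
  then have 1: "1 \<le> pack (2 * M + 1) x r c" by simp
  have M: "\<bar>x r\<bar> \<le> M" using Suc.prems by simp
  define y where "y = pack (2 * M + 1) x r c * (2 * M + 1)"
  have "0 \<le> M" using M by (rule order_trans[OF abs_ge_zero])
  then have "1 * (2 * M + 1) \<le> y"
    unfolding y_def using 1 by (intro mult_right_mono) auto
  moreover have "- x r \<le> M" using M by (simp add: abs_le_iff)
  ultimately show ?case using \<open>0 \<le> M\<close> unfolding pack.simps y_def[symmetric] by simp
qed simp

lemma pack_le:
  assumes "\<And>i. i < r \<Longrightarrow> \<bar>x i\<bar> \<le> M"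
  shows "pack (2 * M + 1) x r 1 \<le> (2 * (2 * M + 1)) ^ r"
  using assms
proof (induction r)
  case (Suc r)
  define K where "K = 2 * M + 1"
  have M: "\<bar>x r\<bar> \<le> M" using Suc.prems by simp
  then have K: "1 \<le> K" "\<bar>x r\<bar> \<le> K" by (auto simp: K_def)
  have IH: "pack K x r 1 \<le> (2 * K) ^ r" using Suc by (simp add: K_def)
  have "1 \<le> (2 * K) ^ r" by (rule one_le_power) (use K in simp)
  then have "1 * K \<le> (2 * K) ^ r * K" using K by (intro mult_right_mono) auto
  moreover have "pack K x r 1 * K \<le> (2 * K) ^ r * K" using IH K by (intro mult_right_mono) auto
  ultimately have "pack K x r 1 * K + x r \<le> (2 * K) ^ r * K + (2 * K) ^ r * K" using K by linarith
  then show ?case unfolding K_def[symmetric] by (simp add: algebra_simps)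
qed simp

lemma unpack_pack:
  assumes x: "\<And>i. i < d \<Longrightarrow> \<bar>x i\<bar> \<le> M" and p: "p = pack (2 * M + 1) x d c"
  shows "r \<le> d \<Longrightarrow> unpack_rest M p r = pack (2 * M + 1) x (d - r) c"
    and "r < d \<Longrightarrow> unpack_digit M p r = x (d - Suc r)"
proof -
  have split: "(pack (2 * M + 1) x (Suc k) c + M) div (2 * M + 1) = pack (2 * M + 1) x k c"
    "(pack (2 * M + 1) x (Suc k) c + M) mod (2 * M + 1) = x k + M" if "k < d" for k
  proof -
    have "0 \<le> x k + M" "x k + M < 2 * M + 1" using x[OF that] by auto
    moreover have "pack (2 * M + 1) x (Suc k) c + M = (x k + M) + pack (2 * M + 1) x k c * (2 * M + 1)"
      by simp
    ultimately show "(pack (2 * M + 1) x (Suc k) c + M) div (2 * M + 1) = pack (2 * M + 1) x k c"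
      "(pack (2 * M + 1) x (Suc k) c + M) mod (2 * M + 1) = x k + M"
      by (simp_all only: div_mult_self1 mod_mult_self1 div_pos_pos_trivial mod_pos_pos_trivial)
  qed
  show rest: "unpack_rest M p r = pack (2 * M + 1) x (d - r) c" if "r \<le> d" for r
    using that
  proof (induction r)
    case (Suc r)
    have d: "d - r = Suc (d - Suc r)" using Suc.prems by (simp add: Suc_diff_Suc)
    have "unpack_rest M p (Suc r) = (pack (2 * M + 1) x (Suc (d - Suc r)) c + M) div (2 * M + 1)"
      using Suc unfolding d[symmetric] by simp
    then show ?case using Suc.prems by (simp only: split(1))
  qed (simp add: p)
  show "unpack_digit M p r = x (d - Suc r)" if "r < d"
  proof -
    have d: "d - r = Suc (d - Suc r)" using that by (simp add: Suc_diff_Suc)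
    show ?thesis
      using that split(2)[of "d - Suc r"] rest[of r] unfolding unpack_digit_def d by simp
  qed
qed

section \<open>Correctness of the algorithm\<close>

text \<open>Zeros outside \<open>R\<close> kill all terms except those of subsets of
  \<open>R\<close>. Terms with a common exponent merge into one digit, nonzero as soon as one of
  them is. The sum over all subsets of \<open>{..<n}\<close> stays below \<open>T\<close>, so the
  same \<open>T\<close> serves every \<open>R\<close>.\<close>

lemma digit_nonzero_iff:
  fixes c :: "nat \<Rightarrow> nat \<Rightarrow> int" and e :: "nat \<Rightarrow> nat"
  assumes R: "R \<subseteq> {..<n}" and T: "T = 1 + det (weighted_mat n (gram m c) (\<lambda>_. 1))"
  shows "det (weighted_mat n (gram m c) (\<lambda>j. if j \<in> R then T ^ e j else 0)) div T ^ p mod T \<noteq> 0 \<longleftrightarrow>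
    (\<exists>S\<subseteq>R. det (minor_mat n (gram m c) S) \<noteq> 0 \<and> (\<Sum>j\<in>S. e j) = p)"
proof -
  define g where "g = (\<lambda>S. det (minor_mat n (gram m c) S))"
  define pos where "pos = (\<lambda>S. \<Sum>j\<in>S. e j)"
  define a where "a = (\<lambda>p. \<Sum>S\<in>{S \<in> Pow R. pos S = p}. g S)"
  \<comment> \<open>The range of exponents is stretched to include \<open>p\<close>, which may
    exceed all that occur; its digit is then an empty sum.\<close>
  define N where "N = Suc (max p (pos R))"
  have finR: "finite R" using R finite_subset by blast
  have g: "0 \<le> g S" if "S \<subseteq> R" for S
    unfolding g_def using det_minor_gram_nonneg[of S n m c] that R by auto
  have "det (weighted_mat n (gram m c) (\<lambda>j. if j \<in> R then T ^ e j else 0))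
      = (\<Sum>S\<in>Pow {..<n}. g S * (\<Prod>j\<in>S. if j \<in> R then T ^ e j else 0))"
    unfolding det_weighted_mat g_def ..
  also have "\<dots> = (\<Sum>S\<in>Pow R. g S * (\<Prod>j\<in>S. if j \<in> R then T ^ e j else 0))"
  proof (rule sum.mono_neutral_right)
    show "\<forall>S\<in>Pow {..<n} - Pow R. g S * (\<Prod>j\<in>S. if j \<in> R then T ^ e j else 0) = 0"
    proof
      fix S assume "S \<in> Pow {..<n} - Pow R"
      then obtain j where "j \<in> S" "j \<notin> R" "finite S" using finite_subset by auto
      then have "(\<Prod>j\<in>S. if j \<in> R then T ^ e j else 0) = 0" by (intro prod_zero) auto
      then show "g S * (\<Prod>j\<in>S. if j \<in> R then T ^ e j else 0) = 0" by simp
    qed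
  qed (use R in auto)
  also have "\<dots> = (\<Sum>S\<in>Pow R. g S * T ^ pos S)"
  proof (intro sum.cong refl arg_cong2[where f = "(*)"])
    fix S assume "S \<in> Pow R"
    then have "(\<Prod>j\<in>S. if j \<in> R then T ^ e j else 0) = (\<Prod>j\<in>S. T ^ e j)" by (intro prod.cong) auto
    then show "(\<Prod>j\<in>S. if j \<in> R then T ^ e j else 0) = T ^ pos S" by (simp add: pos_def power_sum)
  qed
  also have "\<dots> = (\<Sum>p<N. \<Sum>S\<in>{S \<in> Pow R. pos S = p}. g S * T ^ pos S)"
  proof (rule sum.group[symmetric])
    show "pos ` Pow R \<subseteq> {..<N}"
      using finR by (auto simp: N_def pos_def less_Suc_eq_le intro!: max.coboundedI2 sum_mono2)
  qed (use finR in auto)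
  also have "\<dots> = (\<Sum>p<N. a p * T ^ p)"
    unfolding a_def sum_distrib_right by (intro sum.cong) auto
  finally have det: "det (weighted_mat n (gram m c) (\<lambda>j. if j \<in> R then T ^ e j else 0)) = (\<Sum>p<N. a p * T ^ p)" .
  have "0 \<le> a q \<and> a q < T" for q
  proof
    show "0 \<le> a q" unfolding a_def using g by (intro sum_nonneg) auto
    have "a q \<le> (\<Sum>S\<in>Pow {..<n}. g S)"
      unfolding a_def using R det_minor_gram_nonneg[of _ n m c] by (intro sum_mono2) (auto simp: g_def)
    also have "\<dots> < T" unfolding T det_weighted_mat g_def by simp
    finally show "a q < T" .
  qed
  then have "(\<Sum>p<N. a p * T ^ p) div T ^ p mod T = a p"
    by (intro digit_sum) (auto simp: N_def)
  then have "det (weighted_mat n (gram m c) (\<lambda>j. if j \<in> R then T ^ e j else 0)) div T ^ p mod T \<noteq> 0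
      \<longleftrightarrow> a p \<noteq> 0" by (simp add: det)
  also have "\<dots> \<longleftrightarrow> (\<exists>S\<in>{S \<in> Pow R. pos S = p}. g S \<noteq> 0)"
    unfolding a_def using finR g by (subst sum_nonneg_eq_0_iff) auto
  finally show ?thesis by (auto simp: g_def pos_def)
qed

section \<open>Linear search for an optimal exponent and greedy deletion\<close>

fun select :: "(nat \<Rightarrow> bool) \<Rightarrow> (nat \<Rightarrow> nat \<Rightarrow> bool) \<Rightarrow> nat \<Rightarrow> nat" where
  "select C better 0 = 0"
| "select C better (Suc p) = (if C p \<and> \<not> better (select C better p) p then p else select C better p)"

lemma select_le: "select C better N \<le> N"
  by (induction N) auto

text \<open>A scan that keeps the best candidate so far. \<open>better\<close> is a total preorder
  only, as different exponents may tie; \<open>C 0\<close> makes the initial value 0 a genuine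
  candidate.\<close>

lemma select_optimal:
  assumes "C 0" and refl: "\<And>p. better p p" and total: "\<And>p q. better p q \<or> better q p"
    and trans: "\<And>p q r. better p q \<Longrightarrow> better q r \<Longrightarrow> better p r"
  shows "C (select C better N) \<and> (\<forall>p<N. C p \<longrightarrow> better (select C better N) p)"
proof (induction N)
  case 0
  then show ?case using \<open>C 0\<close> by simp
next
  case (Suc N)
  show ?case
  proof (cases "C N \<and> \<not> better (select C better N) N")
    case True
    then have "better N (select C better N)" using total by blast
    then show ?thesis using True Suc refl trans by (auto simp: less_Suc_eq)
  next
    case False
    then show ?thesis using Suc by (auto simp: less_Suc_eq)
  qed
qed

fun shrink :: "(nat set \<Rightarrow> bool) \<Rightarrow> nat \<Rightarrow> nat \<Rightarrow> nat set" where
  "shrink P n 0 = {..<n}"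
| "shrink P n (Suc k) = (if P (shrink P n k - {k}) then shrink P n k - {k} else shrink P n k)"

lemma shrink_subset: "shrink P n k \<subseteq> {..<n}"
  by (induction k) auto

lemma shrink_antimono: "k \<le> l \<Longrightarrow> shrink P n l \<subseteq> shrink P n k"
  by (induction l rule: dec_induct) auto

text \<open>Some witness \<open>S\<close> survives inside the final set. If an element
  \<open>k\<close> were left outside \<open>S\<close>, then \<open>S\<close> would already have
  allowed the deletion of \<open>k\<close> at its turn. So the final set is \<open>S\<close>, with
  no appeal to an exchange property.\<close>

lemma shrink_minimal:
  assumes P: "\<And>R. R \<subseteq> {..<n} \<Longrightarrow> P R \<longleftrightarrow> (\<exists>S\<subseteq>R. Q S)" and "P {..<n}"
  shows "Q (shrink P n n)"
proof -
  have "P (shrink P n k)" for k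
    using \<open>P {..<n}\<close> by (induction k) auto
  then obtain S where S: "S \<subseteq> shrink P n n" "Q S"
    using P[OF shrink_subset] by blast
  have "shrink P n n \<subseteq> S"
  proof
    fix k assume k: "k \<in> shrink P n n"
    show "k \<in> S"
    proof (rule ccontr)
      assume "k \<notin> S"
      have "k < n" using k shrink_subset by blast
      then have "shrink P n n \<subseteq> shrink P n (Suc k)" by (intro shrink_antimono) simp
      then have "k \<in> shrink P n (Suc k)" using k by blast
      then have "\<not> P (shrink P n k - {k})" by (auto split: if_splits)
      moreover have "S \<subseteq> shrink P n k - {k}"
        using S \<open>k \<notin> S\<close> shrink_antimono[of k n P n] \<open>k < n\<close> by auto
      moreover have "shrink P n k - {k} \<subseteq> {..<n}" using shrink_subset by blast
      ultimately show False using P S by blast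
    qed
  qed
  then show ?thesis using S by (simp add: subset_antisym)
qed

text \<open>A bound on all partial sums of weights, computable with ring operations alone and still
  polynomial in the largest weight.\<close>

definition weight_bound :: "nat \<Rightarrow> nat \<Rightarrow> (nat \<Rightarrow> int vec) \<Rightarrow> int" where
  "weight_bound d n w = (\<Sum>i<d. \<Sum>j<n. (w i $ j)\<^sup>2)"

definition exponent :: "nat \<Rightarrow> nat \<Rightarrow> (nat \<Rightarrow> int vec) \<Rightarrow> nat \<Rightarrow> nat" where
  "exponent d n w j = nat (pack (2 * weight_bound d n w + 1) (\<lambda>i. w i $ j) d 1)"

definition radix :: "nat \<Rightarrow> nat \<Rightarrow> (nat \<Rightarrow> nat \<Rightarrow> int) \<Rightarrow> int" where
  "radix m n c = 1 + det (weighted_mat n (gram m c) (\<lambda>_. 1))"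

definition occurrence ::
  "nat \<Rightarrow> nat \<Rightarrow> nat \<Rightarrow> (nat \<Rightarrow> nat \<Rightarrow> int) \<Rightarrow> (nat \<Rightarrow> int vec) \<Rightarrow> nat \<Rightarrow> nat set \<Rightarrow> int" where
  "occurrence d m n c w p R = det (weighted_mat n (gram m c)
     (\<lambda>j. if j \<in> R then radix m n c ^ exponent d n w j else 0)) div radix m n c ^ p mod radix m n c"

text \<open>The leading part \<open>unpack_rest M p d\<close> is the cardinality of the sets that occur at \<open>p\<close>.\<close>

definition preferred :: "nat \<Rightarrow> int \<Rightarrow> (real vec \<Rightarrow> real) \<Rightarrow> nat \<Rightarrow> nat \<Rightarrow> bool" where
  "preferred d M f p q \<longleftrightarrow> unpack_rest M (int q) d < unpack_rest M (int p) d \<or>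
     unpack_rest M (int q) d = unpack_rest M (int p) d \<and>
     f (map_vec real_of_int (unpack_vec M d (int p))) \<le> f (map_vec real_of_int (unpack_vec M d (int q)))"

definition best_exponent :: "nat \<Rightarrow> nat \<Rightarrow> nat \<Rightarrow> (nat \<Rightarrow> nat \<Rightarrow> int) \<Rightarrow> (nat \<Rightarrow> int vec) \<Rightarrow> (real vec \<Rightarrow> real) \<Rightarrow> nat" where
  "best_exponent d m n c w f = select (\<lambda>p. occurrence d m n c w p {..<n} \<noteq> 0)
     (preferred d (weight_bound d n w) f) (Suc (\<Sum>j<n. exponent d n w j))"

definition best_set :: "nat \<Rightarrow> nat \<Rightarrow> nat \<Rightarrow> (nat \<Rightarrow> nat \<Rightarrow> int) \<Rightarrow> (nat \<Rightarrow> int vec) \<Rightarrow> (real vec \<Rightarrow> real) \<Rightarrow> nat set" where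
  "best_set d m n c w f = shrink (\<lambda>R. occurrence d m n c w (best_exponent d m n c w f) R \<noteq> 0) n n"

lemma abs_le_square: "\<bar>a :: int\<bar> \<le> a\<^sup>2"
  by (metis abs_ge_zero abs_le_square_iff abs_of_nonneg power2_abs self_le_power zero_less_numeral
      zero_le_power2 linorder_not_less int_one_le_iff_zero_less order_le_less power_zero_numeral)

lemma abs_sum_weight_le:
  assumes S: "S \<subseteq> {..<n}" and i: "i < d"
  shows "\<bar>\<Sum>j\<in>S. w i $ j\<bar> \<le> weight_bound d n w"
proof -
  have "\<bar>\<Sum>j\<in>S. w i $ j\<bar> \<le> (\<Sum>j\<in>S. (w i $ j)\<^sup>2)"
    by (intro order_trans[OF sum_abs] sum_mono abs_le_square)
  also have "\<dots> \<le> (\<Sum>j<n. (w i $ j)\<^sup>2)" using S by (intro sum_mono2) auto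
  also have "\<dots> \<le> weight_bound d n w"
    unfolding weight_bound_def using i
    by (intro member_le_sum[of i "{..<d}" "\<lambda>i. \<Sum>j<n. (w i $ j)\<^sup>2"]) (auto intro: sum_nonneg)
  finally show ?thesis .
qed

lemma sum_exponent:
  assumes S: "S \<subseteq> {..<n}"
  shows "int (\<Sum>j\<in>S. exponent d n w j)
    = pack (2 * weight_bound d n w + 1) (\<lambda>i. \<Sum>j\<in>S. w i $ j) d (int (card S))"
proof -
  have fin: "finite S" using S finite_subset by blast
  have "int (exponent d n w j) = pack (2 * weight_bound d n w + 1) (\<lambda>i. w i $ j) d 1" if "j \<in> S" for j
    using pack_pos[of d "\<lambda>i. w i $ j" "weight_bound d n w" 1] abs_sum_weight_le[where S = "{j}" and n = n and w = w] that S
    unfolding exponent_def by force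
  then have "int (\<Sum>j\<in>S. exponent d n w j) = (\<Sum>j\<in>S. pack (2 * weight_bound d n w + 1) (\<lambda>i. w i $ j) d 1)"
    by simp
  then show ?thesis by (simp add: pack_sum[OF fin])
qed

lemma unpack_exponent:
  assumes S: "S \<subseteq> {..<n}"
  shows "unpack_rest (weight_bound d n w) (int (\<Sum>j\<in>S. exponent d n w j)) d = int (card S)"
    and "unpack_vec (weight_bound d n w) d (int (\<Sum>j\<in>S. exponent d n w j)) = weight_vec d w S"
proof -
  note * = unpack_pack[OF abs_sum_weight_le[OF S, where w = w and d = d] sum_exponent[OF S, where w = w and d = d]]
  show "unpack_rest (weight_bound d n w) (int (\<Sum>j\<in>S. exponent d n w j)) d = int (card S)"
    using *(1)[of d] by simp
  show "unpack_vec (weight_bound d n w) d (int (\<Sum>j\<in>S. exponent d n w j)) = weight_vec d w S"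
  proof (rule eq_vecI)
    fix i assume "i < dim_vec (weight_vec d w S)"
    then have i: "i < d" by (simp add: weight_vec_def)
    then have "d - Suc (d - Suc i) = i" by simp
    then show "unpack_vec (weight_bound d n w) d (int (\<Sum>j\<in>S. exponent d n w j)) $ i = weight_vec d w S $ i"
      using i *(2)[of "d - Suc i"] by (simp only: unpack_vec_def weight_vec_def index_vec)
  qed (simp add: unpack_vec_def weight_vec_def)
qed

text \<open>The preference ranks cardinality first, so the chosen set is a largest independent set
  and hence a base; among bases, which have equal cardinality, only \<open>f\<close>
  decides.\<close>

lemma optimal_best_set:
  assumes A: "A \<in> carrier_mat m n"
  shows "optimal_base d A w f (best_set d m n (\<lambda>r a. A $$ (r, a)) w f)"
proof -
  define c where "c = (\<lambda>r a. A $$ (r, a))"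
  define M where "M = weight_bound d n w"
  define pos where "pos = (\<lambda>S. \<Sum>j\<in>S. exponent d n w j)"
  define p where "p = best_exponent d m n c w f"
  define B where "B = best_set d m n c w f"
  have indep: "vectorial_indep A S \<longleftrightarrow> S \<subseteq> {..<n} \<and> det (minor_mat n (gram m c) S) \<noteq> 0" for S
    unfolding c_def by (rule vectorial_indep_iff[OF A])
  have occurs: "occurrence d m n c w q R \<noteq> 0 \<longleftrightarrow> (\<exists>S\<subseteq>R. vectorial_indep A S \<and> pos S = q)"
    if "R \<subseteq> {..<n}" for q R
    unfolding occurrence_def digit_nonzero_iff[OF that radix_def] indep pos_def using that by blast
  \<comment> \<open>The empty set is independent and sits at exponent 0, which validates the default
    value of \<open>select\<close>.\<close>
  have "minor_mat n (gram m c) {} = 1\<^sub>m n" by (rule eq_matI) (auto simp: minor_mat_def)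
  then have "vectorial_indep A {}" by (simp add: indep)
  then have "occurrence d m n c w 0 {..<n} \<noteq> 0"
    unfolding occurs[OF subset_refl] by (intro exI[of _ "{}"]) (simp add: pos_def)
  then have p: "occurrence d m n c w p {..<n} \<noteq> 0 \<and>
      (\<forall>q<Suc (pos {..<n}). occurrence d m n c w q {..<n} \<noteq> 0 \<longrightarrow> preferred d M f p q)"
    unfolding p_def best_exponent_def pos_def M_def
    by (rule select_optimal) (auto simp: preferred_def)
  then have "vectorial_indep A B \<and> pos B = p"
    unfolding B_def best_set_def p_def[symmetric]
    by (intro shrink_minimal[where Q = "\<lambda>S. vectorial_indep A S \<and> pos S = p"])
      (simp_all only: occurs)
  then have B: "vectorial_indep A B" "pos B = p" by auto
  have preferred: "card S < card B \<or> card S = card B \<and>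
      f (map_vec real_of_int (weight_vec d w B)) \<le> f (map_vec real_of_int (weight_vec d w S))"
    if S: "vectorial_indep A S" for S
  proof -
    have S': "S \<subseteq> {..<n}" and B': "B \<subseteq> {..<n}" using S B by (simp_all add: indep)
    have "occurrence d m n c w (pos S) {..<n} \<noteq> 0" unfolding occurs[OF subset_refl] using S indep by blast
    moreover have "pos S < Suc (pos {..<n})"
      unfolding pos_def less_Suc_eq_le using S by (intro sum_mono2) (auto simp: indep)
    ultimately have "preferred d M f (pos B) (pos S)" using p B by simp
    then show ?thesis
      unfolding preferred_def pos_def M_def unpack_exponent[OF S'] unpack_exponent[OF B'] by auto
  qed
  have base: "vectorial_base A B"
  proof (rule vectorial_baseI[OF B(1)])
    show "card S \<le> card B" if "vectorial_indep A S" for S using preferred[OF that] by auto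
  qed
  show ?thesis
    unfolding optimal_base_def c_def[symmetric] B_def[symmetric]
  proof (intro conjI allI impI base)
    fix B' assume B': "vectorial_base A B'"
    then have "vectorial_indep A B'" by (simp add: vectorial_base_def)
    \<comment> \<open>This excludes the first alternative of the preference and leaves the
      comparison by \<open>f\<close>.\<close>
    moreover have "card B \<le> card B'" using card_indep_le_base[OF B' B(1)] .
    ultimately show "f (map_vec real_of_int (weight_vec d w B)) \<le> f (map_vec real_of_int (weight_vec d w B'))"
      using preferred[of B'] by auto
  qed
qed

section \<open>The algorithm in polynomial time\<close>

text \<open>The index is a constant, so the access is unrolled into the program; it serves the
  weight vectors, whose number \<open>d\<close> is fixed.\<close>

lemma poly_time_nth:
  "poly_time \<Gamma> u (\<lambda>i. tab r (x i)) \<Longrightarrow> k < r \<Longrightarrow> poly_time \<Gamma> u (\<lambda>i. x i k)"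
proof (induction r arbitrary: x k)
  case (Suc r)
  note xs = Suc.prems(1)[unfolded tab_Suc]
  show ?case
  proof (cases k)
    case 0
    then show ?thesis using poly_time_fst[OF xs] by simp
  next
    case (Suc k')
    then show ?thesis using Suc.IH[OF poly_time_snd[OF xs], of k'] Suc.prems by simp
  qed
qed simp

lemma poly_time_sum_const:
  fixes r :: nat
  assumes "\<And>k. k < r \<Longrightarrow> poly_time_int \<Gamma> u (\<lambda>i. a i k)" "poly_time \<Gamma> u v"
  shows "poly_time_int \<Gamma> u (\<lambda>i. \<Sum>k<r. a i k)"
  using assms
proof (induction r)
  case 0
  then show ?case using poly_time_Const by simp
next
  case (Suc r)
  have "poly_time_int \<Gamma> u (\<lambda>i. (\<Sum>k<r. a i k) + a i r)"
    by (intro poly_time_add Suc) simp_all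
  then show ?case by simp
qed

lemma poly_time_weight_bound:
  assumes w: "\<And>k. k < d \<Longrightarrow> poly_time \<Gamma> u (\<lambda>i. int_tab (n i) (\<lambda>j. w i k $ j))"
    and v: "poly_time \<Gamma> u v"
  shows "poly_time_int \<Gamma> u (\<lambda>i. weight_bound d (n i) (w i))"
  unfolding weight_bound_def power2_eq_square
proof (rule poly_time_sum_const[OF _ v])
  fix k assume "k < d"
  show "poly_time_int \<Gamma> u (\<lambda>i. \<Sum>j<n i. w i k $ j * w i k $ j)"
  proof (rule poly_time_sum, rule poly_time_map[OF w[OF \<open>k < d\<close>]])
    fix e assume "poly_time_int (steps \<Gamma> n) e (\<lambda>j. w (fst j) k $ snd j)"
    then show "poly_time_int (steps \<Gamma> n) e (\<lambda>j. w (fst j) k $ snd j * w (fst j) k $ snd j)"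
      by (intro poly_time_mult)
  qed
qed

lemma poly_time_pack:
  assumes w: "\<And>k. k < r \<Longrightarrow> poly_time \<Gamma> u (\<lambda>i. int_tab (n i) (\<lambda>j. w i k $ j))"
    and K: "poly_time_int \<Gamma> u K"
    and upto: "poly_time \<Gamma> u (\<lambda>i. int_tab (n i) int)"
  shows "poly_time \<Gamma> u (\<lambda>i. int_tab (n i) (\<lambda>j. pack (K i) (\<lambda>k. w i k $ j) r 1))"
  using w
proof (induction r)
  case 0
  have "poly_time \<Gamma> u (\<lambda>i. int_tab (n i) (\<lambda>j. 1))"
    by (rule poly_time_map[OF upto]) (rule poly_time_Const)
  then show ?case by simp
next
  case (Suc r)
  have IH: "poly_time \<Gamma> u (\<lambda>i. int_tab (n i) (\<lambda>j. pack (K i) (\<lambda>k. w i k $ j) r 1))"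
    by (rule Suc.IH) (use Suc.prems in simp)
  have wr: "poly_time \<Gamma> u (\<lambda>i. int_tab (n i) (\<lambda>j. w i r $ j))"
    by (rule Suc.prems) simp
  show ?case
    unfolding pack.simps
  proof (rule poly_time_map2[OF IH wr])
    fix e
    assume "poly_time_int (steps \<Gamma> n) e (\<lambda>j. pack (K (fst j)) (\<lambda>k. w (fst j) k $ snd j) r 1)"
      "poly_time_int (steps \<Gamma> n) e (\<lambda>j. w (fst j) r $ snd j)"
      "\<And>h. poly_time \<Gamma> u h \<Longrightarrow> poly_time (steps \<Gamma> n) e (\<lambda>j. h (fst j))"
    then show "poly_time_int (steps \<Gamma> n) e
        (\<lambda>j. pack (K (fst j)) (\<lambda>k. w (fst j) k $ snd j) r 1 * K (fst j) + w (fst j) r $ snd j)"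
      using K by (intro poly_time_add poly_time_mult)
  qed
qed

lemma poly_time_unpack:
  assumes M: "poly_time_int \<Gamma> u M" and p: "poly_time_int \<Gamma> u p"
  shows "poly_time_int \<Gamma> u (\<lambda>i. unpack_rest (M i) (p i) r)"
    and "poly_time_int \<Gamma> u (\<lambda>i. unpack_digit (M i) (p i) r)"
    and "poly_time \<Gamma> u (\<lambda>i. encode_vec (unpack_vec (M i) d (p i)))"
proof -
  note const = poly_time_Const[OF M]
  show rest: "poly_time_int \<Gamma> u (\<lambda>i. unpack_rest (M i) (p i) r)" for r
  proof (induction r)
    case (Suc r)
    then show ?case
      unfolding unpack_rest.simps by (intro poly_time_div poly_time_add poly_time_mult M const)
  qed (simp add: p)
  show digit: "poly_time_int \<Gamma> u (\<lambda>i. unpack_digit (M i) (p i) r)" for r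
    unfolding unpack_digit_def
    by (intro poly_time_diff poly_time_mod poly_time_add poly_time_mult M const rest)
  \<comment> \<open>Digits come out from the last coordinate to the first, so pushing each onto the
    front gives the proper order.\<close>
  have "poly_time \<Gamma> u (\<lambda>i. encode_list (map Leaf (rev (map (unpack_digit (M i) (p i)) [0..<r]))))" for r
  proof (induction r)
    case 0
    then show ?case using const by simp
  next
    case (Suc r)
    then show ?case using poly_time_Node[OF digit[of r] Suc] by simp
  qed
  moreover have "list_of_vec (unpack_vec (M i) d (p i)) = rev (map (unpack_digit (M i) (p i)) [0..<d])" for i
    by (rule nth_equalityI) (auto simp: unpack_vec_def rev_nth)
  ultimately show "poly_time \<Gamma> u (\<lambda>i. encode_vec (unpack_vec (M i) d (p i)))"
    unfolding encode_vec_def by simp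
qed

lemma poly_time_preferred:
  assumes M: "poly_time_int \<Gamma> u M"
    and p: "poly_time_int \<Gamma> u (\<lambda>i. int (p i))" and q: "poly_time_int \<Gamma> u (\<lambda>i. int (q i))"
  shows "poly_time_int \<Gamma> u (\<lambda>i. of_bool (preferred (dim \<Gamma>) (M i) (objective \<Gamma> i) (p i) (q i)))"
proof -
  note p' = poly_time_unpack(1)[OF M p, of "dim \<Gamma>"] and q' = poly_time_unpack(1)[OF M q, of "dim \<Gamma>"]
  note query = poly_time_query[OF poly_time_unpack(3)[OF M p, of "dim \<Gamma>"] poly_time_unpack(3)[OF M q, of "dim \<Gamma>"]]
  show ?thesis
    \<comment> \<open>A failed \<open>\<le>\<close> settles the case of unequal cardinalities in
      either direction; only ties reach the oracle.\<close>
    by (rule poly_time_cong[OF _ poly_time_if[OF poly_time_le[OF p' q'] poly_time_Const[OF M]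
          poly_time_if[OF poly_time_le[OF q' p'] poly_time_Const[OF M] query]]])
      (auto simp: preferred_def unpack_vec_def)
qed

lemma poly_time_occurrence:
  assumes G: "poly_time \<Gamma> u (\<lambda>i. tab (n i) (\<lambda>a. int_tab (n i) (gram (m i) (c i) a)))"
    and T: "poly_time_int \<Gamma> u (\<lambda>i. radix (m i) (n i) (c i))"
    and y: "poly_time \<Gamma> u
      (\<lambda>i. int_tab (n i) (\<lambda>j. if j \<in> R i then radix (m i) (n i) (c i) ^ exponent d (n i) (w i) j else 0))"
    and p: "poly_time_int \<Gamma> u (\<lambda>i. int (p i))" "poly_bounded \<Gamma> p"
  shows "poly_time_int \<Gamma> u (\<lambda>i. occurrence d (m i) (n i) (c i) (w i) (p i) (R i))"
proof -
  have "0 \<le> radix m n c" for m n c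
    unfolding radix_def using det_weighted_gram_pos[of n "\<lambda>_. 1" m c] by simp
  then have "det (pivot_mat (n i) (gram (m i) (c i))
      (\<lambda>j. if j \<in> R i then radix (m i) (n i) (c i) ^ exponent d (n i) (w i) j else 0) k) \<noteq> 0" for i k
    by (intro less_imp_neq[OF det_pivot_gram_pos, symmetric]) simp
  from poly_time_det_weighted[OF G y this] show ?thesis
    unfolding occurrence_def by (intro poly_time_mod poly_time_div poly_time_power T p)
qed

lemma shrink_superset: "{k..<n} \<subseteq> shrink P n k"
  by (induction k) auto

text \<open>The fate of an index is decided at its own turn and never revised, so the output list
  can grow alongside the deletions; pushing onto the front makes it decreasing.\<close>

lemma filter_shrink:
  assumes "k < n"
  shows "rev (filter (\<lambda>j. j \<in> shrink P n (Suc k)) [0..<Suc k]) =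
    (if P (shrink P n k - {k}) then [] else [k]) @ rev (filter (\<lambda>j. j \<in> shrink P n k) [0..<k])"
proof -
  have "k \<in> shrink P n k" using shrink_superset[of k n P] assms by auto
  moreover have "filter (\<lambda>j. j \<in> shrink P n k \<and> j \<noteq> k) [0..<k] = filter (\<lambda>j. j \<in> shrink P n k) [0..<k]"
    by (rule filter_cong) auto
  ultimately show ?thesis by simp
qed

text \<open>Polynomial only because \<open>d\<close> is fixed: it appears as the exponent of the
  bound.\<close>

lemma exponent_le:
  assumes "j < n"
  shows "exponent d n w j \<le> (2 * (2 * nat (weight_bound d n w) + 1)) ^ d"
proof -
  let ?M = "weight_bound d n w"
  have M: "0 \<le> ?M" unfolding weight_bound_def by (intro sum_nonneg) auto
  have "pack (2 * ?M + 1) (\<lambda>i. w i $ j) d 1 \<le> (2 * (2 * ?M + 1)) ^ d"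
    using abs_sum_weight_le[where S = "{j}" and n = n and w = w and d = d] assms
    by (intro pack_le) simp
  also have "\<dots> = int ((2 * (2 * nat ?M + 1)) ^ d)" using M by (simp add: add.commute)
  finally show ?thesis unfolding exponent_def by linarith
qed

lemma poly_time_best_set:
  fixes \<Gamma> :: "'i family" and w :: "'i \<Rightarrow> nat \<Rightarrow> int vec"
  defines "d \<equiv> dim \<Gamma>"
  assumes n: "poly_time_int \<Gamma> u (\<lambda>i. int (n i))" "poly_bounded \<Gamma> n"
    and rows: "poly_time \<Gamma> u (\<lambda>i. tab (m i) (\<lambda>r. int_tab (n i) (c i r)))"
    and w: "\<And>k. k < d \<Longrightarrow> poly_time \<Gamma> u (\<lambda>i. int_tab (n i) (\<lambda>j. w i k $ j))"
    and bnd: "poly_bounded \<Gamma> (\<lambda>i. nat (weight_bound d (n i) (w i)))"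
  shows "poly_time \<Gamma> u (\<lambda>i. encode_nats (rev (filter
    (\<lambda>j. j \<in> best_set d (m i) (n i) (c i) (w i) (objective \<Gamma> i)) [0..<n i])))"
proof -
  define M where "M = (\<lambda>i. weight_bound d (n i) (w i))"
  define ex where "ex = (\<lambda>i. exponent d (n i) (w i))"
  define T where "T = (\<lambda>i. radix (m i) (n i) (c i))"
  define G where "G = (\<lambda>i. gram (m i) (c i))"
  define occ where "occ = (\<lambda>i. occurrence d (m i) (n i) (c i) (w i))"
  define ys where "ys = (\<lambda>i R. int_tab (n i) (\<lambda>j. if j \<in> R then T i ^ ex i j else 0))"
  define N where "N = (\<lambda>i. Suc (\<Sum>j<n i. ex i j))"
  note const = poly_time_Const[OF n(1)]
  note upto = poly_time_upto[OF n]
  have M: "poly_time_int \<Gamma> u M"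
    unfolding M_def by (rule poly_time_weight_bound[OF w n(1)])
  have "poly_time \<Gamma> u (\<lambda>i. int_tab (n i) (\<lambda>j. pack (2 * M i + 1) (\<lambda>k. w i k $ j) d 1))"
    using w by (intro poly_time_pack upto poly_time_add poly_time_mult const M)
  then have ex: "poly_time \<Gamma> u (\<lambda>i. int_tab (n i) (\<lambda>j. int (ex i j)))"
  proof (rule poly_time_cong[rotated], intro tab_cong)
    fix i j assume "j < n i"
    then show "Leaf (pack (2 * M i + 1) (\<lambda>k. w i k $ j) d 1) = Leaf (int (ex i j))"
      using sum_exponent[of "{j}" "n i" d "w i"] by (simp add: M_def ex_def)
  qed
  have ex_bnd: "poly_bounded (steps \<Gamma> n) (\<lambda>j. ex (fst j) (snd j))"
  proof (rule poly_bounded_mono)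
    show "poly_bounded (steps \<Gamma> n) (\<lambda>j. (2 * (2 * nat (weight_bound d (n (fst j)) (w (fst j))) + 1)) ^ d)"
      by (intro poly_bounded_power poly_bounded_mult poly_bounded_add poly_bounded_const
          poly_bounded_fst[OF bnd])
    show "ex (fst j) (snd j) \<le> (2 * (2 * nat (weight_bound d (n (fst j)) (w (fst j))) + 1)) ^ d"
      if "j \<in> idx (steps \<Gamma> n)" for j
      unfolding ex_def by (rule exponent_le) (use that in simp)
  qed
  have N: "poly_time_int \<Gamma> u (\<lambda>i. int (N i))" "poly_bounded \<Gamma> N"
  proof -
    have "poly_time_int \<Gamma> u (\<lambda>i. 1 + (\<Sum>j<n i. int (ex i j)))"
      by (intro poly_time_add const poly_time_sum ex)
    then show "poly_time_int \<Gamma> u (\<lambda>i. int (N i))" by (simp add: N_def)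
    show "poly_bounded \<Gamma> N"
      unfolding N_def using poly_bounded_sum[OF ex_bnd n(2)] by (intro poly_bounded_Suc) simp
  qed
  have G: "poly_time \<Gamma> u (\<lambda>i. tab (n i) (\<lambda>a. int_tab (n i) (G i a)))"
    unfolding G_def by (rule poly_time_gram[OF rows n])
  have T: "poly_time_int \<Gamma> u T"
  proof -
    have ones: "poly_time \<Gamma> u (\<lambda>i. int_tab (n i) (\<lambda>j. 1))"
      by (rule poly_time_map[OF upto]) (rule poly_time_Const)
    have "det (pivot_mat (n i) (G i) (\<lambda>_. 1) k) \<noteq> 0" for i k
      unfolding G_def by (rule less_imp_neq[OF det_pivot_gram_pos, symmetric]) simp
    from poly_time_det_weighted[OF G ones this] show ?thesis
      unfolding T_def radix_def G_def by (intro poly_time_add const)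
  qed
  have "poly_time \<Gamma> u (\<lambda>i. int_tab (n i) (\<lambda>j. T i ^ ex i j))"
  proof (rule poly_time_map[OF ex])
    fix e
    assume "poly_time_int (steps \<Gamma> n) e (\<lambda>j. int (ex (fst j) (snd j)))"
      and "\<And>h. poly_time \<Gamma> u h \<Longrightarrow> poly_time (steps \<Gamma> n) e (\<lambda>j. h (fst j))"
    then show "poly_time_int (steps \<Gamma> n) e (\<lambda>j. T (fst j) ^ ex (fst j) (snd j))"
      using T ex_bnd by (intro poly_time_power)
  qed
  then have ys_all: "poly_time \<Gamma> u (\<lambda>i. ys i {..<n i})"
    by (rule poly_time_cong[rotated]) (auto simp: ys_def intro: tab_cong)

  define best where "best = (\<lambda>i. select (\<lambda>p. occ i p {..<n i} \<noteq> 0) (preferred d (M i) (objective \<Gamma> i)))"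
  have best_step: "best i (Suc k) = (if occ i k {..<n i} = 0 then best i k
      else if of_bool (preferred d (M i) (objective \<Gamma> i) (best i k) k) = (0 :: int) then k else best i k)"
    for i k by (simp add: best_def)
  have "poly_time_int \<Gamma> u (\<lambda>i. int (best i (N i)))"
  proof (rule poly_time_iterate[OF N, where acc = "\<lambda>i k. Leaf (int (best i k))"])
    show "poly_time_int \<Gamma> u (\<lambda>i. int (best i 0))" using const by (simp add: best_def)
    show "poly_bounded (steps \<Gamma> (\<lambda>i. Suc (N i))) (\<lambda>j. val_length (Leaf (int (best (fst j) (snd j)))))"
    proof (rule poly_bounded_mono)
      show "poly_bounded (steps \<Gamma> (\<lambda>i. Suc (N i))) (\<lambda>j. 1 + N (fst j))"
        by (intro poly_bounded_add poly_bounded_const poly_bounded_fst[OF N(2)])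
      fix j assume "j \<in> idx (steps \<Gamma> (\<lambda>i. Suc (N i)))"
      then have "snd j \<le> N (fst j)" by simp
      then have "best (fst j) (snd j) \<le> N (fst j)"
        unfolding best_def by (rule order_trans[OF select_le])
      then show "val_length (Leaf (int (best (fst j) (snd j)))) \<le> 1 + N (fst j)"
        using bin_length_le_abs[of "int (best (fst j) (snd j))"] by simp
    qed
  next
    fix e
    assume b: "poly_time_int (steps \<Gamma> N) e (\<lambda>j. int (best (fst j) (snd j)))"
      and k: "poly_time_int (steps \<Gamma> N) e (\<lambda>j. int (snd j))"
      and lift: "\<And>h. poly_time \<Gamma> u h \<Longrightarrow> poly_time (steps \<Gamma> N) e (\<lambda>j. h (fst j))"
    \<comment> \<open>The determinant is recomputed for every candidate exponent, which is
      affordable as \<open>N i\<close> is polynomially bounded.\<close>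
    have o: "poly_time_int (steps \<Gamma> N) e (\<lambda>j. occ (fst j) (snd j) {..<n (fst j)})"
      unfolding occ_def
      by (rule poly_time_occurrence)
        (use lift[OF G] lift[OF T] lift[OF ys_all] k poly_bounded_snd[OF N(2)]
          in \<open>simp_all only: G_def T_def ys_def ex_def\<close>)
    have "poly_time_int (steps \<Gamma> N) e
        (\<lambda>j. of_bool (preferred d (M (fst j)) (objective \<Gamma> (fst j)) (best (fst j) (snd j)) (snd j)))"
      using poly_time_preferred[OF lift[OF M] b k] by (simp add: d_def)
    from poly_time_if[OF o b poly_time_if[OF this k b]]
    show "poly_time_int (steps \<Gamma> N) e (\<lambda>j. int (best (fst j) (Suc (snd j))))"
      by (rule poly_time_cong[rotated]) (simp add: best_step)
  qed
  moreover define p where "p = (\<lambda>i. best_exponent d (m i) (n i) (c i) (w i) (objective \<Gamma> i))"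
  ultimately have p: "poly_time_int \<Gamma> u (\<lambda>i. int (p i))"
    by (simp add: p_def best_exponent_def best_def N_def M_def ex_def occ_def)
  have p_bnd: "poly_bounded \<Gamma> p"
    by (rule poly_bounded_mono[OF N(2)])
      (unfold p_def best_exponent_def N_def ex_def, rule select_le)

  define R where "R = (\<lambda>i. shrink (\<lambda>R. occ i (p i) R \<noteq> 0) (n i))"
  define js where "js = (\<lambda>i k. encode_nats (rev (filter (\<lambda>j. j \<in> R i k) [0..<k])))"
  have R_Suc: "R i (Suc k) = (if occ i (p i) (R i k - {k}) = 0 then R i k else R i k - {k})" for i k
    by (simp add: R_def)
  have js_Suc: "js i (Suc k) = (if occ i (p i) (R i k - {k}) = 0 then Node (Leaf (int k)) (js i k) else js i k)"
    if "k < n i" for i k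
    unfolding js_def R_def filter_shrink[OF that] by (simp add: encode_nats_def)
  \<comment> \<open>The current set is represented by the list of values substituted for
    \<open>y\<close>, which is what the next determinant takes as input.\<close>
  have "poly_time \<Gamma> u (\<lambda>i. Node (ys i (R i (n i))) (js i (n i)))"
  proof (rule poly_time_iterate[OF n, where acc = "\<lambda>i k. Node (ys i (R i k)) (js i k)"])
    have "poly_time \<Gamma> u (\<lambda>i. Node (ys i {..<n i}) (Leaf 0))" by (rule poly_time_Node[OF ys_all const])
    then show "poly_time \<Gamma> u (\<lambda>i. Node (ys i (R i 0)) (js i 0))"
      by (simp add: R_def js_def encode_nats_def)
    have ys_le: "val_length (ys i A) \<le> val_length (ys i {..<n i})" for i A
      unfolding ys_def val_length_tab
      using bin_length_pos by (intro add_mono sum_mono) (auto simp: Suc_le_eq)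
    have js_le: "val_length (js i k) \<le> 1 + n i * (2 + n i)" if "k \<le> n i" for i k
    proof -
      let ?js = "rev (filter (\<lambda>j. j \<in> R i k) [0..<k])"
      have "val_length (js i k) = 1 + (\<Sum>j\<leftarrow>?js. 1 + bin_length (int j))"
        unfolding js_def encode_nats_def val_length_encode_list by (simp add: comp_def)
      also have "(\<Sum>j\<leftarrow>?js. 1 + bin_length (int j)) \<le> (\<Sum>j\<leftarrow>?js. 2 + n i)"
      proof (rule sum_list_mono)
        fix j assume "j \<in> set ?js"
        then show "1 + bin_length (int j) \<le> 2 + n i"
          using bin_length_le_abs[of "int j"] that by simp
      qed
      also have "\<dots> = length ?js * (2 + n i)" by (simp add: sum_list_triv)
      also have "\<dots> \<le> n i * (2 + n i)"
        using length_filter_le[of "\<lambda>j. j \<in> R i k" "[0..<k]"] that by (intro mult_right_mono) auto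
      finally show ?thesis by simp
    qed
    show "poly_bounded (steps \<Gamma> (\<lambda>i. Suc (n i)))
        (\<lambda>j. val_length (Node (ys (fst j) (R (fst j) (snd j))) (js (fst j) (snd j))))"
    proof (rule poly_bounded_mono)
      show "poly_bounded (steps \<Gamma> (\<lambda>i. Suc (n i))) (\<lambda>j. 1 + val_length (ys (fst j) {..<n (fst j)}) +
          (1 + n (fst j) * (2 + n (fst j))))"
        by (intro poly_bounded_add poly_bounded_mult poly_bounded_const poly_bounded_fst[OF n(2)]
            poly_bounded_fst[OF poly_time_imp_bounded(2)[OF ys_all]])
      fix j assume "j \<in> idx (steps \<Gamma> (\<lambda>i. Suc (n i)))"
      then have "snd j \<le> n (fst j)" by simp
      from js_le[OF this] ys_le[of "fst j" "R (fst j) (snd j)"]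
      show "val_length (Node (ys (fst j) (R (fst j) (snd j))) (js (fst j) (snd j)))
          \<le> 1 + val_length (ys (fst j) {..<n (fst j)}) + (1 + n (fst j) * (2 + n (fst j)))"
        unfolding val_length.simps by linarith
    qed
  next
    fix e
    assume acc: "poly_time (steps \<Gamma> n) e (\<lambda>j. Node (ys (fst j) (R (fst j) (snd j))) (js (fst j) (snd j)))"
      and k: "poly_time_int (steps \<Gamma> n) e (\<lambda>j. int (snd j))"
      and lift: "\<And>h. poly_time \<Gamma> u h \<Longrightarrow> poly_time (steps \<Gamma> n) e (\<lambda>j. h (fst j))"
    note y = poly_time_fst[OF acc] and j = poly_time_snd[OF acc]
    \<comment> \<open>Deleting an index means overwriting its value by 0; equality of indices is
      tested through their difference, since branching compares with 0.\<close>
    define z where "z = (\<lambda>j l. if int l - int (snd j) = 0 then 0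
      else if l \<in> R (fst j) (snd j) then T (fst j) ^ ex (fst j) l else (0 :: int))"
    have "poly_time (steps \<Gamma> n) e (\<lambda>j. int_tab (n (fst j)) (z j))"
    proof (rule poly_time_map2[OF lift[OF upto] y[unfolded ys_def]])
      let ?\<Gamma> = "steps (steps \<Gamma> n) (\<lambda>j. n (fst j))"
      fix e'
      assume l: "poly_time_int ?\<Gamma> e' (\<lambda>l. int (snd l))"
        and yl: "poly_time_int ?\<Gamma> e' (\<lambda>l. if snd l \<in> R (fst (fst l)) (snd (fst l))
            then T (fst (fst l)) ^ ex (fst (fst l)) (snd l) else 0)"
        and lift': "\<And>h. poly_time (steps \<Gamma> n) e h \<Longrightarrow> poly_time ?\<Gamma> e' (\<lambda>l. h (fst l))"
      from poly_time_if[OF poly_time_diff[OF l lift'[OF k]] poly_time_Const[OF l, of 0] yl]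
      show "poly_time_int ?\<Gamma> e' (\<lambda>l. z (fst l) (snd l))"
        by (rule poly_time_cong[rotated]) (simp add: z_def)
    qed
    then have y': "poly_time (steps \<Gamma> n) e (\<lambda>j. ys (fst j) (R (fst j) (snd j) - {snd j}))"
      by (rule poly_time_cong[rotated]) (auto simp: ys_def z_def intro: tab_cong)
    have "poly_time_int (steps \<Gamma> n) e (\<lambda>j. occ (fst j) (p (fst j)) (R (fst j) (snd j) - {snd j}))"
      unfolding occ_def
      by (rule poly_time_occurrence[OF _ _ _ lift[OF p] poly_bounded_fst[OF p_bnd]])
        (use lift[OF G] lift[OF T] y' in \<open>simp_all only: G_def T_def ys_def ex_def\<close>)
    from poly_time_if[OF this poly_time_Node[OF y poly_time_Node[OF k j]] poly_time_Node[OF y' j]]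
    show "poly_time (steps \<Gamma> n) e (\<lambda>j. Node (ys (fst j) (R (fst j) (Suc (snd j)))) (js (fst j) (Suc (snd j))))"
      by (rule poly_time_cong[rotated]) (simp add: R_Suc js_Suc)
  qed
  from poly_time_snd[OF this] show ?thesis
    by (simp add: js_def R_def best_set_def p_def occ_def)
qed

section \<open>The size of an instance\<close>

text \<open>Every entry has length at least 1, so the number of entries is a lower bound; with both
  dimensions positive it dominates each of them.\<close>

lemma dim_le_mat_bin_length:
  assumes "A \<in> carrier_mat m n" "0 < m" "0 < n"
  shows "m \<le> mat_bin_length A" "n \<le> mat_bin_length A"
proof -
  have "(\<Sum>i<m. \<Sum>j<n. 1) \<le> (\<Sum>i<m. \<Sum>j<n. bin_length (A $$ (i, j)))"
    by (intro sum_mono) (simp add: Suc_le_eq bin_length_pos)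
  then have "m * n \<le> mat_bin_length A" using assms(1) by (simp add: mat_bin_length_def)
  moreover have "m \<le> m * n" "n \<le> m * n" using assms by simp_all
  ultimately show "m \<le> mat_bin_length A" "n \<le> mat_bin_length A" by linarith+
qed

lemma le_max_abs_weight:
  assumes "i < d" "j < n"
  shows "nat \<bar>w i $ j\<bar> \<le> max_abs_weight d n w"
proof -
  have "{nat \<bar>w i $ j\<bar> | i j. i < d \<and> j < n} = (\<lambda>(i, j). nat \<bar>w i $ j\<bar>) ` ({..<d} \<times> {..<n})"
    by auto
  then show ?thesis
    unfolding max_abs_weight_def using assms by (intro Max_ge) auto
qed

lemma weight_bound_le: "nat (weight_bound d n w) \<le> d * (n * (max_abs_weight d n w)\<^sup>2)"
proof -
  have "weight_bound d n w \<le> (\<Sum>i<d. \<Sum>j<n. (int (max_abs_weight d n w))\<^sup>2)"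
    unfolding weight_bound_def
  proof (intro sum_mono)
    fix i j assume "i \<in> {..<d}" "j \<in> {..<n}"
    then have "\<bar>w i $ j\<bar> \<le> int (max_abs_weight d n w)" using le_max_abs_weight[of i d j n w] by simp
    then show "(w i $ j)\<^sup>2 \<le> (int (max_abs_weight d n w))\<^sup>2"
      using abs_le_square_iff[of "w i $ j" "int (max_abs_weight d n w)"] by simp
  qed
  also have "\<dots> = int (d * (n * (max_abs_weight d n w)\<^sup>2))" by simp
  finally show ?thesis by linarith
qed

lemma encode_instance_tab:
  assumes A: "A \<in> carrier_mat m n" and w: "\<And>i. i < d \<Longrightarrow> w i \<in> carrier_vec n"
  shows "encode_instance d A w = Node (Node (Leaf (int m)) (Leaf (int n)))
    (Node (tab m (\<lambda>r. int_tab n (\<lambda>j. A $$ (r, j)))) (tab d (\<lambda>k. int_tab n (\<lambda>j. w k $ j))))"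
proof -
  have vec: "encode_vec v = int_tab n (\<lambda>j. v $ j)" if "v \<in> carrier_vec n" for v
  proof -
    have "list_of_vec v = map (\<lambda>j. v $ j) [0..<n]"
      using that by (intro nth_equalityI) auto
    then show ?thesis by (simp add: encode_vec_def tab_def comp_def)
  qed
  have "map encode_vec (rows A) = map (\<lambda>r. int_tab n (\<lambda>j. A $$ (r, j))) [0..<m]"
  proof (rule nth_equalityI)
    fix r assume "r < length (map encode_vec (rows A))"
    then have r: "r < m" using A by simp
    then have "encode_vec (row A r) = int_tab n (\<lambda>j. row A r $ j)" using A by (intro vec) auto
    also have "\<dots> = int_tab n (\<lambda>j. A $$ (r, j))" using A r by (intro tab_cong) auto
    finally show "map encode_vec (rows A) ! r = map (\<lambda>r. int_tab n (\<lambda>j. A $$ (r, j))) [0..<m] ! r"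
      using A r by simp
  qed (use A in simp)
  moreover have "map (\<lambda>i. encode_vec (w i)) [0..<d] = map (\<lambda>k. int_tab n (\<lambda>j. w k $ j)) [0..<d]"
    by (intro map_cong refl vec w) simp
  ultimately show ?thesis
    unfolding encode_instance_def tab_def[of m] tab_def[of d] carrier_matD[OF A] by (simp only:)
qed

text \<open>The 7 gathers the three nodes above the data, the 1 in the length of each dimension and
  the ends of the two outer lists.\<close>

lemma val_length_instance_le:
  assumes A: "A \<in> carrier_mat m n" and w: "\<And>i. i < d \<Longrightarrow> w i \<in> carrier_vec n"
    and "0 < m" "0 < n" and s: "mat_bin_length A + max_abs_weight d n w \<le> s"
  shows "val_length (encode_instance d A w) \<le>
    7 + 2 * s + (s + s * (1 + s) + s) + (d + d * (1 + s + s * (1 + s)))"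
proof -
  have mn: "m \<le> s" "n \<le> s" using dim_le_mat_bin_length[OF A \<open>0 < m\<close> \<open>0 < n\<close>] s by auto
  have "(\<Sum>r<m. val_length (int_tab n (\<lambda>j. A $$ (r, j)))) = m * (1 + n) + mat_bin_length A"
    unfolding val_length_tab sum.distrib mat_bin_length_def carrier_matD[OF A]
    by (simp add: algebra_simps)
  also have "\<dots> \<le> s * (1 + s) + s" using mn s by (intro add_mono mult_le_mono) auto
  finally have 1: "val_length (tab m (\<lambda>r. int_tab n (\<lambda>j. A $$ (r, j)))) \<le> 1 + (s + s * (1 + s) + s)"
    unfolding val_length_tab[of m] using mn by linarith
  have "(\<Sum>k<d. val_length (int_tab n (\<lambda>j. w k $ j))) \<le> of_nat (card {..<d}) * (1 + s + s * (1 + s))"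
  proof (rule sum_bounded_above)
    fix k assume k: "k \<in> {..<d}"
    have "(\<Sum>j<n. val_length (Leaf (w k $ j))) \<le> of_nat (card {..<n}) * (1 + s)"
    proof (rule sum_bounded_above)
      fix j assume "j \<in> {..<n}"
      then show "val_length (Leaf (w k $ j)) \<le> 1 + s"
        using bin_length_le_abs[of "w k $ j"] le_max_abs_weight[of k d j n w] k s by simp
    qed
    also have "\<dots> \<le> s * (1 + s)" using mn by (intro mult_le_mono) auto
    finally show "val_length (int_tab n (\<lambda>j. w k $ j)) \<le> 1 + s + s * (1 + s)"
      unfolding val_length_tab using mn by linarith
  qed
  then have 2: "val_length (tab d (\<lambda>k. int_tab n (\<lambda>j. w k $ j))) \<le> 1 + (d + d * (1 + s + s * (1 + s)))"
    unfolding val_length_tab[of d] by simp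
  have "bin_length (int m) \<le> 1 + s" "bin_length (int n) \<le> 1 + s"
    using bin_length_le_abs[of "int m"] bin_length_le_abs[of "int n"] mn by auto
  moreover have "encode_instance d A w = Node (Node (Leaf (int m)) (Leaf (int n)))
      (Node (tab m (\<lambda>r. int_tab n (\<lambda>j. A $$ (r, j)))) (tab d (\<lambda>k. int_tab n (\<lambda>j. w k $ j))))"
    by (rule encode_instance_tab) (use A w in auto)
  ultimately show ?thesis using 1 2 by simp
qed

text \<open>\<open>[:[:1, 1:], 1:]\<close> is \<open>1 + x + y\<close>, read as a polynomial in
  \<open>x\<close> over polynomials in \<open>y\<close>.\<close>

lemma poly2_affine_power: "poly2 (Polynomial.smult [:a:] ([:[:1, 1:], 1:] ^ k)) x y = a * (1 + (x + y)) ^ k"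
  by (simp add: poly2_def poly_power algebra_simps)

theorem theorem1p3:
  fixes d :: nat
  assumes "0 < d"
  shows "\<exists>(P :: prog) (p :: nat poly poly).
    \<forall>(m :: nat) (n :: nat) (A :: int mat) (w :: nat \<Rightarrow> int vec) (f :: real vec \<Rightarrow> real).
      0 < m \<longrightarrow> 0 < n \<longrightarrow> A \<in> carrier_mat m n \<longrightarrow> (\<forall>i<d. w i \<in> carrier_vec n) \<longrightarrow>
      (\<exists>js t. exec d f P (encode_instance d A w) (encode_nats js) t \<and>
         distinct js \<and> optimal_base d A w f (set js) \<and>
         t \<le> poly2 p (mat_bin_length A) (max_abs_weight d n w))"
proof -
  define m :: "int mat \<times> (nat \<Rightarrow> int vec) \<times> (real vec \<Rightarrow> real) \<Rightarrow> nat" where "m = (\<lambda>(A, w, f). dim_row A)"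
  define n :: "int mat \<times> (nat \<Rightarrow> int vec) \<times> (real vec \<Rightarrow> real) \<Rightarrow> nat" where "n = (\<lambda>(A, w, f). dim_col A)"
  define c :: "int mat \<times> (nat \<Rightarrow> int vec) \<times> (real vec \<Rightarrow> real) \<Rightarrow> nat \<Rightarrow> nat \<Rightarrow> int"
    where "c = (\<lambda>(A, w, f) r j. A $$ (r, j))"
  define W :: "int mat \<times> (nat \<Rightarrow> int vec) \<times> (real vec \<Rightarrow> real) \<Rightarrow> nat \<Rightarrow> int vec" where "W = (\<lambda>(A, w, f). w)"
  \<comment> \<open>Instances include their oracle, so one program serves all \<open>f\<close>. The
    size adds both parameters, so that a monomial in \<open>1 + bound\<close> is a polynomial in the
    two.\<close>
  define \<Gamma> where "\<Gamma> = Family d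
    {(A, w, f). 0 < dim_row A \<and> 0 < dim_col A \<and> (\<forall>i<d. w i \<in> carrier_vec (dim_col A))}
    (\<lambda>(A, w, f). mat_bin_length A + max_abs_weight d (dim_col A) w) (\<lambda>(A, w, f :: real vec \<Rightarrow> real). f)"
  define u where "u = (\<lambda>(A, w, f :: real vec \<Rightarrow> real). encode_instance d A w)"
  have [simp]: "dim \<Gamma> = d" "objective \<Gamma> (A, w, f) = f"
    "bound \<Gamma> (A, w, f) = mat_bin_length A + max_abs_weight d (dim_col A) w"
    "(A, w, f) \<in> idx \<Gamma> \<longleftrightarrow> 0 < dim_row A \<and> 0 < dim_col A \<and> (\<forall>i<d. w i \<in> carrier_vec (dim_col A))"
    for A w f by (simp_all add: \<Gamma>_def)
  have n_le: "n i \<le> bound \<Gamma> i" if "i \<in> idx \<Gamma>" for i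
  proof (cases i)
    case (fields A w f)
    then show ?thesis using that dim_le_mat_bin_length(2)[of A "dim_row A" "dim_col A"] by (simp add: n_def)
  qed
  then have n: "poly_bounded \<Gamma> n" by (rule poly_bounded_mono[OF poly_bounded_bound])
  have "poly_bounded \<Gamma> (\<lambda>i. val_length (u i))"
  proof (rule poly_bounded_mono)
    let ?s = "bound \<Gamma>"
    show "poly_bounded \<Gamma> (\<lambda>i. 7 + 2 * ?s i + (?s i + ?s i * (1 + ?s i) + ?s i) +
        (d + d * (1 + ?s i + ?s i * (1 + ?s i))))"
      by (intro poly_bounded_add poly_bounded_mult poly_bounded_const poly_bounded_bound)
    show "val_length (u i) \<le> 7 + 2 * ?s i + (?s i + ?s i * (1 + ?s i) + ?s i) +
        (d + d * (1 + ?s i + ?s i * (1 + ?s i)))" if "i \<in> idx \<Gamma>" for i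
    proof (cases i)
      case (fields A w f)
      then show ?thesis
        using that val_length_instance_le[of A "dim_row A" "dim_col A" d w "?s i"] by (simp add: u_def)
    qed
  qed
  then have "poly_time \<Gamma> u u" by (rule poly_time_id)
  then have "poly_time \<Gamma> u (\<lambda>i. Node (Node (Leaf (int (m i))) (Leaf (int (n i))))
      (Node (tab (m i) (\<lambda>r. int_tab (n i) (c i r))) (tab d (\<lambda>k. int_tab (n i) (\<lambda>j. W i k $ j)))))"
    by (rule poly_time_cong[rotated])
      (auto simp: u_def m_def n_def c_def W_def encode_instance_tab[OF carrier_matI[OF refl refl]])
  note input = poly_time_fst[OF this] poly_time_snd[OF this]
  have W_bnd: "poly_bounded \<Gamma> (\<lambda>i. nat (weight_bound d (n i) (W i)))"
  proof (rule poly_bounded_mono)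
    show "poly_bounded \<Gamma> (\<lambda>i. d * (n i * (bound \<Gamma> i)\<^sup>2))"
      by (intro poly_bounded_mult poly_bounded_power poly_bounded_const poly_bounded_bound n)
    show "nat (weight_bound d (n i) (W i)) \<le> d * (n i * (bound \<Gamma> i)\<^sup>2)" if "i \<in> idx \<Gamma>" for i
    proof (cases i)
      case (fields A w f)
      have "d * (n i * (max_abs_weight d (n i) w)\<^sup>2) \<le> d * (n i * (bound \<Gamma> i)\<^sup>2)"
        by (intro mult_left_mono power_mono) (auto simp: fields n_def)
      moreover have "W i = w" by (simp add: fields W_def)
      ultimately show ?thesis using order_trans[OF weight_bound_le[of d "n i" w]] by (simp only:)
    qed
  qed
  have "poly_time \<Gamma> u (\<lambda>i. encode_nats (rev (filter
      (\<lambda>j. j \<in> best_set d (m i) (n i) (c i) (W i) (objective \<Gamma> i)) [0..<n i])))"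
    using poly_time_best_set[of \<Gamma> u n m c W, OF poly_time_snd[OF input(1)] n poly_time_fst[OF input(2)]]
      poly_time_nth[OF poly_time_snd[OF input(2)]] W_bnd by simp
  then obtain P \<tau> where \<tau>: "poly_bounded \<Gamma> \<tau>"
    and P: "\<And>i. i \<in> idx \<Gamma> \<Longrightarrow> exec (dim \<Gamma>) (objective \<Gamma> i) P (u i) (encode_nats (rev (filter
      (\<lambda>j. j \<in> best_set d (m i) (n i) (c i) (W i) (objective \<Gamma> i)) [0..<n i]))) (\<tau> i)"
    by (rule poly_timeE) blast
  obtain a k where ak: "\<And>i. i \<in> idx \<Gamma> \<Longrightarrow> \<tau> i \<le> a * (1 + bound \<Gamma> i) ^ k"
    using \<tau> unfolding poly_bounded_def by blast
  show ?thesis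
  proof (intro exI[of _ P] exI[of _ "Polynomial.smult [:a:] ([:[:1, 1:], 1:] ^ k)"] allI impI)
    fix m' n' :: nat and A :: "int mat" and w :: "nat \<Rightarrow> int vec" and f :: "real vec \<Rightarrow> real"
    assume "0 < m'" "0 < n'" and A: "A \<in> carrier_mat m' n'" and w: "\<forall>i<d. w i \<in> carrier_vec n'"
    then have i: "(A, w, f) \<in> idx \<Gamma>" by simp
    let ?B = "best_set d m' n' (\<lambda>r j. A $$ (r, j)) w f"
    let ?js = "rev (filter (\<lambda>j. j \<in> ?B) [0..<n'])"
    have "set ?js = ?B"
      using shrink_subset[of _ n' n'] by (auto simp: best_set_def)
    then have "optimal_base d A w f (set ?js)" using optimal_best_set[OF A] by simp
    moreover have "exec d f P (encode_instance d A w) (encode_nats ?js) (\<tau> (A, w, f))"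
      using P[OF i] A by (simp add: u_def m_def n_def c_def W_def)
    moreover have "\<tau> (A, w, f) \<le> poly2 (Polynomial.smult [:a:] ([:[:1, 1:], 1:] ^ k)) (mat_bin_length A) (max_abs_weight d n' w)"
      unfolding poly2_affine_power using ak[OF i] A by simp
    ultimately show "\<exists>js t. exec d f P (encode_instance d A w) (encode_nats js) t \<and>
         distinct js \<and> optimal_base d A w f (set js) \<and>
         t \<le> poly2 (Polynomial.smult [:a:] ([:[:1, 1:], 1:] ^ k)) (mat_bin_length A) (max_abs_weight d n' w)"
      by (intro exI[of _ ?js] exI[of _ "\<tau> (A, w, f)"]) simp
  qed
qed

end
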